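(* Let $m>0$ and let $A=(A_1,A_2,A_3)$, where each $A_j:\mathbb{R}^3\to\mathbb{R}$ ($j=1,2,3$) is a measurable function satisfying $|A_j(x)|\le C\langle x\rangle^{-\rho}$ with some $\rho>3/2$ and a positive constant $C$. Suppose that $f={}^t(\varphi^+,\varphi^-)$ belongs to $\mathcal{L}^{2,-s}$ for some $s$ with $0<s<\min(1,\rho-1)$ and satisfies $H_Af=mf$ (resp. $H_Af=-mf$) in the distributional sense. Then $f\in[H^1(\mathbb{R}^3)]^4$ and $\varphi^-=0$ (resp. $\varphi^+=0$).
   Context: $\langle x\rangle=\sqrt{1+|x|^2}$, $D=\frac1i\nabla_x$; $\sigma_1=\begin{pmatrix}0&1\\1&0\end{pmatrix}$, $\sigma_2=\begin{pmatrix}0&-i\\i&0\end{pmatrix}$, $\sigma_3=\begin{pmatrix}1&0\\0&-1\end{pmatrix}$ are the Pauli matrices; $\alpha_j=\begin{pmatrix}\mathbf 0&\sigma_j\\\sigma_j&\mathbf 0\end{pmatrix}$ $(j=1,2,3)$ and $\beta=\begin{pmatrix}I_2&\mathbf 0\\\mathbf 0&-I_2\end{pmatrix}$ are the Dirac matrices. Here $H_A=\alpha\cdot(D-A(x))+m\beta$ denotes the formal differential operator acting on $\mathbb{C}^4$-valued functions on $\mathbb{R}^3$ (in the sense of distributions). For $s\in\mathbb{R}$, $L^{2,s}(\mathbb{R}^3)=\{u\mid\langle x\rangle^su\in L^2(\mathbb{R}^3)\}$ and $\mathcal{L}^{2,s}=[L^{2,s}(\mathbb{R}^3)]^4$. In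 $f={}^t(\varphi^+,\varphi^-)$ the components $\varphi^\pm$ are $\mathbb{C}^2$-valued. $H^1(\mathbb{R}^3)$ is the Sobolev space of order 1. *)

theory Defs
  imports "HOL-Analysis.Analysis"
begin

section \<open>Dirac matrices\<close>

definition pauli :: "3 \<Rightarrow> complex^2^2" where
  "pauli j =
    (if j = 1 then vector [vector [0, 1], vector [1, 0]]
     else if j = 2 then vector [vector [0, -\<i>], vector [\<i>, 0]]
     else vector [vector [1, 0], vector [0, -1]])"

definition block :: "complex^2^2 \<Rightarrow> complex^2^2 \<Rightarrow> complex^2^2 \<Rightarrow> complex^2^2 \<Rightarrow> complex^4^4" where
  "block P Q R S = vector
    [vector [P$1$1, P$1$2, Q$1$1, Q$1$2],
     vector [P$2$1, P$2$2, Q$2$1, Q$2$2],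
     vector [R$1$1, R$1$2, S$1$1, S$1$2],
     vector [R$2$1, R$2$2, S$2$1, S$2$2]]"

definition dirac_alpha :: "3 \<Rightarrow> complex^4^4" where
  "dirac_alpha j = block 0 (pauli j) (pauli j) 0"

definition dirac_beta :: "complex^4^4" where
  "dirac_beta = block (mat 1) 0 0 (- mat 1)"

definition upper_spinor :: "(real^3 \<Rightarrow> complex^4) \<Rightarrow> real^3 \<Rightarrow> complex^2" where
  "upper_spinor f x = vector [f x $ 1, f x $ 2]"

definition lower_spinor :: "(real^3 \<Rightarrow> complex^4) \<Rightarrow> real^3 \<Rightarrow> complex^2" where
  "lower_spinor f x = vector [f x $ 3, f x $ 4]"

section \<open>Test functions and distributions\<close>

definition partial :: "3 \<Rightarrow> (real^3 \<Rightarrow> complex) \<Rightarrow> real^3 \<Rightarrow> complex" where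
  "partial j u x = frechet_derivative u (at x) (axis j 1)"

primrec C_k :: "nat \<Rightarrow> (real^3 \<Rightarrow> complex) \<Rightarrow> bool" where
  "C_k 0 u \<longleftrightarrow> continuous_on UNIV u"
| "C_k (Suc k) u \<longleftrightarrow> (\<forall>x. u differentiable (at x)) \<and> (\<forall>j. C_k k (partial j u))"

definition test_functions :: "(real^3 \<Rightarrow> complex) set" where
  "test_functions = {\<phi>. (\<forall>k. C_k k \<phi>) \<and> compact (closure {x. \<phi> x \<noteq> 0})}"

text \<open>
  Distributions, with values in \<open>complex^'n\<close>, are represented by their action on test functions;
  they are only ever compared on \<open>test_functions\<close>. The pairing is bilinear (no complex
  conjugation). The distribution \<open>distribution_of f\<close> is meaningful for locally integrable \<open>f\<close>, which
  includes every \<open>f\<close> in a weighted \<open>L2\<close> space and its products with bounded measurable functions.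
\<close>

type_synonym 'n distribution = "(real^3 \<Rightarrow> complex) \<Rightarrow> complex^'n"

definition distr_eq :: "'n::finite distribution \<Rightarrow> 'n distribution \<Rightarrow> bool" where
  "distr_eq S T \<longleftrightarrow> (\<forall>\<phi>\<in>test_functions. S \<phi> = T \<phi>)"

definition distribution_of :: "(real^3 \<Rightarrow> complex^'n) \<Rightarrow> 'n::finite distribution" where
  "distribution_of f \<phi> = (LINT x|lebesgue. \<phi> x *s f x)"

definition distr_partial :: "3 \<Rightarrow> 'n::finite distribution \<Rightarrow> 'n distribution" where
  "distr_partial j T \<phi> = - T (partial j \<phi>)"

definition distr_D :: "3 \<Rightarrow> 'n::finite distribution \<Rightarrow> 'n distribution" where
  "distr_D j T \<phi> = (1 / \<i>) *s distr_partial j T \<phi>"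

definition dirac_operator ::
  "real \<Rightarrow> (real^3 \<Rightarrow> real^3) \<Rightarrow> (real^3 \<Rightarrow> complex^4) \<Rightarrow> 4 distribution" where
  "dirac_operator m A f \<phi> =
    (\<Sum>j\<in>UNIV. dirac_alpha j *v
       (distr_D j (distribution_of f) \<phi> - distribution_of (\<lambda>x. complex_of_real (A x $ j) *s f x) \<phi>))
    + complex_of_real m *s (dirac_beta *v distribution_of f \<phi>)"

section \<open>Function spaces\<close>

text \<open>
  Elements of the spaces below are functions rather than equivalence classes; all the
  conditions are invariant under changes on Lebesgue null sets.
\<close>

definition japanese_bracket :: "real^3 \<Rightarrow> real" where
  "japanese_bracket x = sqrt (1 + (norm x)\<^sup>2)"

definition L2 :: "(real^3 \<Rightarrow> complex) set" where
  "L2 = {u. u \<in> borel_measurable lebesgue \<and> integrable lebesgue (\<lambda>x. (norm (u x))\<^sup>2)}"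

definition weighted_L2 :: "real \<Rightarrow> (real^3 \<Rightarrow> complex) set" where
  "weighted_L2 s = {u. (\<lambda>x. complex_of_real (japanese_bracket x powr s) * u x) \<in> L2}"

definition weak_partial :: "3 \<Rightarrow> (real^3 \<Rightarrow> complex) \<Rightarrow> (real^3 \<Rightarrow> complex) \<Rightarrow> bool" where
  "weak_partial j u v \<longleftrightarrow> (\<forall>\<phi>\<in>test_functions.
     (LINT x|lebesgue. u x * partial j \<phi> x) = - (LINT x|lebesgue. v x * \<phi> x))"

definition H1 :: "(real^3 \<Rightarrow> complex) set" where
  "H1 = {u\<in>L2. \<forall>j. \<exists>v\<in>L2. weak_partial j u v}"

definition componentwise_in :: "(real^3 \<Rightarrow> complex) set \<Rightarrow> (real^3 \<Rightarrow> complex^4) set" where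
  "componentwise_in X = {f. \<forall>k. (\<lambda>x. f x $ k) \<in> X}"

end

theory Submission
  imports Defs
begin

text \<open>
  Split the spinor into its two halves. At the threshold energies \<open>m\<close> and \<open>- m\<close> the mass cancels in one
  of the two resulting equations, and with \<open>S = \<sigma> . grad\<close> and \<open>P = \<i> \<sigma> . A\<close> the system becomes

    \<open>S u = P u\<close> and \<open>S w = P w + \<kappa> u\<close> with a real constant \<open>\<kappa> \<noteq> 0\<close>,

  where \<open>u\<close> is the half that is claimed to vanish and \<open>w\<close> is \<open>- \<i>\<close> times the other half
  (\<open>dirac_eigenvalue_equation_components\<close>, \<open>coupled_pair\<close>). Both \<open>S\<close> and \<open>P\<close> are antisymmetric for
  the real inner product. The proof then has three steps.

  \<^item> The half \<open>u\<close> vanishes. Pairing the two equations, cut off at radius \<open>R\<close>, leaves only \<open>\<kappa> \<integral>|u|\<^sup>2\<close> and a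
    commutator with the cutoff. By Young's inequality the former is bounded by \<open>R\<^sup>-\<^sup>2 \<integral>|w|\<^sup>2\<close> over the
    ball of radius \<open>R\<close>. As \<open>w\<close> is square integrable with weight \<open>|x|\<close> to the power \<open>- 2 s\<close>, this is of order
    \<open>R\<close> to the power \<open>2 s - 2\<close>, and \<open>s < 1\<close> (\<open>companion_component_zero\<close>).

  \<^item> The half \<open>w\<close>, now a solution of \<open>S w = P w\<close>, is square integrable. The operator \<open>S\<close> satisfies the
    Hardy inequality \<open>c \<integral>W |v|\<^sup>2 \<le> \<integral>(1 + |x|\<^sup>2) W |S v|\<^sup>2\<close> with \<open>W = (1 + \<delta> |x|\<^sup>2) powr (- s)\<close> and a
    constant \<open>c\<close> independent of \<open>\<delta>\<close> (\<open>damped_hardy_inequality\<close>): up to divergences the difference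
    of the integrands is a sum of squares. For the solution the right hand side is finite, because
    \<open>(1 + |x|\<^sup>2) |P w|\<^sup>2\<close> gains the decay \<open>2 - 2 \<rho> < - 2 s\<close>. For fixed \<open>\<delta>\<close> a cutoff can be removed, and
    then \<open>\<delta> \<rightarrow> 0\<close> (\<open>weighted_solution_square_integrable\<close>).

  \<^item> The gradient of \<open>w\<close> is square integrable, since \<open>\<integral>|grad v|\<^sup>2 = \<integral>|S v|\<^sup>2\<close> for smooth \<open>v\<close> and
    \<open>S w = P w\<close> is square integrable (\<open>weak_weyl_gradient\<close>).

  The hypotheses concern distributions while the last two steps are identities for smooth spinors of
  compact support. Mollification connects them: it commutes with \<open>S\<close> and converges in mean square, so
  a weak solution with compact support is approximated together with its image under \<open>S\<close>
  (\<open>weak_weyl_approximation\<close>).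
\<close>

section \<open>Partial derivatives and test functions\<close>

lemma partial_eqI: "(u has_derivative D) (at x) \<Longrightarrow> partial j u x = D (axis j 1)"
  by (simp add: partial_def frechet_derivative_at [symmetric])

lemma differentiable_has_partial_derivative:
  fixes u :: "real^3 \<Rightarrow> complex"
  assumes "u differentiable (at x)"
  shows "(u has_derivative (\<lambda>h. \<Sum>j\<in>UNIV. (h $ j) *\<^sub>R partial j u x)) (at x)"
proof -
  from assms obtain D where D: "(u has_derivative D) (at x)" by (auto simp: differentiable_def)
  interpret D: bounded_linear D using D by (rule has_derivative_bounded_linear)
  have "D h = (\<Sum>j\<in>UNIV. (h $ j) *\<^sub>R partial j u x)" for h
  proof -
    have "h = (\<Sum>j\<in>UNIV. (h $ j) *\<^sub>R axis j 1)"
      by (simp add: vec_eq_iff axis_def if_distrib cong: if_cong)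
    then have "D h = D (\<Sum>j\<in>UNIV. (h $ j) *\<^sub>R axis j 1)" by simp
    also have "\<dots> = (\<Sum>j\<in>UNIV. (h $ j) *\<^sub>R partial j u x)"
      by (simp add: D.sum D.scaleR partial_eqI[OF D])
    finally show ?thesis .
  qed
  then have "D = (\<lambda>h. \<Sum>j\<in>UNIV. (h $ j) *\<^sub>R partial j u x)" by auto
  with D show ?thesis by simp
qed

lemma partial_add:
  "\<lbrakk>u differentiable (at x); v differentiable (at x)\<rbrakk>
    \<Longrightarrow> partial j (\<lambda>x. u x + v x) x = partial j u x + partial j v x"
proof -
  assume "u differentiable (at x)" "v differentiable (at x)"
  then obtain D E where "(u has_derivative D) (at x)" "(v has_derivative E) (at x)"
    by (auto simp: differentiable_def)
  then show ?thesis
    using partial_eqI[OF has_derivative_add, of u D x v E j] by (simp add: partial_eqI)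
qed

lemma partial_mult:
  assumes "u differentiable (at x)" "v differentiable (at x)"
  shows "partial j (\<lambda>x. u x * v x) x = partial j u x * v x + u x * partial j v x"
proof -
  obtain D E where "(u has_derivative D) (at x)" "(v has_derivative E) (at x)"
    using assms by (auto simp: differentiable_def)
  then show ?thesis
    using partial_eqI[OF has_derivative_mult, of u D x v E j] by (simp add: partial_eqI)
qed

lemma partial_const [simp]: "partial j (\<lambda>_. c) = (\<lambda>_. 0)"
  by (simp add: partial_def fun_eq_iff)

lemma partial_cnj:
  assumes "u differentiable (at x)"
  shows "partial j (\<lambda>x. cnj (u x)) x = cnj (partial j u x)"
proof -
  obtain D where "(u has_derivative D) (at x)"
    using assms by (auto simp: differentiable_def)
  then show ?thesis
    using partial_eqI[OF has_derivative_cnj, of u D x j] by (simp add: partial_eqI)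
qed

lemma C_k_mono: "C_k (Suc k) u \<Longrightarrow> C_k k u"
proof (induction k arbitrary: u)
  case 0
  then show ?case
    by (auto intro!: continuous_at_imp_continuous_on differentiable_imp_continuous_within)
qed auto

lemma C_k_add: "C_k k u \<Longrightarrow> C_k k v \<Longrightarrow> C_k k (\<lambda>x. u x + v x)"
proof (induction k arbitrary: u v)
  case (Suc k)
  moreover have "partial j (\<lambda>x. u x + v x) = (\<lambda>x. partial j u x + partial j v x)" for j
    using Suc.prems by (auto simp: partial_add)
  ultimately show ?case by auto
qed (auto intro: continuous_on_add)

lemma C_k_mult: "C_k k u \<Longrightarrow> C_k k v \<Longrightarrow> C_k k (\<lambda>x. u x * v x)"
proof (induction k arbitrary: u v)
  case (Suc k)
  moreover have "partial j (\<lambda>x. u x * v x) = (\<lambda>x. partial j u x * v x + u x * partial j v x)" for j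
    using Suc.prems by (auto simp: partial_mult)
  ultimately show ?case
    using C_k_mono[OF Suc.prems(1)] C_k_mono[OF Suc.prems(2)] by (auto intro!: C_k_add)
qed (auto intro: continuous_on_mult)

lemma C_k_cnj: "C_k k u \<Longrightarrow> C_k k (\<lambda>x. cnj (u x))"
proof (induction k arbitrary: u)
  case (Suc k)
  moreover have "partial j (\<lambda>x. cnj (u x)) = (\<lambda>x. cnj (partial j u x))" for j
    using Suc.prems by (auto simp: partial_cnj)
  moreover have "(\<lambda>x. cnj (u x)) differentiable (at x)" for x
    using Suc.prems by (simp add: differentiable_cnj_iff)
  ultimately show ?case by auto
qed (auto intro: continuous_on_cnj)

text \<open>Smoothness without formulas for the higher derivatives: it suffices to exhibit a class of
  differentiable functions that contains \<open>u\<close> and is stable under partial derivatives. This is how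
  bumps, reflections and convolutions are seen to be smooth.\<close>

lemma C_k_of_partial_closed_class:
  assumes "u \<in> X"
    and "\<And>u x. u \<in> X \<Longrightarrow> u differentiable (at x)"
    and "\<And>u j. u \<in> X \<Longrightarrow> partial j u \<in> X"
  shows "C_k k u"
  using assms(1)
proof (induction k arbitrary: u)
  case 0
  then show ?case
    using assms(2) by (auto intro!: continuous_at_imp_continuous_on differentiable_imp_continuous_within)
qed (use assms in auto)

lemma C_k_const: "C_k k (\<lambda>_. c)"
  by (rule C_k_of_partial_closed_class[of _ "range (\<lambda>c _. c)"]) (auto simp: fun_eq_iff intro: rangeI)

text \<open>Compactness of the closed support, in the form in which it is used: vanishing outside a ball.\<close>

lemma test_functions_iff:
  "u \<in> test_functions \<longleftrightarrow> (\<forall>k. C_k k u) \<and> (\<exists>R. \<forall>x. norm x > R \<longrightarrow> u x = 0)"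
proof -
  have "compact (closure {x. u x \<noteq> 0}) \<longleftrightarrow> (\<exists>R. \<forall>x. norm x > R \<longrightarrow> u x = 0)"
    unfolding compact_closure bounded_iff
    by (smt (verit) mem_Collect_eq)
  then show ?thesis by (simp add: test_functions_def)
qed

lemma test_function_differentiable: "u \<in> test_functions \<Longrightarrow> u differentiable (at x)"
  unfolding test_functions_iff by (metis C_k.simps(2))

lemma test_function_continuous: "u \<in> test_functions \<Longrightarrow> continuous_on A u"
  unfolding test_functions_iff by (metis C_k.simps(1) continuous_on_subset subset_UNIV)

lemma partial_outside_support:
  fixes u :: "real^3 \<Rightarrow> complex"
  assumes "\<And>x. norm x > R \<Longrightarrow> u x = 0" "norm x > R"
  shows "partial j u x = 0"
proof -
  have "open (- cball (0::real^3) R)" by auto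
  moreover have "x \<in> - cball 0 R" using assms(2) by simp
  ultimately have "(u has_derivative (\<lambda>_. 0)) (at x)"
    using assms(1)
    by (intro has_derivative_transform_within_open[OF has_derivative_const[where c=0]]) auto
  then show ?thesis by (rule partial_eqI)
qed

lemma test_function_partial: "u \<in> test_functions \<Longrightarrow> partial j u \<in> test_functions"
  unfolding test_functions_iff by (metis C_k.simps(2) partial_outside_support)

lemma test_function_add:
  assumes "u \<in> test_functions" "v \<in> test_functions"
  shows "(\<lambda>x. u x + v x) \<in> test_functions"
proof -
  obtain R S where "\<forall>x. norm x > R \<longrightarrow> u x = 0" "\<forall>x. norm x > S \<longrightarrow> v x = 0"
    using assms by (auto simp: test_functions_iff)
  then have "\<forall>x. norm x > max R S \<longrightarrow> u x + v x = 0" by simp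
  then show ?thesis using assms unfolding test_functions_iff by (blast intro: C_k_add)
qed

lemma test_function_mult_smooth:
  "u \<in> test_functions \<Longrightarrow> (\<And>k. C_k k v) \<Longrightarrow> (\<lambda>x. u x * v x) \<in> test_functions"
  unfolding test_functions_iff by (metis C_k_mult mult_zero_left)

lemma test_function_mult:
  "u \<in> test_functions \<Longrightarrow> v \<in> test_functions \<Longrightarrow> (\<lambda>x. u x * v x) \<in> test_functions"
  by (rule test_function_mult_smooth) (auto simp: test_functions_iff)

lemma test_function_cnj: "u \<in> test_functions \<Longrightarrow> (\<lambda>x. cnj (u x)) \<in> test_functions"
  unfolding test_functions_iff by (metis C_k_cnj complex_cnj_zero)

lemma test_function_of_partial_closed_class:
  assumes "u \<in> X"
    and "\<And>u x. u \<in> X \<Longrightarrow> u differentiable (at x)"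
    and "\<And>u j. u \<in> X \<Longrightarrow> partial j u \<in> X"
    and "\<And>x. norm x > R \<Longrightarrow> u x = 0"
  shows "u \<in> test_functions"
  using C_k_of_partial_closed_class[OF assms(1-3)] assms(4) unfolding test_functions_iff by blast

lemma test_function_mult_const: "u \<in> test_functions \<Longrightarrow> (\<lambda>x. u x * c) \<in> test_functions"
  by (rule test_function_mult_smooth) (auto simp: C_k_const)

section \<open>A smooth bump\<close>

text \<open>The function \<open>exp (- 1 / t)\<close>, flat at \<open>0\<close>, together with the extra factors \<open>1 / t ^ k\<close> that
  its derivatives produce.\<close>

definition flat_exp :: "nat \<Rightarrow> real \<Rightarrow> real" where
  "flat_exp k t = (if t > 0 then exp (- 1 / t) / t ^ k else 0)"

lemma flat_exp_nonneg: "flat_exp k t \<ge> 0"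
  by (simp add: flat_exp_def)

lemma flat_exp_tendsto_0: "flat_exp k \<midarrow>0\<rightarrow> 0"
proof -
  have "((\<lambda>t::real. inverse t ^ k / exp (inverse t)) \<longlongrightarrow> 0) (at_right 0)"
    by (rule filterlim_compose[OF tendsto_power_div_exp_0 filterlim_inverse_at_top_right])
  moreover have "\<forall>\<^sub>F t in at_right 0. inverse t ^ k / exp (inverse t) = flat_exp k t"
    by (auto simp: eventually_at_filter flat_exp_def exp_minus field_simps)
  ultimately have "(flat_exp k \<longlongrightarrow> 0) (at_right 0)"
    by (rule Lim_transform_eventually)
  moreover have "(flat_exp k \<longlongrightarrow> 0) (at_left 0)"
    by (rule tendsto_eventually) (auto simp: eventually_at_filter flat_exp_def)
  ultimately show ?thesis by (intro filterlim_split_at)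
qed

text \<open>At \<open>t = 0\<close> the difference quotient of \<open>flat_exp k\<close> is \<open>flat_exp (k + 1)\<close>, which tends to \<open>0\<close>
  because the exponential beats every power.\<close>

lemma flat_exp_has_derivative:
  "(flat_exp k has_real_derivative flat_exp (k + 2) t - k * flat_exp (k + 1) t) (at t)"
proof -
  consider "t < 0" | "t = 0" | "t > 0" by linarith
  then show ?thesis
  proof cases
    case 1
    have "(flat_exp k has_real_derivative 0) (at t)"
      by (rule DERIV_cong_ev[OF refl _ refl, THEN iffD1, OF _ DERIV_const])
        (use 1 in \<open>auto simp: flat_exp_def eventually_nhds intro!: exI[of _ "{..<0}"]\<close>)
    then show ?thesis using 1 by (simp add: flat_exp_def)
  next
    case 2
    have "(\<lambda>h. (flat_exp k (0 + h) - flat_exp k 0) / h) \<midarrow>0\<rightarrow> 0"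
      by (rule Lim_transform_eventually[OF flat_exp_tendsto_0[of "k + 1"]])
        (auto simp: eventually_at_filter flat_exp_def)
    then show ?thesis using 2 by (simp add: DERIV_def flat_exp_def)
  next
    case 3
    have "((\<lambda>t. exp (- 1 / t)) has_real_derivative exp (- 1 / t) / t ^ 2) (at t)"
      using 3 by (auto intro!: derivative_eq_intros simp: power2_eq_square)
    moreover have "((\<lambda>t. t ^ k) has_real_derivative k * t ^ k / t) (at t)"
      by (rule DERIV_cong[OF DERIV_pow]) (use 3 in \<open>cases k; simp\<close>)
    ultimately have *: "((\<lambda>t. exp (- 1 / t) / t ^ k) has_real_derivative
        exp (- 1 / t) / t ^ (k + 2) - k * (exp (- 1 / t) / t ^ (k + 1))) (at t)"
      by (rule DERIV_cong[OF DERIV_divide])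
        (use 3 in \<open>simp_all add: divide_simps power2_eq_square algebra_simps\<close>)
    have "(flat_exp k has_real_derivative
        exp (- 1 / t) / t ^ (k + 2) - k * (exp (- 1 / t) / t ^ (k + 1))) (at t)"
      by (rule DERIV_cong_ev[OF refl _ refl, THEN iffD1, OF _ *])
        (use 3 in \<open>auto simp: flat_exp_def eventually_nhds intro!: exI[of _ "{0<..}"]\<close>)
    then show ?thesis using 3 by (simp add: flat_exp_def)
  qed
qed

text \<open>The radial bumps and their products with polynomials form a class that is closed under partial
  derivatives.\<close>

inductive_set bump_class :: "real \<Rightarrow> real \<Rightarrow> (real^3 \<Rightarrow> complex) set" for a c where
  base: "(\<lambda>x. of_real (flat_exp k (a - c * (norm x)\<^sup>2))) \<in> bump_class a c"
| scale: "u \<in> bump_class a c \<Longrightarrow> (\<lambda>x. z * u x) \<in> bump_class a c"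
| coord: "u \<in> bump_class a c \<Longrightarrow> (\<lambda>x. of_real (x $ j) * u x) \<in> bump_class a c"
| plus: "u \<in> bump_class a c \<Longrightarrow> v \<in> bump_class a c \<Longrightarrow> (\<lambda>x. u x + v x) \<in> bump_class a c"

lemma has_derivative_coord: "((\<lambda>x::real^3. complex_of_real (x $ j)) has_derivative (\<lambda>h. of_real (h $ j))) (at x)"
  by (rule bounded_linear.has_derivative[OF bounded_linear_of_real
        bounded_linear.has_derivative[OF bounded_linear_vec_nth has_derivative_ident]])

lemma has_derivative_flat_exp_norm:
  "((\<lambda>x::real^3. complex_of_real (flat_exp k (a - c * (norm x)\<^sup>2))) has_derivative
    (\<lambda>h. of_real (- 2 * c * (x \<bullet> h) * (flat_exp (k + 2) (a - c * (norm x)\<^sup>2) - k * flat_exp (k + 1) (a - c * (norm x)\<^sup>2))))) (at x)"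
proof -
  have "((\<lambda>x::real^3. a - c * (x \<bullet> x)) has_derivative (\<lambda>h. - 2 * c * (x \<bullet> h))) (at x)"
    by (auto intro!: derivative_eq_intros simp: inner_commute algebra_simps)
  then have "((\<lambda>x::real^3. flat_exp k (a - c * (x \<bullet> x))) has_derivative
    (\<lambda>h. (- 2 * c * (x \<bullet> h)) * (flat_exp (k + 2) (a - c * (x \<bullet> x)) - k * flat_exp (k + 1) (a - c * (x \<bullet> x))))) (at x)"
    by (rule has_derivative_eq_rhs[OF has_derivative_compose[OF _ flat_exp_has_derivative[unfolded has_field_derivative_def]]])
      (simp add: fun_eq_iff)
  from bounded_linear.has_derivative[OF bounded_linear_of_real this]
  show ?thesis by (simp add: power2_norm_eq_inner)
qed

lemma bump_class_partial:
  assumes "u \<in> bump_class a c"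
  shows "(\<forall>x. u differentiable (at x)) \<and> (\<forall>j. partial j u \<in> bump_class a c)"
  using assms
proof induction
  case (base k)
  let ?f = "\<lambda>k x::real^3. complex_of_real (flat_exp k (a - c * (norm x)\<^sup>2))"
  have "partial j (?f k) =
      (\<lambda>x. of_real (x $ j) * ((- 2 * of_real c) * ?f (k + 2) x + (2 * of_real c * of_nat k) * ?f (k + 1) x))" for j
    by (rule ext, subst partial_eqI[OF has_derivative_flat_exp_norm])
      (simp add: inner_axis algebra_simps)
  moreover have "(\<lambda>x. of_real (x $ j) * ((- 2 * of_real c) * ?f (k + 2) x + (2 * of_real c * of_nat k) * ?f (k + 1) x)) \<in> bump_class a c" for j
    by (intro bump_class.intros)
  moreover have "?f k differentiable (at x)" for x
    using has_derivative_flat_exp_norm[of k a c] unfolding differentiable_def by blast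
  ultimately show ?case by simp
next
  case (scale u z)
  then have "partial j (\<lambda>x. z * u x) = (\<lambda>x. z * partial j u x)" for j
    by (auto simp: partial_mult)
  then show ?case using scale by (auto intro: bump_class.intros differentiable_mult)
next
  case (coord u i)
  have d: "(\<lambda>x::real^3. complex_of_real (x $ i)) differentiable (at x)" for x
    using has_derivative_coord by (auto simp: differentiable_def)
  have "partial j (\<lambda>x. complex_of_real (x $ i)) x = (if i = j then 1 else 0)" for j and x :: "real^3"
    by (subst partial_eqI[OF has_derivative_coord]) (simp add: axis_def)
  then have "partial j (\<lambda>x. of_real (x $ i) * u x) =
      (\<lambda>x. (if i = j then 1 else 0) * u x + of_real (x $ i) * partial j u x)" for j
    using coord d by (auto simp: partial_mult)
  then show ?case using coord d by (auto intro!: bump_class.intros differentiable_mult)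
next
  case (plus u v)
  then have "partial j (\<lambda>x. u x + v x) = (\<lambda>x. partial j u x + partial j v x)" for j
    by (auto simp: partial_add)
  then show ?case using plus by (auto intro: bump_class.intros)
qed

text \<open>The parameters serve two purposes: \<open>a \<rightarrow> 0\<close> with \<open>c = 1\<close> gives mollifiers with shrinking support,
  \<open>c \<rightarrow> 0\<close> with \<open>a = 1\<close> gives cutoffs with growing support.\<close>

definition bump :: "real \<Rightarrow> real \<Rightarrow> real^3 \<Rightarrow> real" where
  "bump a c x = flat_exp 0 (a - c * (norm x)\<^sup>2)"

lemma bump_nonneg: "bump a c x \<ge> 0"
  by (simp add: bump_def flat_exp_nonneg)

lemma bump_outside: "c > 0 \<Longrightarrow> R > 0 \<Longrightarrow> a \<le> c * R\<^sup>2 \<Longrightarrow> norm x \<ge> R \<Longrightarrow> bump a c x = 0"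
proof -
  assume *: "c > 0" "R > 0" "a \<le> c * R\<^sup>2" "norm x \<ge> R"
  then have "c * R\<^sup>2 \<le> c * (norm x)\<^sup>2" by (intro mult_left_mono power_mono) auto
  with *(3) have "\<not> a - c * (norm x)\<^sup>2 > 0" by linarith
  then show ?thesis by (simp add: bump_def flat_exp_def)
qed

lemma bump_test_function:
  assumes "c > 0"
  shows "(\<lambda>x. complex_of_real (bump a c x)) \<in> test_functions"
proof (rule test_function_of_partial_closed_class[of _ "bump_class a c" "1 + \<bar>a\<bar> / c"])
  show "complex_of_real (bump a c x) = 0" if "norm x > 1 + \<bar>a\<bar> / c" for x :: "real^3"
  proof -
    have "c * (1 + \<bar>a\<bar> / c) = c + \<bar>a\<bar>" using assms by (simp add: distrib_left)
    then have "a \<le> c * (1 + \<bar>a\<bar> / c)" using assms by linarith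
    also have "\<dots> \<le> c * (1 + \<bar>a\<bar> / c)\<^sup>2"
      using assms self_le_power[of "1 + \<bar>a\<bar> / c" 2] by (intro mult_left_mono) auto
    finally have "bump a c x = 0"
      using assms that by (intro bump_outside[where R="1 + \<bar>a\<bar> / c"]) (auto intro: add_pos_nonneg)
    then show ?thesis by simp
  qed
  show "(\<lambda>x. complex_of_real (bump a c x)) \<in> bump_class a c"
    unfolding bump_def by (rule bump_class.base)
qed (use bump_class_partial in auto)

section \<open>Square integrable functions\<close>

lemma tendsto_inverse_real_plus_1: "(\<lambda>n. 1 / (real n + 1)) \<longlonglongrightarrow> 0"
  using LIMSEQ_inverse_real_of_nat by (simp add: inverse_eq_divide add.commute)

definition square_integrable :: "'a measure \<Rightarrow> ('a \<Rightarrow> 'b::euclidean_space) \<Rightarrow> bool" where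
  "square_integrable M u \<longleftrightarrow> u \<in> borel_measurable M \<and> integrable M (\<lambda>x. (norm (u x))\<^sup>2)"

definition mean_square :: "'a measure \<Rightarrow> ('a \<Rightarrow> 'b::euclidean_space) \<Rightarrow> real" where
  "mean_square M u = (LINT x|M. (norm (u x))\<^sup>2)"

lemma mean_square_nonneg [simp]: "mean_square M u \<ge> 0"
  by (simp add: mean_square_def)

lemma square_integrable_bound:
  assumes "square_integrable M u" "v \<in> borel_measurable M" "\<And>x. norm (v x) \<le> c * norm (u x)"
  shows "square_integrable M v"
  unfolding square_integrable_def
proof
  show "integrable M (\<lambda>x. (norm (v x))\<^sup>2)"
  proof (rule Bochner_Integration.integrable_bound)
    show "integrable M (\<lambda>x. c\<^sup>2 * (norm (u x))\<^sup>2)"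
      using assms(1) by (simp add: square_integrable_def)
    show "AE x in M. norm ((norm (v x))\<^sup>2) \<le> norm (c\<^sup>2 * (norm (u x))\<^sup>2)"
      using power_mono[OF assms(3), of _ 2] by (simp add: power_mult_distrib)
  qed (use assms(2) in measurable)
qed fact

lemma mean_square_mono:
  assumes "square_integrable M u" "v \<in> borel_measurable M" "\<And>x. norm (v x) \<le> norm (u x)"
  shows "mean_square M v \<le> mean_square M u"
  using square_integrable_bound[of M u v 1] assms
  by (auto simp: mean_square_def square_integrable_def intro!: integral_mono)

lemma square_integrable_norm_mult:
  assumes "square_integrable M u" "square_integrable M v"
  shows "integrable M (\<lambda>x. norm (u x) * norm (v x))"
proof (rule Bochner_Integration.integrable_bound)
  show "integrable M (\<lambda>x. (norm (u x))\<^sup>2 + (norm (v x))\<^sup>2)"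
    using assms by (auto simp: square_integrable_def)
  have "norm (u x) * norm (v x) \<le> (norm (u x))\<^sup>2 + (norm (v x))\<^sup>2" for x
    using sum_squares_bound[of "norm (u x)" "norm (v x)"] mult_nonneg_nonneg[OF norm_ge_zero norm_ge_zero, of "u x" "v x"]
    by linarith
  then show "AE x in M. norm (norm (u x) * norm (v x)) \<le> norm ((norm (u x))\<^sup>2 + (norm (v x))\<^sup>2)"
    by simp
qed (use assms in \<open>auto simp: square_integrable_def\<close>)

lemma borel_measurable_bounded_linear:
  fixes L :: "'b::euclidean_space \<Rightarrow> 'c::euclidean_space"
  assumes "bounded_linear L" "u \<in> borel_measurable M"
  shows "(\<lambda>x. L (u x)) \<in> borel_measurable M"
  by (rule measurable_compose[OF assms(2) borel_measurable_continuous_onI[OF linear_continuous_on[OF assms(1)]]])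

lemma borel_measurable_bounded_bilinear:
  fixes B :: "'b::euclidean_space \<Rightarrow> 'c::euclidean_space \<Rightarrow> 'd::euclidean_space"
  assumes "bounded_bilinear B" "u \<in> borel_measurable M" "v \<in> borel_measurable M"
  shows "(\<lambda>x. B (u x) (v x)) \<in> borel_measurable M"
proof -
  have "continuous_on UNIV (\<lambda>p. B (fst p) (snd p))"
    by (intro continuous_on_eq_continuous_within[THEN iffD2] ballI
        bounded_bilinear.continuous[OF assms(1)] continuous_fst continuous_snd continuous_ident)
  then have "(\<lambda>p. B (fst p) (snd p)) \<in> borel_measurable borel"
    by (rule borel_measurable_continuous_onI)
  moreover have "(\<lambda>x. (u x, v x)) \<in> borel_measurable M"
    using assms by auto
  ultimately show ?thesis
    using measurable_compose[of "\<lambda>x. (u x, v x)" M borel "\<lambda>p. B (fst p) (snd p)"] by simp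
qed

lemma square_integrable_bilinear:
  assumes "square_integrable M u" "square_integrable M v" "bounded_bilinear B"
  shows "integrable M (\<lambda>x. B (u x) (v x) :: 'c::euclidean_space)"
proof -
  obtain K where K: "\<And>a b. norm (B a b) \<le> norm a * norm b * K"
    using bounded_bilinear.bounded[OF assms(3)] by blast
  show ?thesis
  proof (rule Bochner_Integration.integrable_bound)
    show "integrable M (\<lambda>x. norm (u x) * norm (v x) * K)"
      using square_integrable_norm_mult[OF assms(1,2)] by simp
    show "AE x in M. norm (B (u x) (v x)) \<le> norm (norm (u x) * norm (v x) * K)"
    proof (intro always_eventually allI)
      show "norm (B (u x) (v x)) \<le> norm (norm (u x) * norm (v x) * K)" for x
        using K[of "u x" "v x"] by (metis abs_ge_self order_trans real_norm_def)
    qed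
    show "(\<lambda>x. B (u x) (v x)) \<in> borel_measurable M"
      using assms by (intro borel_measurable_bounded_bilinear[OF assms(3)]) (auto simp: square_integrable_def)
  qed
qed

lemma norm_add_sq_le: "(norm (a + b))\<^sup>2 \<le> 2 * (norm a)\<^sup>2 + 2 * (norm (b::'b::real_normed_vector))\<^sup>2"
proof -
  have "(norm (a + b))\<^sup>2 \<le> (norm a + norm b)\<^sup>2"
    by (intro power_mono norm_triangle_ineq) simp
  then show ?thesis
    using sum_squares_bound[of "norm a" "norm b"] by (simp add: power2_sum)
qed

lemma square_integrable_add:
  assumes "square_integrable M u" "square_integrable M v"
  shows "square_integrable M (\<lambda>x. u x + v x)"
    and "mean_square M (\<lambda>x. u x + v x) \<le> 2 * mean_square M u + 2 * mean_square M v"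
proof -
  show *: "square_integrable M (\<lambda>x. u x + v x)"
    unfolding square_integrable_def
  proof
    show "(\<lambda>x. u x + v x) \<in> borel_measurable M"
      using assms by (auto simp: square_integrable_def)
    show "integrable M (\<lambda>x. (norm (u x + v x))\<^sup>2)"
    proof (rule Bochner_Integration.integrable_bound)
      show "integrable M (\<lambda>x. 2 * (norm (u x))\<^sup>2 + 2 * (norm (v x))\<^sup>2)"
        using assms by (auto simp: square_integrable_def)
      show "AE x in M. norm ((norm (u x + v x))\<^sup>2) \<le> norm (2 * (norm (u x))\<^sup>2 + 2 * (norm (v x))\<^sup>2)"
        using norm_add_sq_le by (auto intro!: always_eventually)
    qed (use assms in \<open>auto simp: square_integrable_def\<close>)
  qed
  have "mean_square M (\<lambda>x. u x + v x) \<le> (LINT x|M. 2 * (norm (u x))\<^sup>2 + 2 * (norm (v x))\<^sup>2)"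
    using * assms norm_add_sq_le unfolding mean_square_def
    by (intro integral_mono) (auto simp: square_integrable_def)
  then show "mean_square M (\<lambda>x. u x + v x) \<le> 2 * mean_square M u + 2 * mean_square M v"
    using assms by (simp add: mean_square_def square_integrable_def)
qed

lemma square_integrable_diff:
  assumes "square_integrable M u" "square_integrable M v"
  shows "square_integrable M (\<lambda>x. u x - v x)"
    and "mean_square M (\<lambda>x. u x - v x) \<le> 2 * mean_square M u + 2 * mean_square M v"
proof -
  have "square_integrable M (\<lambda>x. - v x)"
    using assms(2) by (auto simp: square_integrable_def)
  from square_integrable_add[OF assms(1) this]
  show "square_integrable M (\<lambda>x. u x - v x)"
    and "mean_square M (\<lambda>x. u x - v x) \<le> 2 * mean_square M u + 2 * mean_square M v"
    by (auto simp: mean_square_def)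
qed

text \<open>The polynomial \<open>t\<^sup>2 |u|\<^sup>2 - 2 t \<integral>|u||v| + |v|\<^sup>2\<close> is nonnegative. Evaluating it at its minimum gives the
  claim; if the leading coefficient vanishes, a nonzero linear coefficient would make it negative
  for some \<open>t\<close>.\<close>

lemma Cauchy_Schwarz_integral:
  assumes "square_integrable M u" "square_integrable M v"
  shows "(LINT x|M. norm (u x) * norm (v x)) \<le> sqrt (mean_square M u) * sqrt (mean_square M v)"
proof -
  let ?I = "LINT x|M. norm (u x) * norm (v x)" and ?a = "mean_square M u" and ?b = "mean_square M v"
  have I0: "?I \<ge> 0" by simp
  have q: "0 \<le> t\<^sup>2 * ?a - 2 * t * ?I + ?b" for t
  proof -
    have "0 \<le> (LINT x|M. (t * norm (u x) - norm (v x))\<^sup>2)" by simp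
    also have "\<dots> = (LINT x|M. t\<^sup>2 * (norm (u x))\<^sup>2 - 2 * t * (norm (u x) * norm (v x)) + (norm (v x))\<^sup>2)"
      by (rule arg_cong[where f="integral\<^sup>L M"]) (auto simp: power2_eq_square algebra_simps)
    also have "\<dots> = t\<^sup>2 * ?a - 2 * t * ?I + ?b"
      using assms square_integrable_norm_mult[OF assms]
      by (simp add: square_integrable_def mean_square_def)
    finally show ?thesis .
  qed
  have "?I\<^sup>2 \<le> ?a * ?b"
  proof (cases "?a = 0")
    case True
    have "?I = 0"
    proof (rule ccontr)
      assume "?I \<noteq> 0"
      then have "2 * ((?b + 1) / (2 * ?I)) * ?I = ?b + 1" by simp
      then show False using q[of "(?b + 1) / (2 * ?I)"] True by simp
    qed
    then show ?thesis by simp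
  next
    case False
    then have a: "?a > 0" using mean_square_nonneg[of M u] by linarith
    have "(?I / ?a)\<^sup>2 * ?a = ?I\<^sup>2 / ?a" "2 * (?I / ?a) * ?I = 2 * (?I\<^sup>2 / ?a)"
      using a by (simp_all add: power2_eq_square)
    with q[of "?I / ?a"] have "?I\<^sup>2 / ?a \<le> ?b" by linarith
    then show ?thesis using a by (simp add: pos_divide_le_eq mult.commute)
  qed
  then show ?thesis
    using I0 by (metis real_le_rsqrt real_sqrt_mult)
qed

lemma mean_square_convergent_bilinear:
  fixes B :: "'b::euclidean_space \<Rightarrow> 'c::euclidean_space \<Rightarrow> 'd::euclidean_space"
  assumes "\<And>n. square_integrable M (v n)" "square_integrable M u" "square_integrable M w"
    and lim: "(\<lambda>n. mean_square M (\<lambda>x. v n x - u x)) \<longlonglongrightarrow> 0"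
    and B: "bounded_bilinear B"
  shows "(\<lambda>n. LINT x|M. B (v n x) (w x)) \<longlonglongrightarrow> (LINT x|M. B (u x) (w x))"
proof -
  interpret B: bounded_bilinear B by fact
  obtain K where K: "K > 0" "\<And>a b. norm (B a b) \<le> norm a * norm b * K"
    using B.pos_bounded by blast
  have "norm ((LINT x|M. B (v n x) (w x)) - (LINT x|M. B (u x) (w x)))
      \<le> sqrt (mean_square M (\<lambda>x. v n x - u x)) * sqrt (mean_square M w) * K" for n
  proof -
    have d: "square_integrable M (\<lambda>x. v n x - u x)" by (intro square_integrable_diff assms)
    have "(LINT x|M. B (v n x) (w x)) - (LINT x|M. B (u x) (w x)) = (LINT x|M. B (v n x - u x) (w x))"
      using assms by (simp add: B.diff_left square_integrable_bilinear)
    also have "norm \<dots> \<le> (LINT x|M. norm (B (v n x - u x) (w x)))"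
      by (rule integral_norm_bound)
    also have "\<dots> \<le> (LINT x|M. norm (v n x - u x) * norm (w x) * K)"
      using K d assms
      by (intro integral_mono integrable_norm square_integrable_bilinear integrable_mult_left square_integrable_norm_mult) auto
    also have "\<dots> = (LINT x|M. norm (v n x - u x) * norm (w x)) * K" by simp
    also have "\<dots> \<le> sqrt (mean_square M (\<lambda>x. v n x - u x)) * sqrt (mean_square M w) * K"
      using K by (intro mult_right_mono Cauchy_Schwarz_integral d assms) auto
    finally show ?thesis .
  qed
  moreover have "(\<lambda>n. sqrt (mean_square M (\<lambda>x. v n x - u x)) * sqrt (mean_square M w) * K) \<longlonglongrightarrow> 0"
    using lim by (auto intro!: tendsto_eq_intros)
  ultimately have "(\<lambda>n. (LINT x|M. B (v n x) (w x)) - (LINT x|M. B (u x) (w x))) \<longlonglongrightarrow> 0"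
    by (rule Lim_null_comparison[OF always_eventually, OF allI])
  then show ?thesis by (rule LIM_zero_cancel)
qed

text \<open>Expanding \<open>|v n|\<^sup>2\<close> around \<open>u\<close> leaves a term quadratic in \<open>v n - u\<close>, controlled by the mean square
  distance, and one that is linear in \<open>v n\<close>, to which the convergence of bilinear pairings applies.\<close>

lemma mean_square_convergent_weighted:
  fixes b :: "'a \<Rightarrow> real"
  assumes v: "\<And>n. square_integrable M (v n)" and u: "square_integrable M u"
    and lim: "(\<lambda>n. mean_square M (\<lambda>x. v n x - u x)) \<longlonglongrightarrow> 0"
    and b: "b \<in> borel_measurable M" "\<And>x. \<bar>b x\<bar> \<le> K"
  shows "(\<lambda>n. LINT x|M. b x * (norm (v n x))\<^sup>2) \<longlonglongrightarrow> (LINT x|M. b x * (norm (u x))\<^sup>2)"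
proof -
  have scaled: "square_integrable M (\<lambda>x. b x *\<^sub>R y x)" if y: "square_integrable M y" for y :: "'a \<Rightarrow> 'b"
  proof (rule square_integrable_bound[OF y, of _ K])
    have "y \<in> borel_measurable M" using y by (simp add: square_integrable_def)
    then show "(\<lambda>x. b x *\<^sub>R y x) \<in> borel_measurable M" using b(1) by measurable
    show "norm (b x *\<^sub>R y x) \<le> K * norm (y x)" for x
      using b(2)[of x] by (simp add: mult_right_mono)
  qed
  have d: "square_integrable M (\<lambda>x. v n x - u x)" for n
    by (intro square_integrable_diff u v)
  note bu = scaled[OF u] and bd = scaled[OF d]
  have i: "integrable M (\<lambda>x. b x *\<^sub>R y x \<bullet> z x)"
    if "square_integrable M (\<lambda>x. b x *\<^sub>R y x)" "square_integrable M z" for y z :: "'a \<Rightarrow> 'b"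
    by (rule square_integrable_bilinear[OF that bounded_bilinear_inner])
  have 1: "(\<lambda>n. LINT x|M. v n x \<bullet> (b x *\<^sub>R u x)) \<longlonglongrightarrow> (LINT x|M. u x \<bullet> (b x *\<^sub>R u x))"
    by (rule mean_square_convergent_bilinear[OF v u bu lim bounded_bilinear_inner])
  have 2: "(\<lambda>n. LINT x|M. b x *\<^sub>R (v n x - u x) \<bullet> (v n x - u x)) \<longlonglongrightarrow> 0"
  proof (rule Lim_null_comparison[OF always_eventually])
    have "norm (LINT x|M. b x *\<^sub>R (v n x - u x) \<bullet> (v n x - u x)) \<le> K * mean_square M (\<lambda>x. v n x - u x)" for n
    proof -
      have "norm (LINT x|M. b x *\<^sub>R (v n x - u x) \<bullet> (v n x - u x)) \<le>
          (LINT x|M. norm (b x *\<^sub>R (v n x - u x) \<bullet> (v n x - u x)))"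
        by (rule integral_norm_bound)
      also have "\<dots> \<le> (LINT x|M. K * (norm (v n x - u x))\<^sup>2)"
      proof (intro integral_mono integrable_norm i bd d)
        show "integrable M (\<lambda>x. K * (norm (v n x - u x))\<^sup>2)"
          using d[of n] by (simp add: square_integrable_def)
        show "norm (b x *\<^sub>R (v n x - u x) \<bullet> (v n x - u x)) \<le> K * (norm (v n x - u x))\<^sup>2" for x
          using b(2)[of x] by (simp add: power2_norm_eq_inner abs_mult mult_right_mono)
      qed
      finally show ?thesis by (simp add: mean_square_def)
    qed
    then show "\<forall>n. norm (LINT x|M. b x *\<^sub>R (v n x - u x) \<bullet> (v n x - u x)) \<le> K * mean_square M (\<lambda>x. v n x - u x)"
      by simp
    show "(\<lambda>n. K * mean_square M (\<lambda>x. v n x - u x)) \<longlonglongrightarrow> 0"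
      using tendsto_mult[OF tendsto_const[of K] lim] by simp
  qed
  have "(LINT x|M. b x * (norm (v n x))\<^sup>2) =
      (LINT x|M. b x *\<^sub>R (v n x - u x) \<bullet> (v n x - u x)) + 2 * (LINT x|M. v n x \<bullet> (b x *\<^sub>R u x))
      - (LINT x|M. u x \<bullet> (b x *\<^sub>R u x))" for n
  proof -
    have "(LINT x|M. b x * (norm (v n x))\<^sup>2) = (LINT x|M. b x *\<^sub>R (v n x - u x) \<bullet> (v n x - u x)
        + 2 * (v n x \<bullet> (b x *\<^sub>R u x)) - u x \<bullet> (b x *\<^sub>R u x))"
      by (rule arg_cong[where f="integral\<^sup>L M"])
        (auto simp: power2_norm_eq_inner inner_diff_left inner_diff_right inner_commute algebra_simps)
    then show ?thesis
      using i[OF bd d, of n n] i[OF bu v] i[OF bu u] by (simp add: inner_commute)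
  qed
  moreover have "(LINT x|M. b x * (norm (u x))\<^sup>2) = 0 + 2 * (LINT x|M. u x \<bullet> (b x *\<^sub>R u x)) - (LINT x|M. u x \<bullet> (b x *\<^sub>R u x))"
    by (simp add: power2_norm_eq_inner)
  ultimately show ?thesis
    using tendsto_diff[OF tendsto_add[OF 2 tendsto_mult[OF tendsto_const[of 2] 1]] tendsto_const[of "LINT x|M. u x \<bullet> (b x *\<^sub>R u x)"]]
    by simp
qed

text \<open>Fatou's lemma, in the form in which it yields the integrability of a limit.\<close>

lemma integrable_limit_of_bounded_integrals:
  fixes f :: "nat \<Rightarrow> 'a \<Rightarrow> real"
  assumes f: "\<And>n. integrable M (f n)" "\<And>n x. f n x \<ge> 0" "\<And>n. n \<ge> N \<Longrightarrow> integral\<^sup>L M (f n) \<le> K"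
    and g: "g \<in> borel_measurable M" "AE x in M. (\<lambda>n. f n x) \<longlonglongrightarrow> g x" "\<And>x. g x \<ge> 0" and K: "K \<ge> 0"
  shows "integrable M g" "integral\<^sup>L M g \<le> K"
proof -
  have "(\<integral>\<^sup>+x. ennreal (g x) \<partial>M) = (\<integral>\<^sup>+x. liminf (\<lambda>n. ennreal (f n x)) \<partial>M)"
  proof (rule nn_integral_cong_AE)
    show "AE x in M. ennreal (g x) = liminf (\<lambda>n. ennreal (f n x))"
      using g(2)
    proof eventually_elim
      case (elim x)
      then have "(\<lambda>n. ennreal (f n x)) \<longlonglongrightarrow> ennreal (g x)" by (rule tendsto_ennrealI)
      from lim_imp_Liminf[OF _ this] show ?case by simp
    qed
  qed
  also have "\<dots> \<le> liminf (\<lambda>n. \<integral>\<^sup>+x. ennreal (f n x) \<partial>M)"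
    using f(1) by (intro nn_integral_liminf) auto
  also have "\<dots> = liminf (\<lambda>n. ennreal (integral\<^sup>L M (f n)))"
    using f(1,2) by (simp add: nn_integral_eq_integral)
  also have "\<dots> \<le> ennreal K"
  proof -
    have "\<forall>\<^sub>F n in sequentially. ennreal (integral\<^sup>L M (f n)) \<le> ennreal K"
      using f(3) by (auto simp: eventually_sequentially intro!: exI[of _ N] ennreal_leI)
    then show ?thesis by (intro Liminf_le) auto
  qed
  finally have *: "(\<integral>\<^sup>+x. ennreal (g x) \<partial>M) \<le> ennreal K" .
  then have "(\<integral>\<^sup>+x. ennreal (g x) \<partial>M) < \<infinity>" by (simp add: le_less_trans)
  then show i: "integrable M g"
    using g by (intro integrableI_nonneg) auto
  show "integral\<^sup>L M g \<le> K"
    using * g(3) K by (simp add: nn_integral_eq_integral[OF i])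
qed

text \<open>Riesz--Fischer. Along a subsequence the squared increments \<open>e k\<close> have integrals below \<open>(1/4) ^ k\<close>, so
  that even \<open>\<Sum>k. 2 ^ k * e k\<close> is integrable and hence finite almost everywhere. The increments then
  decay like \<open>(sqrt (1/2)) ^ k\<close>, the subsequence converges pointwise, and Fatou's lemma turns the
  pointwise limit into a mean square limit of the whole sequence.\<close>

lemma mean_square_complete:
  fixes v :: "nat \<Rightarrow> 'a \<Rightarrow> 'b::euclidean_space"
  assumes v: "\<And>n. square_integrable M (v n)"
    and cauchy: "\<And>e. e > 0 \<Longrightarrow> \<exists>N. \<forall>m\<ge>N. \<forall>n\<ge>N. mean_square M (\<lambda>x. v m x - v n x) < e"
  obtains u where "square_integrable M u" "(\<lambda>n. mean_square M (\<lambda>x. v n x - u x)) \<longlonglongrightarrow> 0"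
proof -
  have meas: "v n \<in> borel_measurable M" for n using v by (simp add: square_integrable_def)
  have "\<exists>N. \<forall>m\<ge>N. \<forall>n\<ge>N. mean_square M (\<lambda>x. v m x - v n x) < (1/4) ^ k" for k :: nat
    by (rule cauchy) simp
  then obtain N where N: "\<And>k m n. m \<ge> N k \<Longrightarrow> n \<ge> N k \<Longrightarrow> mean_square M (\<lambda>x. v m x - v n x) < (1/4) ^ k"
    by metis
  \<comment> \<open>the summand \<open>k\<close> makes the indices tend to infinity\<close>
  define r where "r k = k + Max (N ` {..k})" for k
  have rN: "r k \<ge> N i" if "i \<le> k" for i k
    using that by (auto simp: r_def intro!: trans_le_add2 Max_ge)
  have rk: "r k \<ge> k" for k by (simp add: r_def)
  define e where "e k x = (norm (v (r (Suc k)) x - v (r k) x))\<^sup>2" for k x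
  have e_fun: "e k = (\<lambda>x. (norm (v (r (Suc k)) x - v (r k) x))\<^sup>2)" for k
    by (simp add: e_def fun_eq_iff)
  have e_nonneg: "e k x \<ge> 0" for k x
    by (simp add: e_def)
  have e_int: "integrable M (e k)" for k
    unfolding e_fun using square_integrable_diff(1)[OF v v] by (auto simp: square_integrable_def)
  have e_small: "integral\<^sup>L M (e k) < (1/4) ^ k" for k
    using N[OF rN rN, of k "Suc k" k] by (simp add: e_fun mean_square_def)
  have "(\<integral>\<^sup>+x. (\<Sum>k. ennreal (2 ^ k * e k x)) \<partial>M) = (\<Sum>k. \<integral>\<^sup>+x. ennreal (2 ^ k * e k x) \<partial>M)"
    using e_int by (intro nn_integral_suminf) (auto simp: borel_measurable_integrable)
  also have "\<dots> \<le> (\<Sum>k. ennreal ((1/2) ^ k))"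
  proof (rule suminf_le)
    fix k
    have "(\<integral>\<^sup>+x. ennreal (2 ^ k * e k x) \<partial>M) = ennreal (2 ^ k * integral\<^sup>L M (e k))"
      using e_int[of k] by (subst nn_integral_eq_integral) (auto simp: e_nonneg)
    also have "\<dots> \<le> ennreal (2 ^ k * (1/4) ^ k)"
      using e_small[of k] by (intro ennreal_leI mult_left_mono) auto
    also have "(2::real) ^ k * (1/4) ^ k = (1/2) ^ k"
      by (simp flip: power_mult_distrib)
    finally show "(\<integral>\<^sup>+x. ennreal (2 ^ k * e k x) \<partial>M) \<le> ennreal ((1/2) ^ k)" .
  qed auto
  also have "\<dots> = ennreal (\<Sum>k. (1/2) ^ k)"
    by (intro suminf_ennreal_eq summable_sums summable_geometric) auto
  finally have "(\<integral>\<^sup>+x. (\<Sum>k. ennreal (2 ^ k * e k x)) \<partial>M) < \<infinity>"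
    by (simp add: le_less_trans)
  then have "AE x in M. (\<Sum>k. ennreal (2 ^ k * e k x)) \<noteq> \<infinity>"
    using e_int by (intro nn_integral_PInf_AE) (auto simp: borel_measurable_integrable)
  then have conv: "AE x in M. convergent (\<lambda>k. v (r k) x)"
  proof eventually_elim
    case (elim x)
    have "summable (\<lambda>k. 2 ^ k * e k x)"
      using elim by (intro summable_suminf_not_top) (auto simp: e_def)
    then have "Bseq (\<lambda>k. 2 ^ k * e k x)"
      using summable_LIMSEQ_zero convergent_imp_Bseq convergentI by blast
    then obtain K where K: "K > 0" "\<And>k. norm (2 ^ k * e k x) \<le> K"
      by (auto simp: Bseq_def)
    have "norm (v (r (Suc k)) x - v (r k) x) \<le> sqrt K * (sqrt (1/2)) ^ k" for k
    proof -
      have "e k x \<le> K * (1/2) ^ k"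
        using K(2)[of k] by (simp add: e_def field_simps)
      then have "sqrt (e k x) \<le> sqrt (K * (1/2) ^ k)" by (rule real_sqrt_le_mono)
      then show ?thesis by (simp add: e_def real_sqrt_mult real_sqrt_power)
    qed
    moreover have "summable (\<lambda>k. sqrt K * (sqrt (1/2)) ^ k)"
      by (intro summable_mult summable_geometric) auto
    ultimately have "summable (\<lambda>k. v (r (Suc k)) x - v (r k) x)"
      by (rule summable_comparison_test'[where N=0, rotated])
    then have "convergent (\<lambda>n. \<Sum>k<n. v (r (Suc k)) x - v (r k) x)"
      by (simp add: summable_iff_convergent)
    then have "convergent (\<lambda>n. v (r n) x - v (r 0) x)"
      by (simp add: sum_lessThan_telescope[where f="\<lambda>k. v (r k) x"])
    from convergent_add[OF this convergent_const[of "v (r 0) x"]]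
    show ?case by simp
  qed
  define u where "u x = lim (\<lambda>k. v (r k) x)" for x
  have um: "u \<in> borel_measurable M"
    unfolding u_def by (rule borel_measurable_lim_metric) (rule meas)
  have lim: "AE x in M. (\<lambda>k. v (r k) x) \<longlonglongrightarrow> u x"
    using conv by eventually_elim (simp add: u_def convergent_LIMSEQ_iff)
  have close: "integrable M (\<lambda>x. (norm (v n x - u x))\<^sup>2) \<and> mean_square M (\<lambda>x. v n x - u x) \<le> d"
    if d: "d > 0" and n: "\<And>m. m \<ge> n0 \<Longrightarrow> mean_square M (\<lambda>x. v n x - v m x) \<le> d" for n n0 d
  proof -
    have i: "integrable M (\<lambda>x. (norm (v n x - v (r k) x))\<^sup>2)" for k
      using square_integrable_diff(1)[OF v v] by (auto simp: square_integrable_def)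
    have l: "AE x in M. (\<lambda>k. (norm (v n x - v (r k) x))\<^sup>2) \<longlonglongrightarrow> (norm (v n x - u x))\<^sup>2"
      using lim by eventually_elim (intro tendsto_intros)
    have b: "(LINT x|M. (norm (v n x - v (r k) x))\<^sup>2) \<le> d" if "k \<ge> n0" for k
      using n[of "r k"] rk[of k] that by (simp add: mean_square_def)
    note * = integrable_limit_of_bounded_integrals[where f="\<lambda>k x. (norm (v n x - v (r k) x))\<^sup>2" and N=n0 and K=d, OF i _ b _ l]
    show ?thesis using * um meas d by (auto simp: mean_square_def)
  qed
  obtain n0 where n0: "\<forall>m\<ge>n0. \<forall>n\<ge>n0. mean_square M (\<lambda>x. v m x - v n x) < 1"
    using cauchy[of 1] by auto
  have "integrable M (\<lambda>x. (norm (v n0 x - u x))\<^sup>2)"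
    using close[of 1 n0 n0] n0 by (auto intro: less_imp_le)
  then have "square_integrable M (\<lambda>x. v n0 x - u x)"
    using um meas by (auto simp: square_integrable_def)
  from square_integrable_diff(1)[OF v this, of n0] have "square_integrable M u" by simp
  moreover have "(\<lambda>n. mean_square M (\<lambda>x. v n x - u x)) \<longlonglongrightarrow> 0"
  proof (rule LIMSEQ_I)
    fix d :: real assume d: "d > 0"
    obtain n1 where n1: "\<forall>m\<ge>n1. \<forall>n\<ge>n1. mean_square M (\<lambda>x. v m x - v n x) < d/2"
      using cauchy[of "d/2"] d by auto
    have "norm (mean_square M (\<lambda>x. v n x - u x) - 0) < d" if "n \<ge> n1" for n
    proof -
      have "mean_square M (\<lambda>x. v n x - u x) \<le> d/2"
        using close[of "d/2" n1 n] n1 d that by (auto intro: less_imp_le)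
      then show ?thesis using d by simp
    qed
    then show "\<exists>no. \<forall>n\<ge>no. norm (mean_square M (\<lambda>x. v n x - u x) - 0) < d" by blast
  qed
  ultimately show ?thesis by (rule that)
qed

lemma continuous_compact_support_square_integrable:
  fixes w :: "'a::euclidean_space \<Rightarrow> 'b::euclidean_space"
  assumes "continuous_on UNIV w" "\<And>x. norm x > R \<Longrightarrow> w x = 0"
  shows "integrable lborel w" "square_integrable lborel w"
proof -
  have *: "integrable lborel g" if "continuous_on UNIV g" "\<And>x. norm x > R \<Longrightarrow> g x = 0"
    for g :: "'a \<Rightarrow> 'c::euclidean_space"
  proof -
    have "integrable lborel (\<lambda>x. indicator (cball 0 R) x *\<^sub>R g x)"
      using that(1) by (intro borel_integrable_compact) (auto intro: continuous_on_subset)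
    also have "(\<lambda>x. indicator (cball 0 R) x *\<^sub>R g x) = g"
      using that(2) by (auto simp: fun_eq_iff indicator_def)
    finally show ?thesis .
  qed
  show "integrable lborel w" by (rule *) (use assms in auto)
  have "integrable lborel (\<lambda>x. (norm (w x))\<^sup>2)"
    by (rule *) (use assms in \<open>auto intro!: continuous_intros\<close>)
  then show "square_integrable lborel w"
    using assms(1) by (simp add: square_integrable_def borel_measurable_continuous_onI)
qed

text \<open>A measurable function is almost everywhere a limit of continuous functions \<open>g n\<close>. Clamping their
  values to the ball of radius \<open>K\<close> and cutting them off at radius \<open>R + 1\<close> keeps the limit and provides
  a majorant for dominated convergence.\<close>

lemma continuous_approximation_bounded:
  fixes u :: "'a::euclidean_space \<Rightarrow> 'b::euclidean_space"
  assumes u: "u \<in> borel_measurable borel" and K: "K > 0" "\<And>x. norm (u x) \<le> K"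
    and R: "\<And>x. norm x > R \<Longrightarrow> u x = 0" and e: "e > 0"
  shows "\<exists>w. continuous_on UNIV w \<and> (\<forall>x. norm x > R + 1 \<longrightarrow> w x = 0) \<and> mean_square lborel (\<lambda>x. w x - u x) < e"
proof -
  have "u measurable_on UNIV"
    using u by (intro lebesgue_measurable_imp_measurable_on) (auto simp: measurable_completion)
  then obtain N g where N: "negligible N" and g: "\<And>n::nat. continuous_on UNIV (g n)"
    and lim: "\<And>x. x \<notin> N \<Longrightarrow> (\<lambda>n. g n x) \<longlonglongrightarrow> u x"
    by (auto simp: measurable_on_def)
  define clamp where "clamp y = (K / max K (norm y)) *\<^sub>R y" for y :: 'b
  define \<theta> where "\<theta> x = max 0 (min 1 (R + 1 - norm x))" for x :: 'a
  define w where "w n x = \<theta> x *\<^sub>R clamp (g n x)" for n x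
  have clamp_cont: "continuous_on UNIV clamp"
    unfolding clamp_def using K(1) by (intro continuous_intros) (auto simp: max_def)
  have clamp_le: "norm (clamp y) \<le> K" for y
  proof (cases "norm y \<le> K")
    case False
    then show ?thesis using K(1) by (simp add: clamp_def max_def)
  qed (use K(1) in \<open>simp add: clamp_def max_def\<close>)
  have \<theta>_cont: "continuous_on UNIV \<theta>"
    unfolding \<theta>_def by (intro continuous_intros)
  have w_cont: "continuous_on UNIV (w n)" for n
    unfolding w_def
    by (intro continuous_on_scaleR \<theta>_cont continuous_on_compose2[OF clamp_cont g]) simp
  have w_le: "norm (w n x) \<le> K" for n x
  proof -
    have "\<bar>\<theta> x\<bar> * norm (clamp (g n x)) \<le> 1 * K"
      using clamp_le by (intro mult_mono) (auto simp: \<theta>_def)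
    then show ?thesis by (simp add: w_def)
  qed
  have w_out: "w n x = 0" if "norm x > R + 1" for n x
    using that by (simp add: w_def \<theta>_def)
  have w_lim: "(\<lambda>n. w n x) \<longlonglongrightarrow> u x" if "x \<notin> N" for x
  proof -
    have "(\<lambda>n. clamp (g n x)) \<longlonglongrightarrow> clamp (u x)"
      using lim[OF that] clamp_cont by (auto intro: isCont_tendsto_compose simp: continuous_on_eq_continuous_at)
    moreover have "clamp (u x) = u x" using K(2)[of x] K(1) by (simp add: clamp_def max_def)
    ultimately have "(\<lambda>n. w n x) \<longlonglongrightarrow> \<theta> x *\<^sub>R u x"
      unfolding w_def by (intro tendsto_scaleR tendsto_const) simp
    moreover have "\<theta> x *\<^sub>R u x = u x"
    proof (cases "norm x > R")
      case False
      then have "\<theta> x = 1" by (simp add: \<theta>_def)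
      then show ?thesis by simp
    qed (simp add: R)
    ultimately show ?thesis by simp
  qed
  have dm: "(\<lambda>x. (norm (w n x - u x))\<^sup>2) \<in> borel_measurable borel" for n
    using borel_measurable_continuous_onI[OF w_cont[of n]] u by measurable
  have "(\<lambda>n. LINT x|lebesgue. (norm (w n x - u x))\<^sup>2) \<longlonglongrightarrow> (LINT x|(lebesgue :: 'a measure). 0)"
  proof (rule integral_dominated_convergence[where w="\<lambda>x. indicator (cball 0 (R + 1)) x *\<^sub>R (2 * K)\<^sup>2"])
    show "(\<lambda>x. (norm (w n x - u x))\<^sup>2) \<in> borel_measurable lebesgue" for n
      using dm by (intro measurable_completion) simp
    show "integrable lebesgue (\<lambda>x::'a. indicator (cball 0 (R + 1)) x *\<^sub>R (2 * K)\<^sup>2)"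
    proof (intro integrable_scaleR_left)
      have "integrable lborel (indicat_real (cball (0::'a) (R + 1)))"
        by (intro integrable_real_indicator) (use emeasure_bounded_finite[OF bounded_cball, of "0::'a" "R + 1"] in auto)
      then show "integrable lebesgue (indicat_real (cball (0::'a) (R + 1)))"
        by (subst integrable_completion) auto
    qed
    show "AE x in lebesgue. (\<lambda>n. (norm (w n x - u x))\<^sup>2) \<longlonglongrightarrow> 0"
    proof -
      have "AE x in lebesgue. x \<notin> N"
        using N by (simp add: negligible_iff_null_sets AE_not_in)
      then show ?thesis
      proof eventually_elim
        case (elim x)
        then have "(\<lambda>n. (norm (w n x - u x))\<^sup>2) \<longlonglongrightarrow> (norm (u x - u x))\<^sup>2"
          by (intro tendsto_intros w_lim)
        then show ?case by simp
      qed
    qed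
    show "AE x in lebesgue. norm ((norm (w n x - u x))\<^sup>2) \<le> indicator (cball 0 (R + 1)) x *\<^sub>R (2 * K)\<^sup>2" for n
    proof (intro always_eventually allI)
      fix x
      have "norm (w n x - u x) \<le> 2 * K"
        using norm_triangle_ineq4[of "w n x" "u x"] w_le[of n x] K(2)[of x] by linarith
      from power_mono[OF this, of 2]
      show "norm ((norm (w n x - u x))\<^sup>2) \<le> indicator (cball 0 (R + 1)) x *\<^sub>R (2 * K)\<^sup>2"
        using R[of x] w_out[of x n] by (cases "norm x \<le> R + 1") (auto simp: indicator_def)
    qed
  qed auto
  moreover have "(LINT x|lebesgue. (norm (w n x - u x))\<^sup>2) = mean_square lborel (\<lambda>x. w n x - u x)" for n
    unfolding mean_square_def using dm by (intro integral_completion) simp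
  ultimately have "(\<lambda>n. mean_square lborel (\<lambda>x. w n x - u x)) \<longlonglongrightarrow> 0" by simp
  from order_tendstoD(2)[OF this e] obtain n where "mean_square lborel (\<lambda>x. w n x - u x) < e"
    by (auto simp: eventually_sequentially)
  then show ?thesis using w_cont w_out by (intro exI[of _ "w n"]) simp
qed

text \<open>Truncating both the domain and the range of \<open>u\<close> reduces the density of continuous functions of
  compact support to the bounded case.\<close>

lemma continuous_approximation:
  fixes u :: "'a::euclidean_space \<Rightarrow> 'b::euclidean_space"
  assumes u: "square_integrable lborel u" and e: "e > 0"
  obtains w R where "continuous_on UNIV w" "\<And>x. norm x > R \<Longrightarrow> w x = 0" "mean_square lborel (\<lambda>x. w x - u x) < e"
proof -
  have um [measurable]: "u \<in> borel_measurable borel" using u by (simp add: square_integrable_def)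
  define t where "t n x = (if norm x \<le> real n \<and> norm (u x) \<le> real n then u x else 0)" for n x
  have tm [measurable]: "t n \<in> borel_measurable borel" for n
    unfolding t_def by (rule measurable_If) (use um in measurable)
  have "(\<lambda>n. LINT x|lborel. (norm (t n x - u x))\<^sup>2) \<longlonglongrightarrow> (LINT x|(lborel :: 'a measure). 0)"
  proof (rule integral_dominated_convergence[where w="\<lambda>x. (norm (u x))\<^sup>2"])
    show "AE x in lborel. (\<lambda>n. (norm (t n x - u x))\<^sup>2) \<longlonglongrightarrow> 0"
    proof (intro always_eventually allI)
      fix x
      obtain k :: nat where k: "max (norm x) (norm (u x)) \<le> real k" using real_arch_simple by blast
      have "\<forall>\<^sub>F n in sequentially. (norm (t n x - u x))\<^sup>2 = 0"
        using eventually_ge_at_top[of k]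
      proof eventually_elim
        case (elim n)
        then have "real k \<le> real n" by simp
        then show ?case using k by (simp add: t_def)
      qed
      then show "(\<lambda>n. (norm (t n x - u x))\<^sup>2) \<longlonglongrightarrow> 0" by (rule tendsto_eventually)
    qed
    show "integrable lborel (\<lambda>x. (norm (u x))\<^sup>2)" using u by (simp add: square_integrable_def)
  qed (auto simp: t_def)
  then have "(\<lambda>n. mean_square lborel (\<lambda>x. t n x - u x)) \<longlonglongrightarrow> 0" by (simp add: mean_square_def)
  from order_tendstoD(2)[OF this, of "e/4"] e obtain n where n: "mean_square lborel (\<lambda>x. t n x - u x) < e/4"
    by (auto simp: eventually_sequentially)
  have "\<exists>w. continuous_on UNIV w \<and> (\<forall>x. norm x > real n + 1 \<longrightarrow> w x = 0) \<and> mean_square lborel (\<lambda>x. w x - t n x) < e/4"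
    by (rule continuous_approximation_bounded[where K="real n + 1"]) (use e in \<open>auto simp: t_def\<close>)
  then obtain w where w: "continuous_on UNIV w" "\<And>x. norm x > real n + 1 \<Longrightarrow> w x = 0"
    "mean_square lborel (\<lambda>x. w x - t n x) < e/4" by blast
  have tn: "square_integrable lborel (t n)"
    by (rule square_integrable_bound[OF u, of _ 1]) (auto simp: t_def)
  have "mean_square lborel (\<lambda>x. (w x - t n x) + (t n x - u x))
      \<le> 2 * mean_square lborel (\<lambda>x. w x - t n x) + 2 * mean_square lborel (\<lambda>x. t n x - u x)"
    by (intro square_integrable_add square_integrable_diff u tn continuous_compact_support_square_integrable(2)[OF w(1,2)])
  then have "mean_square lborel (\<lambda>x. w x - u x) < e" using n w(3) by simp
  then show ?thesis using w by (intro that[of w "real n + 1"])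
qed

section \<open>Convolution with smooth kernels\<close>

lemma norm_vector_scalar_mult: "norm (c *s (v :: complex^'n)) = cmod c * norm v"
  by (simp add: norm_vec_def norm_mult L2_set_right_distrib)

lemma bounded_bilinear_vector_scalar_mult:
  "bounded_bilinear ((*s) :: complex \<Rightarrow> complex^'n \<Rightarrow> complex^'n)"
  by (rule bounded_bilinear.intro)
    (auto simp: vec_eq_iff algebra_simps norm_vector_scalar_mult intro!: exI[of _ 1])

lemma vector_scalar_mult_of_real: "complex_of_real r *s (v :: complex^'n) = r *\<^sub>R v"
  by (simp add: vec_eq_iff scaleR_conv_of_real[where 'a=complex])

definition loc_integrable :: "('a::euclidean_space \<Rightarrow> 'b::euclidean_space) \<Rightarrow> bool" where
  "loc_integrable u \<longleftrightarrow> u \<in> borel_measurable borel \<and>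
     (\<forall>R. integrable lborel (\<lambda>y. indicator (cball 0 R) y *\<^sub>R u y))"

lemma integrable_indicator_cball:
  "integrable lborel (\<lambda>x::'a::euclidean_space. indicator (cball c R) x *\<^sub>R (v :: 'b::euclidean_space))"
  by (intro integrable_scaleR_left integrable_real_indicator)
    (use emeasure_bounded_finite[OF bounded_cball, of c R] in auto)

lemma square_integrable_indicator_cball:
  "square_integrable lborel (indicat_real (cball (c::'a::euclidean_space) R))"
proof -
  have "(\<lambda>x. (norm (indicat_real (cball c R) x))\<^sup>2) = (\<lambda>x. indicator (cball c R) x *\<^sub>R 1)"
    by (auto simp: indicator_def fun_eq_iff)
  then show ?thesis
    using integrable_indicator_cball[of c R "1::real"]
    by (simp add: square_integrable_def)
qed

lemma square_integrable_loc_integrable: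
  assumes "square_integrable lborel u"
  shows "loc_integrable u"
  unfolding loc_integrable_def
  using square_integrable_bilinear[OF square_integrable_indicator_cball assms bounded_bilinear_scaleR] assms
  by (auto simp: square_integrable_def)

definition conv :: "(real^3 \<Rightarrow> complex) \<Rightarrow> (real^3 \<Rightarrow> complex^'n) \<Rightarrow> real^3 \<Rightarrow> complex^'n::finite" where
  "conv K u x = (LINT y|lborel. K (x - y) *s u y)"

lemma conv_integrable:
  fixes u :: "real^3 \<Rightarrow> complex^'n"
  assumes K: "continuous_on UNIV K" "\<And>z. norm z > r \<Longrightarrow> K z = 0" and u: "loc_integrable u"
  shows "integrable lborel (\<lambda>y. K (x - y) *s u y)"
proof -
  have [measurable]: "K \<in> borel_measurable borel" "u \<in> borel_measurable borel"
    using K u by (auto simp: loc_integrable_def borel_measurable_continuous_onI)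
  have "bounded (K ` cball 0 r)"
    by (intro compact_imp_bounded compact_continuous_image continuous_on_subset[OF K(1)]) auto
  then obtain C where C: "C > 0" "\<And>z. norm z \<le> r \<Longrightarrow> cmod (K z) \<le> C"
    by (auto simp: bounded_pos)
  let ?w = "\<lambda>y. indicator (cball 0 (norm x + r)) y *\<^sub>R u y"
  show ?thesis
  proof (rule Bochner_Integration.integrable_bound)
    show "integrable lborel (\<lambda>y. C *\<^sub>R ?w y)"
      using u by (intro integrable_scaleR_right) (simp add: loc_integrable_def)
    show "AE y in lborel. norm (K (x - y) *s u y) \<le> norm (C *\<^sub>R ?w y)"
    proof (intro always_eventually allI)
      fix y
      show "norm (K (x - y) *s u y) \<le> norm (C *\<^sub>R ?w y)"
      proof (cases "norm (x - y) \<le> r")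
        case True
        then have "norm y \<le> norm x + r"
          using norm_triangle_ineq3[of y x] by (simp add: norm_minus_commute)
        then show ?thesis
          using C True by (simp add: norm_vector_scalar_mult mult_right_mono)
      qed (use K C in simp)
    qed
    show "(\<lambda>y. K (x - y) *s u y) \<in> borel_measurable lborel"
      by (intro borel_measurable_bounded_bilinear[OF bounded_bilinear_vector_scalar_mult]) measurable
  qed
qed

lemma conv_outside:
  assumes "\<And>z. norm z > r \<Longrightarrow> K z = 0" "\<And>y. norm y > R \<Longrightarrow> u y = 0" "norm x > R + r"
  shows "conv K u x = 0"
proof -
  have zero: "K (x - y) *s u y = 0" for y
    using assms(1)[of "x - y"] assms(2)[of y] assms(3) norm_triangle_ineq2[of x y]
    by (cases "norm y > R") auto
  show ?thesis by (simp only: conv_def zero Bochner_Integration.integral_zero)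
qed

text \<open>The first order remainder of \<open>K\<close> is small relative to the increment, uniformly in the base point,
  because the partial derivatives of \<open>K\<close> are uniformly continuous on compact sets. Integrated against
  the locally integrable \<open>u\<close>, the remainder stays small.\<close>

lemma conv_has_derivative:
  fixes u :: "real^3 \<Rightarrow> complex^'n"
  assumes K: "\<And>z. K differentiable (at z)" "\<And>j. continuous_on UNIV (partial j K)"
    and supp: "\<And>z. norm z > r \<Longrightarrow> K z = 0" and u: "loc_integrable u"
  shows "(conv K u has_derivative (\<lambda>h. \<Sum>j\<in>UNIV. (h $ j) *\<^sub>R conv (partial j K) u x)) (at x)"
  unfolding has_derivative_at_alt
proof (intro conjI allI impI)
  show "bounded_linear (\<lambda>h::real^3. \<Sum>j\<in>UNIV. (h $ j) *\<^sub>R conv (partial j K) u x)"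
    by (intro bounded_linear_sum bounded_linear_scaleR_const bounded_linear_vec_nth)
  fix e :: real assume e: "e > 0"
  define I where "I = (LINT y|lborel. norm (indicator (cball 0 (norm x + r + 1)) y *\<^sub>R u y))"
  have I0: "I \<ge> 0" by (simp add: I_def)
  \<comment> \<open>one third for each of the three partial derivatives; \<open>I + 1\<close> instead of \<open>I\<close> avoids a division by zero\<close>
  define e' where "e' = e / (3 * (I + 1))"
  have e': "e' > 0" using e I0 by (simp add: e'_def)
  have Kc: "continuous_on UNIV K"
    using K(1) by (auto intro!: continuous_at_imp_continuous_on differentiable_imp_continuous_within)
  have p_supp: "partial j K z = 0" if "norm z > r" for j z
    by (rule partial_outside_support[OF supp that])
  have "\<exists>d>0. \<forall>z\<in>cball 0 (r + 2). \<forall>z'\<in>cball 0 (r + 2). dist z' z < d \<longrightarrow> dist (partial j K z') (partial j K z) < e'" for j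
    using compact_uniformly_continuous[OF continuous_on_subset[OF K(2)] compact_cball, of 0 "r + 2" j] e'
    unfolding uniformly_continuous_on_def by auto
  then obtain d where d: "\<And>j. d j > 0" and d': "\<And>j z z'. norm z \<le> r + 2 \<Longrightarrow> norm z' \<le> r + 2 \<Longrightarrow> dist z' z < d j
      \<Longrightarrow> dist (partial j K z') (partial j K z) < e'"
    unfolding mem_cball_0 Ball_def by metis
  define d0 where "d0 = min 1 (Min (range d))"
  have d0: "d0 > 0" "d0 \<le> 1" "\<And>j. d0 \<le> d j"
    using d by (auto simp: d0_def min_le_iff_disj)
  have lin: "norm (K (z + h) - K z - (\<Sum>j\<in>UNIV. (h $ j) *\<^sub>R partial j K z)) \<le> 3 * e' * norm h"
    if z: "norm z \<le> r + 1" and h: "norm h < d0" for z h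
  proof -
    have "norm (K (z + h) - K z - (\<lambda>h. \<Sum>j\<in>UNIV. (h $ j) *\<^sub>R partial j K z) ((z + h) - z)) \<le> norm ((z + h) - z) * (3 * e')"
    proof (rule differentiable_bound_linearization[where S="ball z d0" and f'="\<lambda>z h. \<Sum>j\<in>UNIV. (h $ j) *\<^sub>R partial j K z"])
      show "z + t *\<^sub>R (z + h - z) \<in> ball z d0" if "t \<in> {0..1}" for t
      proof -
        have "\<bar>t\<bar> * norm h \<le> norm h" using that by (intro mult_left_le_one_le) auto
        then show ?thesis using h by (simp add: dist_norm)
      qed
      show "(K has_derivative (\<lambda>h. \<Sum>j\<in>UNIV. h $ j *\<^sub>R partial j K y)) (at y within ball z d0)" for y
        by (rule has_derivative_at_withinI[OF differentiable_has_partial_derivative[OF K(1)]])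
      show "onorm ((\<lambda>h. \<Sum>j\<in>UNIV. h $ j *\<^sub>R partial j K y) - (\<lambda>h. \<Sum>j\<in>UNIV. h $ j *\<^sub>R partial j K z)) \<le> 3 * e'"
        if y: "y \<in> ball z d0" for y
      proof (rule onorm_le)
        fix h :: "real^3"
        have "norm y \<le> r + 2"
          using y z d0(2) norm_triangle_ineq2[of y z] by (auto simp: dist_norm norm_minus_commute)
        then have *: "norm (partial j K y - partial j K z) \<le> e'" for j
          using d'[of z y j] z y d0(3)[of j] by (auto simp: dist_norm norm_minus_commute)
        have "norm (\<Sum>j\<in>UNIV. h $ j *\<^sub>R (partial j K y - partial j K z)) \<le> (\<Sum>j\<in>(UNIV::3 set). norm h * e')"
        proof (rule sum_norm_le)
          fix j :: 3
          have "\<bar>h $ j\<bar> * norm (partial j K y - partial j K z) \<le> norm h * e'"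
            by (intro mult_mono * component_le_norm_cart) auto
          then show "norm (h $ j *\<^sub>R (partial j K y - partial j K z)) \<le> norm h * e'" by simp
        qed
        then show "norm (((\<lambda>h. \<Sum>j\<in>UNIV. h $ j *\<^sub>R partial j K y) - (\<lambda>h. \<Sum>j\<in>UNIV. h $ j *\<^sub>R partial j K z)) h) \<le> 3 * e' * norm h"
          by (simp add: scaleR_diff_right sum_subtractf mult_ac)
      qed
      show "z \<in> ball z d0" using d0 by simp
    qed
    then show ?thesis by (simp add: mult.commute)
  qed
  show "\<exists>d>0. \<forall>y. norm (y - x) < d \<longrightarrow>
      norm (conv K u y - conv K u x - (\<Sum>j\<in>UNIV. ((y - x) $ j) *\<^sub>R conv (partial j K) u x)) \<le> e * norm (y - x)"
  proof (intro exI conjI allI impI)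
    fix y assume y: "norm (y - x) < d0"
    define h where "h = y - x"
    have split: "K (y - t) *s u t - K (x - t) *s u t - (\<Sum>j\<in>UNIV. (h $ j) *\<^sub>R (partial j K (x - t) *s u t)) =
        (K (x - t + h) - K (x - t) - (\<Sum>j\<in>UNIV. (h $ j) *\<^sub>R partial j K (x - t))) *s u t" for t
    proof -
      have "y - t = x - t + h" by (simp add: h_def)
      then show ?thesis
        by (simp only:) (simp add: vec_eq_iff left_diff_distrib sum_distrib_right)
    qed
    let ?E = "\<lambda>t. (K (x - t + h) - K (x - t) - (\<Sum>j\<in>UNIV. (h $ j) *\<^sub>R partial j K (x - t)))"
    have "conv K u y - conv K u x - (\<Sum>j\<in>UNIV. (h $ j) *\<^sub>R conv (partial j K) u x) =
      (LINT t|lborel. K (y - t) *s u t - K (x - t) *s u t - (\<Sum>j\<in>UNIV. (h $ j) *\<^sub>R (partial j K (x - t) *s u t)))"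
      unfolding conv_def
      using conv_integrable[OF Kc supp u] conv_integrable[OF K(2) p_supp u] by simp
    also have "\<dots> = (LINT t|lborel. ?E t *s u t)"
      by (simp only: split)
    also have "norm \<dots> \<le> (LINT t|lborel. (3 * e' * norm h) * norm (indicator (cball 0 (norm x + r + 1)) t *\<^sub>R u t))"
    proof (rule Bochner_Integration.integral_norm_bound_integral)
      have i: "integrable lborel (\<lambda>t. K (y - t) *s u t - K (x - t) *s u t - (\<Sum>j\<in>UNIV. (h $ j) *\<^sub>R (partial j K (x - t) *s u t)))"
        using conv_integrable[OF Kc supp u] conv_integrable[OF K(2) p_supp u] by simp
      also have "(\<lambda>t. K (y - t) *s u t - K (x - t) *s u t - (\<Sum>j\<in>UNIV. (h $ j) *\<^sub>R (partial j K (x - t) *s u t))) = (\<lambda>t. ?E t *s u t)"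
        by (simp only: split)
      finally show "integrable lborel (\<lambda>t. ?E t *s u t)" .
      show "integrable lborel (\<lambda>t. (3 * e' * norm h) * norm (indicator (cball 0 (norm x + r + 1)) t *\<^sub>R u t))"
        using u unfolding loc_integrable_def by (intro integrable_mult_right integrable_norm) blast
      fix t
      show "norm (?E t *s u t) \<le> (3 * e' * norm h) * norm (indicator (cball 0 (norm x + r + 1)) t *\<^sub>R u t)"
      proof (cases "norm (x - t) \<le> r + 1")
        case True
        then have "norm t \<le> norm x + r + 1"
          using norm_triangle_ineq3[of t x] by (simp add: norm_minus_commute)
        moreover have "norm (?E t) \<le> 3 * e' * norm h"
          using lin[OF True, of h] y by (simp add: h_def)
        ultimately have "norm (?E t *s u t) \<le> 3 * e' * norm h * norm (u t)"
          and "indicat_real (cball 0 (norm x + r + 1)) t = 1"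
          unfolding norm_vector_scalar_mult by (simp_all add: mult_right_mono)
        then show ?thesis by (simp only: scaleR_one)
      next
        case False
        have "norm (x - t + h) > r"
          using False y d0(2) norm_triangle_ineq4[of "x - t + h" h] by (simp add: h_def)
        then have "K (x - t + h) = 0" "K (x - t) = 0" "\<And>j. partial j K (x - t) = 0"
          using False supp p_supp by auto
        then show ?thesis using e' by simp
      qed
    qed
    also have "\<dots> = 3 * e' * norm h * I" by (simp add: I_def)
    also have "\<dots> \<le> 3 * e' * norm h * (I + 1)"
      using e' by (intro mult_left_mono) auto
    also have "\<dots> = e * norm h"
      using I0 by (simp add: e'_def field_simps)
    finally show "norm (conv K u y - conv K u x - (\<Sum>j\<in>UNIV. ((y - x) $ j) *\<^sub>R conv (partial j K) u x)) \<le> e * norm (y - x)"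
      by (simp add: h_def)
  qed (rule d0)
qed

section \<open>Integration by parts and mixed derivatives\<close>

lemma lborel_distr_reflect:
  "distr lborel borel (\<lambda>y. x - y) = (lborel :: 'a::euclidean_space measure)"
proof -
  have "(lborel :: 'a measure) = density (distr lborel borel (\<lambda>y. x - y)) (\<lambda>_. 1)"
    using lborel_affine[of "-1" x] by simp
  then show ?thesis by (simp add: density_1)
qed

lemma lborel_integral_reflect:
  fixes f :: "'a::euclidean_space \<Rightarrow> 'b::euclidean_space"
  assumes "f \<in> borel_measurable borel"
  shows "(LINT y|lborel. f (x - y)) = (LINT y|lborel. f y)"
proof -
  have "(LINT y|lborel. f y) = (LINT y|distr lborel borel (\<lambda>y. x - y). f y)"
    by (simp add: lborel_distr_reflect)
  also have "\<dots> = (LINT y|lborel. f (x - y))"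
    using assms by (intro integral_distr) auto
  finally show ?thesis by simp
qed

text \<open>By translation invariance the convolution of \<open>F\<close> with the constant function \<open>1\<close> is constant; its
  derivative is the integral of the partial derivative of \<open>F\<close>.\<close>

lemma integral_partial_eq_0:
  assumes F: "\<And>z. F differentiable (at z)" "\<And>j. continuous_on UNIV (partial j F)"
    and supp: "\<And>z. norm z > r \<Longrightarrow> F z = 0"
  shows "(LINT x|lborel. partial j F x) = 0"
proof -
  define u :: "real^3 \<Rightarrow> complex^1" where "u = (\<lambda>_. 1)"
  have u: "loc_integrable u"
    using integrable_indicator_cball[of "0::real^3" _ "1 :: complex^1"] by (simp add: loc_integrable_def u_def)
  have Fc: "continuous_on UNIV F"
    using F(1) by (auto intro!: continuous_at_imp_continuous_on differentiable_imp_continuous_within)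
  have reflect: "conv G u x = (LINT y|lborel. G y *s 1)" if "continuous_on UNIV G" for G x
  proof -
    have "(\<lambda>y. G y *s (1 :: complex^1)) \<in> borel_measurable borel"
      using that by (intro borel_measurable_bounded_bilinear[OF bounded_bilinear_vector_scalar_mult])
        (auto intro: borel_measurable_continuous_onI)
    from lborel_integral_reflect[OF this, of x] show ?thesis by (simp add: conv_def u_def)
  qed
  have p_supp: "partial i F z = 0" if "norm z > r" for i z
    by (rule partial_outside_support[OF supp that])
  have "conv F u = (\<lambda>_. LINT y|lborel. F y *s 1)"
    using reflect[OF Fc] by auto
  with conv_has_derivative[where x=0 and r=r, OF F supp u]
  have "((\<lambda>_. LINT y|lborel. F y *s (1::complex^1)) has_derivative
      (\<lambda>h. \<Sum>i\<in>UNIV. (h $ i) *\<^sub>R conv (partial i F) u 0)) (at 0)" by simp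
  from has_derivative_unique[OF this has_derivative_const]
  have "(\<lambda>h. \<Sum>i\<in>UNIV. (h $ i) *\<^sub>R conv (partial i F) u 0) (axis j 1) = 0" by (rule fun_cong)
  then have "conv (partial j F) u 0 = 0"
    by (simp add: axis_def if_distrib[of "\<lambda>t. t *\<^sub>R _"] cong: if_cong)
  then have "(LINT y|lborel. partial j F y *s (1::complex^1)) = 0"
    by (simp add: reflect[OF F(2)])
  moreover have i: "integrable lborel (partial j F)"
    by (rule continuous_compact_support_square_integrable(1)[OF F(2) p_supp])
  have "(LINT y|lborel. partial j F y *s (1::complex^1)) = (LINT y|lborel. partial j F y) *s 1"
    by (rule integral_bounded_linear[OF bounded_bilinear.bounded_linear_left[OF bounded_bilinear_vector_scalar_mult] i])
  ultimately show ?thesis by (simp add: vec_eq_iff)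
qed

lemma partial_of_real:
  "(F has_derivative D) (at x) \<Longrightarrow> partial j (\<lambda>x. complex_of_real (F x)) x = of_real (D (axis j 1))"
  by (rule partial_eqI[OF bounded_linear.has_derivative[OF bounded_linear_of_real]])

lemma integral_derivative_eq_0:
  fixes F :: "real^3 \<Rightarrow> real"
  assumes F: "\<And>x. (F has_derivative D x) (at x)" "\<And>j. continuous_on UNIV (\<lambda>x. D x (axis j 1))"
    and supp: "\<And>x. norm x > r \<Longrightarrow> F x = 0"
  shows "integrable lborel (\<lambda>x. D x (axis j 1))" "(LINT x|lborel. D x (axis j 1)) = 0"
proof -
  have p: "partial j (\<lambda>x. complex_of_real (F x)) = (\<lambda>x. of_real (D x (axis j 1)))" for j
    using partial_of_real[OF F(1)] by auto
  have supp': "complex_of_real (F x) = 0" if "norm x > r" for x using supp[OF that] by simp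
  have "D x (axis j 1) = 0" if "norm x > r" for x
    using partial_outside_support[of r "\<lambda>x. complex_of_real (F x)", OF supp' that, of j] by (simp add: p)
  then show i: "integrable lborel (\<lambda>x. D x (axis j 1))"
    by (rule continuous_compact_support_square_integrable(1)[OF F(2)])
  have "(LINT x|lborel. partial j (\<lambda>x. complex_of_real (F x)) x) = 0"
  proof (rule integral_partial_eq_0[OF _ _ supp'])
    show "(\<lambda>x. complex_of_real (F x)) differentiable (at z)" for z
      using bounded_linear.has_derivative[OF bounded_linear_of_real F(1)] by (auto simp: differentiable_def)
    show "continuous_on UNIV (partial j (\<lambda>x. complex_of_real (F x)))" for j
      unfolding p by (intro continuous_on_of_real F)
  qed
  then show "(LINT x|lborel. D x (axis j 1)) = 0" by (simp add: p)
qed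

text \<open>The mean value theorem, applied twice. The second difference on the left is symmetric in \<open>a\<close> and \<open>b\<close>
  while the right hand side is not: this is the source of the symmetry of second derivatives.\<close>

lemma second_difference_mean_value:
  fixes f :: "real^3 \<Rightarrow> real"
  assumes f: "\<And>x. (f has_derivative D x) (at x)"
    and D: "\<And>x. ((\<lambda>x. D x a) has_derivative E x) (at x)" and t: "t > 0"
  shows "\<exists>\<xi>. norm (\<xi> - x) \<le> t * (norm a + norm b) \<and>
    f (x + t *\<^sub>R a + t *\<^sub>R b) - f (x + t *\<^sub>R a) - f (x + t *\<^sub>R b) + f x = t\<^sup>2 * E \<xi> b"
proof -
  define g where "g s = f (x + s *\<^sub>R a + t *\<^sub>R b) - f (x + s *\<^sub>R a)" for s
  have g: "(g has_real_derivative D (x + s *\<^sub>R a + t *\<^sub>R b) a - D (x + s *\<^sub>R a) a) (at s)" for s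
  proof -
    have *: "((\<lambda>s. f (y + s *\<^sub>R a)) has_derivative (\<lambda>h. D (y + s *\<^sub>R a) (h *\<^sub>R a))) (at s)" for y
      by (rule has_derivative_compose[OF _ f]) (auto intro!: derivative_eq_intros)
    have "D y (h *\<^sub>R a) = h * D y a" for y h
      using bounded_linear.linear[OF has_derivative_bounded_linear[OF f]] by (simp add: linear_cmul)
    then show ?thesis
      unfolding g_def has_field_derivative_def
      by (rule_tac has_derivative_eq_rhs[OF has_derivative_diff[OF *[of "x + t *\<^sub>R b"] *[of x], unfolded add.assoc add.commute[of "t *\<^sub>R b"], folded add.assoc]])
        (simp add: fun_eq_iff algebra_simps)
  qed
  obtain s where s: "0 < s" "s < t" "g t - g 0 = (t - 0) * (D (x + s *\<^sub>R a + t *\<^sub>R b) a - D (x + s *\<^sub>R a) a)"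
    using MVT2[of 0 t g "\<lambda>s. D (x + s *\<^sub>R a + t *\<^sub>R b) a - D (x + s *\<^sub>R a) a"] g t by blast
  define k where "k r = D (x + s *\<^sub>R a + r *\<^sub>R b) a" for r
  have k: "(k has_real_derivative E (x + s *\<^sub>R a + r *\<^sub>R b) b) (at r)" for r
  proof -
    have *: "(k has_derivative (\<lambda>h. E (x + s *\<^sub>R a + r *\<^sub>R b) (h *\<^sub>R b))) (at r)"
      unfolding k_def by (rule has_derivative_compose[OF _ D]) (auto intro!: derivative_eq_intros)
    have "E y (h *\<^sub>R b) = h * E y b" for y h
      using bounded_linear.linear[OF has_derivative_bounded_linear[OF D]] by (simp add: linear_cmul)
    then show ?thesis
      unfolding has_field_derivative_def
      by (intro has_derivative_eq_rhs[OF *]) (simp add: fun_eq_iff)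
  qed
  obtain r where r: "0 < r" "r < t" "k t - k 0 = (t - 0) * E (x + s *\<^sub>R a + r *\<^sub>R b) b"
    using MVT2[of 0 t k "\<lambda>r. E (x + s *\<^sub>R a + r *\<^sub>R b) b"] k t by blast
  have "norm (s *\<^sub>R a + r *\<^sub>R b) \<le> s * norm a + r * norm b"
    using norm_triangle_ineq[of "s *\<^sub>R a" "r *\<^sub>R b"] s r by simp
  also have "\<dots> \<le> t * norm a + t * norm b"
    using s r by (intro add_mono mult_right_mono) auto
  finally have "norm (s *\<^sub>R a + r *\<^sub>R b) \<le> t * (norm a + norm b)" by (simp add: distrib_left)
  moreover have "f (x + t *\<^sub>R a + t *\<^sub>R b) - f (x + t *\<^sub>R a) - f (x + t *\<^sub>R b) + f x = t\<^sup>2 * E (x + s *\<^sub>R a + r *\<^sub>R b) b"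
    using s(3) r(3) by (simp add: g_def k_def power2_eq_square)
  ultimately show ?thesis by (intro exI[of _ "x + s *\<^sub>R a + r *\<^sub>R b"]) (simp add: add.assoc)
qed

lemma mixed_derivatives_eq:
  fixes f :: "real^3 \<Rightarrow> real"
  assumes f: "\<And>x. (f has_derivative D x) (at x)"
    and Da: "\<And>x. ((\<lambda>x. D x a) has_derivative Ea x) (at x)" "continuous_on UNIV (\<lambda>x. Ea x b)"
    and Db: "\<And>x. ((\<lambda>x. D x b) has_derivative Eb x) (at x)" "continuous_on UNIV (\<lambda>x. Eb x a)"
  shows "Ea x b = Eb x a"
proof -
  define T where "T n = 1 / (real n + 1) / (norm a + norm b + 1)" for n
  have T: "T n > 0" for n unfolding T_def by (intro divide_pos_pos add_nonneg_pos) auto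
  have "\<exists>\<xi> \<eta>. norm (\<xi> - x) \<le> T n * (norm a + norm b) \<and> norm (\<eta> - x) \<le> T n * (norm a + norm b) \<and> Ea \<xi> b = Eb \<eta> a" for n
  proof -
    obtain \<xi> where \<xi>: "norm (\<xi> - x) \<le> T n * (norm a + norm b)"
      "f (x + T n *\<^sub>R a + T n *\<^sub>R b) - f (x + T n *\<^sub>R a) - f (x + T n *\<^sub>R b) + f x = (T n)\<^sup>2 * Ea \<xi> b"
      using second_difference_mean_value[OF f Da(1) T] by blast
    obtain \<eta> where \<eta>: "norm (\<eta> - x) \<le> T n * (norm b + norm a)"
      "f (x + T n *\<^sub>R b + T n *\<^sub>R a) - f (x + T n *\<^sub>R b) - f (x + T n *\<^sub>R a) + f x = (T n)\<^sup>2 * Eb \<eta> a"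
      using second_difference_mean_value[OF f Db(1) T] by blast
    have "x + T n *\<^sub>R b + T n *\<^sub>R a = x + T n *\<^sub>R a + T n *\<^sub>R b" by simp
    with \<eta>(2) have "f (x + T n *\<^sub>R a + T n *\<^sub>R b) - f (x + T n *\<^sub>R b) - f (x + T n *\<^sub>R a) + f x = (T n)\<^sup>2 * Eb \<eta> a"
      by (simp only:)
    with \<xi>(2) have "(T n)\<^sup>2 * Ea \<xi> b = (T n)\<^sup>2 * Eb \<eta> a" by linarith
    then show ?thesis using \<xi>(1) \<eta>(1) T[of n] by (auto simp: add.commute)
  qed
  then obtain \<xi> \<eta> where *: "\<And>n. norm (\<xi> n - x) \<le> T n * (norm a + norm b)" "\<And>n. norm (\<eta> n - x) \<le> T n * (norm a + norm b)"
    "\<And>n. Ea (\<xi> n) b = Eb (\<eta> n) a" by metis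
  have "(\<lambda>n. 1 / (real n + 1)) \<longlonglongrightarrow> 0"
    by (rule tendsto_inverse_real_plus_1)
  then have "(\<lambda>n. 1 / (real n + 1) * (1 / (norm a + norm b + 1) * (norm a + norm b))) \<longlonglongrightarrow> 0"
    by (rule tendsto_mult_left_zero)
  then have T0: "(\<lambda>n. T n * (norm a + norm b)) \<longlonglongrightarrow> 0"
    by (simp add: T_def)
  have "(\<lambda>n. \<xi> n - x) \<longlonglongrightarrow> 0" "(\<lambda>n. \<eta> n - x) \<longlonglongrightarrow> 0"
    using * by (auto intro!: Lim_null_comparison[OF always_eventually T0])
  then have lim: "\<xi> \<longlonglongrightarrow> x" "\<eta> \<longlonglongrightarrow> x" by (auto dest: LIM_zero_cancel)
  have "(\<lambda>n. Ea (\<xi> n) b) \<longlonglongrightarrow> Ea x b" "(\<lambda>n. Eb (\<eta> n) a) \<longlonglongrightarrow> Eb x a"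
    using Da(2) Db(2) lim by (auto intro: isCont_tendsto_compose simp: continuous_on_eq_continuous_at)
  then show ?thesis unfolding *(3) by (rule LIMSEQ_unique)
qed

section \<open>Mollification\<close>

definition mollifier :: "nat \<Rightarrow> real^3 \<Rightarrow> real" where
  "mollifier n x = bump ((1 / (real n + 1))\<^sup>2) 1 x / (LINT y|lborel. bump ((1 / (real n + 1))\<^sup>2) 1 y)"

lemma bump_continuous: "c > 0 \<Longrightarrow> continuous_on UNIV (bump a c)"
  using continuous_on_Re[OF test_function_continuous[OF bump_test_function, of c UNIV a]] by simp

lemma bump_integral_pos:
  assumes "r > 0"
  shows "integrable lborel (bump (r\<^sup>2) 1)" "(LINT y|lborel. bump (r\<^sup>2) 1 y) > 0"
proof -
  show i: "integrable lborel (bump (r\<^sup>2) 1)"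
    by (rule continuous_compact_support_square_integrable(1)[where R=r, OF bump_continuous bump_outside[where R=r]])
      (use assms in auto)
  have "(LINT y|lborel. bump (r\<^sup>2) 1 y) \<noteq> 0"
  proof
    assume "(LINT y|lborel. bump (r\<^sup>2) 1 y) = 0"
    then have "AE y in lborel. bump (r\<^sup>2) 1 y = 0"
      using integral_nonneg_eq_0_iff_AE[OF i] bump_nonneg by simp
    then have "AE y in lborel. y \<notin> ball (0::real^3) r"
    proof eventually_elim
      case (elim y)
      show ?case
      proof
        assume "y \<in> ball 0 r"
        then have "(norm y)\<^sup>2 < r\<^sup>2" by (intro power_strict_mono) auto
        then show False using elim by (simp add: bump_def flat_exp_def)
      qed
    qed
    then have "emeasure lborel (ball (0::real^3) r) = 0"
      using AE_iff_null_sets[of "ball (0::real^3) r" lborel] by (auto simp: null_sets_def)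
    then show False
      using content_ball_pos[OF assms, of "0::real^3"] by (simp add: measure_def)
  qed
  moreover have "(LINT y|lborel. bump (r\<^sup>2) 1 y) \<ge> 0"
    by (simp add: bump_nonneg)
  ultimately show "(LINT y|lborel. bump (r\<^sup>2) 1 y) > 0" by linarith
qed

lemma mollifier:
  shows mollifier_nonneg: "mollifier n x \<ge> 0"
    and mollifier_outside: "norm x > 1 / (real n + 1) \<Longrightarrow> mollifier n x = 0"
    and mollifier_integrable: "integrable lborel (mollifier n)"
    and mollifier_integral: "integral\<^sup>L lborel (mollifier n) = 1"
    and mollifier_test_function: "(\<lambda>x. complex_of_real (mollifier n x)) \<in> test_functions"
    and mollifier_continuous: "continuous_on UNIV (mollifier n)"
proof -
  define r where "r = 1 / (real n + 1)"
  have r: "r > 0" by (simp add: r_def)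
  define I where "I = (LINT y|lborel. bump (r\<^sup>2) 1 y)"
  have I: "I > 0" unfolding I_def by (rule bump_integral_pos[OF r])
  have m: "mollifier n = (\<lambda>x. bump (r\<^sup>2) 1 x / I)"
    by (simp add: mollifier_def I_def r_def fun_eq_iff)
  show "mollifier n x \<ge> 0" using I by (simp add: m bump_nonneg)
  show "norm x > 1 / (real n + 1) \<Longrightarrow> mollifier n x = 0"
    using bump_outside[of 1 r "r\<^sup>2" x] r by (simp add: m r_def)
  show "integrable lborel (mollifier n)"
    unfolding m by (intro integrable_divide bump_integral_pos r)
  show "integral\<^sup>L lborel (mollifier n) = 1"
    using I by (simp add: m I_def)
  show "(\<lambda>x. complex_of_real (mollifier n x)) \<in> test_functions"
    using test_function_mult_const[OF bump_test_function, of 1 "r\<^sup>2" "1 / of_real I"] by (simp add: m)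
  show "continuous_on UNIV (mollifier n)"
    unfolding m by (intro continuous_intros bump_continuous) (use I in auto)
qed

definition mollify :: "nat \<Rightarrow> (real^3 \<Rightarrow> complex^'n) \<Rightarrow> real^3 \<Rightarrow> complex^'n::finite" where
  "mollify n = conv (\<lambda>x. complex_of_real (mollifier n x))"

lemma mollify_integrable:
  fixes u :: "real^3 \<Rightarrow> complex^'n"
  shows "loc_integrable u \<Longrightarrow> integrable lborel (\<lambda>y. mollifier n (x - y) *\<^sub>R u y)"
  using conv_integrable[of "\<lambda>x. complex_of_real (mollifier n x)" "1 / (real n + 1)" u x]
    mollifier_outside test_function_continuous[OF mollifier_test_function]
  by (simp add: vector_scalar_mult_of_real)

lemma mollify_eq: "mollify n u x = (LINT y|lborel. mollifier n (x - y) *\<^sub>R u y)"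
  by (simp add: mollify_def conv_def vector_scalar_mult_of_real)

lemma mollifier_reflect:
  "integrable lborel (\<lambda>y. mollifier n (x - y))" "(LINT y|lborel. mollifier n (x - y)) = 1"
proof -
  have m: "mollifier n \<in> borel_measurable borel"
    by (intro borel_measurable_continuous_onI mollifier_continuous)
  show i: "(LINT y|lborel. mollifier n (x - y)) = 1"
    using lborel_integral_reflect[OF m] mollifier_integral by simp
  then show "integrable lborel (\<lambda>y. mollifier n (x - y))"
    using not_integrable_integral_eq by fastforce
qed

text \<open>Jensen's inequality for the probability density \<open>\<lambda>y. mollifier n (x - y)\<close>.\<close>

lemma mollify_norm_square_le:
  fixes u :: "real^3 \<Rightarrow> complex^'n"
  assumes "square_integrable lborel u"
  shows "ennreal ((norm (mollify n u x))\<^sup>2) \<le> (\<integral>\<^sup>+y. ennreal (mollifier n (x - y)) * ennreal ((norm (u y))\<^sup>2) \<partial>lborel)"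
proof -
  have mm [measurable]: "mollifier n \<in> borel_measurable borel"
    by (intro borel_measurable_continuous_onI mollifier_continuous)
  have um [measurable]: "u \<in> borel_measurable borel"
    using assms by (simp add: square_integrable_def)
  let ?k = "\<lambda>y. sqrt (mollifier n (x - y))"
  have k: "square_integrable lborel ?k" "mean_square lborel ?k = 1"
    using mollifier_reflect[of n x] by (auto simp: square_integrable_def mean_square_def mollifier_nonneg)
  obtain C where C: "C > 0" "\<And>z. norm (mollifier n z) \<le> C"
  proof -
    have "bounded (mollifier n ` cball 0 (1 / (real n + 1)))"
      by (intro compact_imp_bounded compact_continuous_image continuous_on_subset[OF mollifier_continuous]) auto
    then obtain C where C: "C > 0" "\<And>z. norm z \<le> 1 / (real n + 1) \<Longrightarrow> norm (mollifier n z) \<le> C"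
      by (auto simp: bounded_pos)
    have "norm (mollifier n z) \<le> C" for z
      using C mollifier_outside[of n z] by (cases "norm z \<le> 1 / (real n + 1)") auto
    with C(1) show ?thesis by (rule that)
  qed
  have ku: "square_integrable lborel (\<lambda>y. ?k y *\<^sub>R u y)"
  proof (rule square_integrable_bound[OF assms])
    show "norm (?k y *\<^sub>R u y) \<le> sqrt C * norm (u y)" for y
      using C(2)[of "x - y"] mollifier_nonneg[of n "x - y"] by (auto intro!: mult_right_mono)
  qed measurable
  have "norm (mollify n u x) \<le> (LINT y|lborel. norm (mollifier n (x - y) *\<^sub>R u y))"
    unfolding mollify_eq by (rule integral_norm_bound)
  also have "\<dots> = (LINT y|lborel. norm (?k y) * norm (?k y *\<^sub>R u y))"
    by (rule arg_cong[where f="integral\<^sup>L lborel"]) (simp add: fun_eq_iff mollifier_nonneg flip: mult.assoc)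
  also have "\<dots> \<le> sqrt (mean_square lborel ?k) * sqrt (mean_square lborel (\<lambda>y. ?k y *\<^sub>R u y))"
    by (rule Cauchy_Schwarz_integral[OF k(1) ku])
  also have "\<dots> = sqrt (mean_square lborel (\<lambda>y. ?k y *\<^sub>R u y))" by (simp add: k)
  finally have "(norm (mollify n u x))\<^sup>2 \<le> mean_square lborel (\<lambda>y. ?k y *\<^sub>R u y)"
    by (metis norm_ge_zero power_mono real_sqrt_pow2 mean_square_nonneg)
  then have "ennreal ((norm (mollify n u x))\<^sup>2) \<le> ennreal (LINT y|lborel. (norm (?k y *\<^sub>R u y))\<^sup>2)"
    by (simp add: mean_square_def ennreal_leI)
  also have "\<dots> = (\<integral>\<^sup>+y. ennreal ((norm (?k y *\<^sub>R u y))\<^sup>2) \<partial>lborel)"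
    using ku by (intro nn_integral_eq_integral[symmetric]) (auto simp: square_integrable_def)
  also have "\<dots> = (\<integral>\<^sup>+y. ennreal (mollifier n (x - y)) * ennreal ((norm (u y))\<^sup>2) \<partial>lborel)"
    by (intro nn_integral_cong) (simp add: power_mult_distrib mollifier_nonneg ennreal_mult')
  finally show ?thesis .
qed

lemma mollify_differentiable:
  fixes u :: "real^3 \<Rightarrow> complex^'n"
  assumes "loc_integrable u"
  shows "(mollify n u has_derivative (\<lambda>h. \<Sum>j\<in>UNIV. (h $ j) *\<^sub>R conv (partial j (\<lambda>x. complex_of_real (mollifier n x))) u x)) (at x)"
  unfolding mollify_def
proof (rule conv_has_derivative[OF _ _ _ assms])
  show "(\<lambda>x. complex_of_real (mollifier n x)) differentiable (at z)" for z
    by (rule test_function_differentiable[OF mollifier_test_function])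
  show "continuous_on UNIV (partial j (\<lambda>x. complex_of_real (mollifier n x)))" for j
    by (rule test_function_continuous[OF test_function_partial[OF mollifier_test_function]])
  show "complex_of_real (mollifier n z) = 0" if "norm z > 1 / (real n + 1)" for z
    using mollifier_outside[OF that] by simp
qed

lemma mollify_continuous: "loc_integrable u \<Longrightarrow> continuous_on A (mollify n u)"
  by (rule continuous_at_imp_continuous_on) (auto intro: has_derivative_continuous[OF mollify_differentiable])

text \<open>Integrating Jensen's inequality in \<open>x\<close> and exchanging the integrals shows that mollification is a
  contraction, as the mollifier has integral \<open>1\<close> in either variable.\<close>

lemma mollify_mean_square_le:
  fixes u :: "real^3 \<Rightarrow> complex^'n"
  assumes "square_integrable lborel u"
  shows "square_integrable lborel (mollify n u)" "mean_square lborel (mollify n u) \<le> mean_square lborel u"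
proof -
  have [measurable]: "mollifier n \<in> borel_measurable borel"
    by (intro borel_measurable_continuous_onI mollifier_continuous)
  have [measurable]: "u \<in> borel_measurable borel"
    using assms by (simp add: square_integrable_def)
  have m [measurable]: "mollify n u \<in> borel_measurable borel"
    by (intro borel_measurable_continuous_onI mollify_continuous square_integrable_loc_integrable assms)
  have "(\<integral>\<^sup>+x. ennreal ((norm (mollify n u x))\<^sup>2) \<partial>lborel)
      \<le> (\<integral>\<^sup>+x. (\<integral>\<^sup>+y. ennreal (mollifier n (x - y)) * ennreal ((norm (u y))\<^sup>2) \<partial>lborel) \<partial>lborel)"
    by (intro nn_integral_mono mollify_norm_square_le assms)
  also have "\<dots> = (\<integral>\<^sup>+y. (\<integral>\<^sup>+x. ennreal (mollifier n (x - y)) * ennreal ((norm (u y))\<^sup>2) \<partial>lborel) \<partial>lborel)"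
    by (rule lborel_pair.Fubini') measurable
  also have "\<dots> = (\<integral>\<^sup>+y. ennreal ((norm (u y))\<^sup>2) \<partial>lborel)"
  proof (rule nn_integral_cong)
    fix y
    have "(\<integral>\<^sup>+x. ennreal (mollifier n (x - y)) \<partial>lborel) = (\<integral>\<^sup>+x. ennreal (mollifier n (x - y)) \<partial>distr lborel borel ((+) y))"
      by (simp add: lborel_distr_plus)
    also have "\<dots> = (\<integral>\<^sup>+x. ennreal (mollifier n x) \<partial>lborel)"
      by (subst nn_integral_distr) auto
    also have "\<dots> = 1"
      using nn_integral_eq_integral[OF mollifier_integrable[of n]] mollifier_nonneg mollifier_integral[of n] by simp
    finally show "(\<integral>\<^sup>+x. ennreal (mollifier n (x - y)) * ennreal ((norm (u y))\<^sup>2) \<partial>lborel) = ennreal ((norm (u y))\<^sup>2)"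
      by (subst nn_integral_multc) auto
  qed
  also have "\<dots> = ennreal (mean_square lborel u)"
    unfolding mean_square_def using assms by (intro nn_integral_eq_integral) (auto simp: square_integrable_def)
  finally have le: "(\<integral>\<^sup>+x. ennreal ((norm (mollify n u x))\<^sup>2) \<partial>lborel) \<le> ennreal (mean_square lborel u)" .
  then have i: "integrable lborel (\<lambda>x. (norm (mollify n u x))\<^sup>2)"
    by (intro integrableI_nonneg) (auto simp: le_less_trans)
  then show "square_integrable lborel (mollify n u)" by (simp add: square_integrable_def m)
  from le show "mean_square lborel (mollify n u) \<le> mean_square lborel u"
    by (simp add: nn_integral_eq_integral[OF i] mean_square_def)
qed

lemma mollify_diff:
  fixes u :: "real^3 \<Rightarrow> complex^'n"
  assumes "loc_integrable u" "loc_integrable v"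
  shows "mollify n (\<lambda>x. u x - v x) x = mollify n u x - mollify n v x"
  unfolding mollify_eq scaleR_diff_right
  by (rule Bochner_Integration.integral_diff[OF mollify_integrable[OF assms(1)] mollify_integrable[OF assms(2)]])

lemma mollify_outside:
  fixes u :: "real^3 \<Rightarrow> complex^'n"
  assumes "\<And>y. norm y > R \<Longrightarrow> u y = 0" "norm x > R + 1"
  shows "mollify n u x = 0"
proof -
  have "1 / (real n + 1) \<le> 1" by simp
  with assms(2) have *: "norm x > R + 1 / (real n + 1)" by linarith
  show ?thesis
    unfolding mollify_def
    by (rule conv_outside[OF _ assms(1) *]) (simp_all add: mollifier_outside)
qed

lemma compact_support_uniform_continuity:
  fixes w :: "'a::euclidean_space \<Rightarrow> 'b::euclidean_space"
  assumes "continuous_on UNIV w" "\<And>x. norm x > R \<Longrightarrow> w x = 0" "e > 0"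
  obtains d where "d > 0" "\<And>x y. dist x y < d \<Longrightarrow> dist (w x) (w y) < e"
proof -
  have "uniformly_continuous_on (cball 0 (R + 1)) w"
    by (intro compact_uniformly_continuous continuous_on_subset[OF assms(1)]) auto
  from this[THEN uniformly_continuous_on_def[THEN iffD1], THEN spec, THEN mp, OF assms(3)]
  have "\<exists>d>0. \<forall>x\<in>cball 0 (R + 1). \<forall>y\<in>cball 0 (R + 1). dist y x < d \<longrightarrow> dist (w y) (w x) < e" .
  then obtain d where d: "d > 0" "\<forall>x\<in>cball 0 (R + 1). \<forall>y\<in>cball 0 (R + 1). dist y x < d \<longrightarrow> dist (w y) (w x) < e"
    by (elim exE conjE) (rule that)
  have "dist (w x) (w y) < e" if xy: "dist x y < min d 1" for x y
  proof (cases "x \<in> cball 0 (R + 1) \<and> y \<in> cball 0 (R + 1)")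
    case False
    have "\<bar>norm x - norm y\<bar> < 1"
      using xy norm_triangle_ineq3[of x y] by (simp add: dist_norm)
    moreover have "norm x > R + 1 \<or> norm y > R + 1" using False by auto
    ultimately have "norm x > R" "norm y > R" by linarith+
    then show ?thesis using assms by simp
  qed (use d xy in \<open>simp add: dist_commute\<close>)
  then show ?thesis using d(1) by (intro that[of "min d 1"]) auto
qed

lemma mollify_continuous_converges:
  fixes w :: "real^3 \<Rightarrow> complex^'n"
  assumes w: "continuous_on UNIV w" "\<And>x. norm x > R \<Longrightarrow> w x = 0"
  shows "(\<lambda>n. mean_square lborel (\<lambda>x. mollify n w x - w x)) \<longlonglongrightarrow> 0"
proof (rule LIMSEQ_I)
  fix e :: real assume e: "e > 0"
  define V where "V = measure lborel (cball (0::real^3) (R + 1))"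
  define e' where "e' = sqrt (e / (V + 1))"
  have V: "V \<ge> 0" by (simp add: V_def)
  have "e'\<^sup>2 = e / (V + 1)" using e V by (simp add: e'_def)
  then have e': "e' > 0" "e'\<^sup>2 * V < e"
    using e V by (simp_all add: e'_def pos_divide_less_eq add_nonneg_pos)
  obtain d where d: "d > 0" "\<And>x y. dist x y < d \<Longrightarrow> dist (w x) (w y) < e'"
    using compact_support_uniform_continuity[OF w e'(1)] by blast
  obtain n0 :: nat where n0: "1 / d < real n0" using reals_Archimedean2 by blast
  have wl: "loc_integrable w"
    by (intro square_integrable_loc_integrable continuous_compact_support_square_integrable(2)[OF w])
  have "norm (mean_square lborel (\<lambda>x. mollify n w x - w x) - 0) < e" if n: "n \<ge> n0" for n
  proof -
    have "1 / d < real n + 1" using n0 n by simp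
    then have nd: "1 / (real n + 1) < d" using d(1) by (simp add: field_simps)
    have close: "norm (mollify n w x - w x) \<le> e'" for x
    proof -
      have "w x = (LINT y|lborel. mollifier n (x - y) *\<^sub>R w x)"
        using mollifier_reflect[of n x] by simp
      then have "mollify n w x - w x = (LINT y|lborel. mollifier n (x - y) *\<^sub>R w y) - (LINT y|lborel. mollifier n (x - y) *\<^sub>R w x)"
        by (simp only: mollify_eq)
      also have "\<dots> = (LINT y|lborel. mollifier n (x - y) *\<^sub>R w y - mollifier n (x - y) *\<^sub>R w x)"
        using mollify_integrable[OF wl] mollifier_reflect[of n x] by simp
      also have "norm \<dots> \<le> (LINT y|lborel. mollifier n (x - y) * e')"
      proof (rule Bochner_Integration.integral_norm_bound_integral)
        show "integrable lborel (\<lambda>y. mollifier n (x - y) *\<^sub>R w y - mollifier n (x - y) *\<^sub>R w x)"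
          using mollify_integrable[OF wl] mollifier_reflect[of n x] by simp
        show "integrable lborel (\<lambda>y. mollifier n (x - y) * e')"
          using mollifier_reflect[of n x] by simp
        show "norm (mollifier n (x - y) *\<^sub>R w y - mollifier n (x - y) *\<^sub>R w x) \<le> mollifier n (x - y) * e'" for y
        proof (cases "norm (x - y) > 1 / (real n + 1)")
          case True
          then show ?thesis by (simp add: mollifier_outside)
        next
          case False
          then have "dist y x < d" using nd by (simp add: dist_norm norm_minus_commute)
          from d(2)[OF this] have "norm (w y - w x) \<le> e'" by (simp add: dist_norm)
          then have "mollifier n (x - y) * norm (w y - w x) \<le> mollifier n (x - y) * e'"
            by (intro mult_left_mono mollifier_nonneg)
          then show ?thesis
            using mollifier_nonneg[of n "x - y"] by (simp flip: scaleR_diff_right)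
        qed
      qed
      also have "\<dots> = e'" using mollifier_reflect[of n x] by simp
      finally show ?thesis .
    qed
    have "mean_square lborel (\<lambda>x. mollify n w x - w x) \<le> (LINT x|(lborel :: (real^3) measure). indicator (cball 0 (R + 1)) x *\<^sub>R e'\<^sup>2)"
      unfolding mean_square_def
    proof (rule Bochner_Integration.integral_mono)
      have "square_integrable lborel (\<lambda>x. mollify n w x - w x)"
        by (intro square_integrable_diff mollify_mean_square_le continuous_compact_support_square_integrable(2)[OF w])
      then show "integrable lborel (\<lambda>x. (norm (mollify n w x - w x))\<^sup>2)"
        by (simp add: square_integrable_def)
      show "integrable lborel (\<lambda>x::real^3. indicator (cball 0 (R + 1)) x *\<^sub>R e'\<^sup>2)"
        by (rule integrable_indicator_cball)
      show "(norm (mollify n w x - w x))\<^sup>2 \<le> indicator (cball 0 (R + 1)) x *\<^sub>R e'\<^sup>2" for x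
      proof (cases "norm x \<le> R + 1")
        case True
        then show ?thesis using power_mono[OF close[of x], of 2] by simp
      next
        case False
        then have "mollify n w x = 0" "w x = 0"
          using mollify_outside[of R w x n] w(2) by auto
        then show ?thesis by simp
      qed
    qed
    also have "\<dots> = e'\<^sup>2 * V" by (simp add: V_def)
    finally show ?thesis using e'(2) by simp
  qed
  then show "\<exists>no. \<forall>n\<ge>no. norm (mean_square lborel (\<lambda>x. mollify n w x - w x) - 0) < e" by blast
qed

text \<open>Since mollifications are contractions, convergence need only be known on a dense set, and for
  continuous functions of compact support it follows from uniform continuity.\<close>

lemma mollify_converges:
  fixes u :: "real^3 \<Rightarrow> complex^'n"
  assumes u: "square_integrable lborel u"
  shows "(\<lambda>n. mean_square lborel (\<lambda>x. mollify n u x - u x)) \<longlonglongrightarrow> 0"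
proof (rule LIMSEQ_I)
  fix e :: real assume e: "e > 0"
  \<comment> \<open>the two triangle inequalities below add up to ten times this quantity\<close>
  have "e / 12 > 0" using e by simp
  obtain w R where w: "continuous_on UNIV w" "\<And>x. norm x > R \<Longrightarrow> w x = 0"
    and wu: "mean_square lborel (\<lambda>x. w x - u x) < e / 12"
    by (rule continuous_approximation[OF u \<open>e / 12 > 0\<close>]) (rule that; assumption)
  have ws: "square_integrable lborel w" by (rule continuous_compact_support_square_integrable(2)[OF w])
  obtain n0 where n0: "\<And>n. n \<ge> n0 \<Longrightarrow> mean_square lborel (\<lambda>x. mollify n w x - w x) < e / 12"
    using order_tendstoD(2)[OF mollify_continuous_converges[where R=R, OF w] \<open>e / 12 > 0\<close>]
    unfolding eventually_sequentially by blast
  have "norm (mean_square lborel (\<lambda>x. mollify n u x - u x) - 0) < e" if n: "n \<ge> n0" for n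
  proof -
    note sq = square_integrable_diff(1) mollify_mean_square_le(1) u ws
    have "mollify n u x - u x = mollify n (\<lambda>x. u x - w x) x + ((mollify n w x - w x) + (w x - u x))" for x
      using mollify_diff[OF square_integrable_loc_integrable[OF u] square_integrable_loc_integrable[OF ws]] by simp
    then have "mean_square lborel (\<lambda>x. mollify n u x - u x) =
        mean_square lborel (\<lambda>x. mollify n (\<lambda>x. u x - w x) x + ((mollify n w x - w x) + (w x - u x)))"
      by (simp only:)
    also have "\<dots> \<le> 2 * mean_square lborel (mollify n (\<lambda>x. u x - w x)) + 2 * mean_square lborel (\<lambda>x. (mollify n w x - w x) + (w x - u x))"
      by (intro square_integrable_add sq)
    finally have "mean_square lborel (\<lambda>x. mollify n u x - u x)
       \<le> 2 * mean_square lborel (mollify n (\<lambda>x. u x - w x)) + 2 * mean_square lborel (\<lambda>x. (mollify n w x - w x) + (w x - u x))" .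
    moreover have "mean_square lborel (mollify n (\<lambda>x. u x - w x)) \<le> mean_square lborel (\<lambda>x. u x - w x)"
      by (intro mollify_mean_square_le sq)
    moreover have "mean_square lborel (\<lambda>x. u x - w x) = mean_square lborel (\<lambda>x. w x - u x)"
      by (simp add: mean_square_def norm_minus_commute)
    moreover have "mean_square lborel (\<lambda>x. (mollify n w x - w x) + (w x - u x))
       \<le> 2 * mean_square lborel (\<lambda>x. mollify n w x - w x) + 2 * mean_square lborel (\<lambda>x. w x - u x)"
      by (intro square_integrable_add sq)
    ultimately have "mean_square lborel (\<lambda>x. mollify n u x - u x) < e"
      using n0[OF n] wu e by linarith
    then show ?thesis by simp
  qed
  then show "\<exists>no. \<forall>n\<ge>no. norm (mean_square lborel (\<lambda>x. mollify n u x - u x) - 0) < e" by blast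
qed

section \<open>The Weyl operator and its weak extension\<close>

lemma pauli_selfadjoint: "(pauli j *v a) \<bullet> b = a \<bullet> (pauli j *v b)"
  using exhaust_3[of j]
  by (auto simp: pauli_def inner_vec_def sum_2 matrix_vector_mult_def inner_complex_def)

lemma pauli_pauli: "pauli j *v (pauli j *v a) = a"
  using exhaust_3[of j]
  by (auto simp: pauli_def vec_eq_iff forall_2 sum_2 matrix_vector_mult_def simp flip: mult.assoc)

lemma pauli_anticommute: "i \<noteq> j \<Longrightarrow> pauli i *v (pauli j *v a) = - (pauli j *v (pauli i *v a))"
  using exhaust_3[of i] exhaust_3[of j]
  by (auto simp: pauli_def vec_eq_iff forall_2 sum_2 matrix_vector_mult_def simp flip: mult.assoc)

lemma pauli_bounded_linear: "bounded_linear ((*v) (pauli j))"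
  by (rule matrix_vector_mul_bounded_linear)

lemma norm_pauli: "norm (pauli j *v a) = norm a"
  by (simp add: norm_eq_sqrt_inner pauli_selfadjoint pauli_pauli)

lemma pauli_scalar: "pauli j *v (c *s a) = c *s (pauli j *v a)"
  by (simp add: vec_eq_iff matrix_vector_mult_def sum_distrib_left algebra_simps)

lemma pauli_scaleR: "pauli j *v (c *\<^sub>R a) = c *\<^sub>R (pauli j *v a)"
  by (rule linear_cmul[OF bounded_linear.linear[OF pauli_bounded_linear]])

lemma pauli_minus: "pauli j *v (- a) = - (pauli j *v a)"
  by (rule linear_neg[OF bounded_linear.linear[OF pauli_bounded_linear]])

lemma vec_scalar_add: "(c + d) *s (a :: complex^'n) = c *s a + d *s a"
  by (simp add: vec_eq_iff algebra_simps)

lemma vector_scalar_mult_minus: "(- c) *s (a :: complex^'n) = - (c *s a)"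
  by (simp add: vec_eq_iff)

definition spinor_partial :: "3 \<Rightarrow> (real^3 \<Rightarrow> complex^2) \<Rightarrow> real^3 \<Rightarrow> complex^2" where
  "spinor_partial j v x = (\<chi> c. partial j (\<lambda>y. v y $ c) x)"

text \<open>This is \<open>\<sigma> . grad\<close>, that is \<open>\<i>\<close> times \<open>\<sigma> . D\<close>. Without the factor \<open>1 / \<i>\<close> the operator is antisymmetric
  for the real inner product of \<open>complex^2\<close>, and the whole argument takes place in this real Hilbert
  space.\<close>

definition weyl :: "(real^3 \<Rightarrow> complex^2) \<Rightarrow> real^3 \<Rightarrow> complex^2" where
  "weyl v x = (\<Sum>j\<in>UNIV. pauli j *v spinor_partial j v x)"

definition test_spinor :: "(real^3 \<Rightarrow> complex^2) \<Rightarrow> bool" where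
  "test_spinor v \<longleftrightarrow> (\<forall>c. (\<lambda>x. v x $ c) \<in> test_functions)"

definition weak_weyl :: "(real^3 \<Rightarrow> complex^2) \<Rightarrow> (real^3 \<Rightarrow> complex^2) \<Rightarrow> bool" where
  "weak_weyl u g \<longleftrightarrow> (\<forall>\<psi>\<in>test_functions.
     (LINT x|lborel. (\<Sum>j\<in>UNIV. pauli j *v (partial j \<psi> x *s u x))) = - (LINT x|lborel. \<psi> x *s g x))"

lemma test_function_reflect:
  assumes "K \<in> test_functions"
  shows "(\<lambda>y. K (x - y)) \<in> test_functions" "partial j (\<lambda>y. K (x - y)) y = - partial j K (x - y)"
proof -
  have d: "((\<lambda>y. K (x - y)) has_derivative (\<lambda>h. \<Sum>j\<in>UNIV. ((- h) $ j) *\<^sub>R partial j K (x - y))) (at y)"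
    if "K \<in> test_functions" for K y
    by (rule has_derivative_compose[OF _ differentiable_has_partial_derivative[OF test_function_differentiable[OF that]]])
      (auto intro!: derivative_eq_intros)
  have p: "partial j (\<lambda>y. K (x - y)) y = - partial j K (x - y)" if "K \<in> test_functions" for K j y
    by (subst partial_eqI[OF d[OF that]]) (simp add: axis_def if_distrib[of "\<lambda>t. t *\<^sub>R _"] sum_negf cong: if_cong)
  show "partial j (\<lambda>y. K (x - y)) y = - partial j K (x - y)" by (rule p[OF assms])
  obtain R where R: "\<And>z. norm z > R \<Longrightarrow> K z = 0" using assms by (auto simp: test_functions_iff)
  show "(\<lambda>y. K (x - y)) \<in> test_functions"
  proof (rule test_function_of_partial_closed_class[of _ "(\<lambda>K y. K (x - y)) ` test_functions" "R + norm x"])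
    show "(\<lambda>y. K (x - y)) \<in> (\<lambda>K y. K (x - y)) ` test_functions" using assms by blast
    show "u differentiable (at y)" if "u \<in> (\<lambda>K y. K (x - y)) ` test_functions" for u y
      using that d by (auto simp: differentiable_def)
    show "partial j u \<in> (\<lambda>K y. K (x - y)) ` test_functions" if "u \<in> (\<lambda>K y. K (x - y)) ` test_functions" for u j
    proof -
      obtain L where L: "u = (\<lambda>y. L (x - y))" "L \<in> test_functions" using \<open>u \<in> _\<close> by (elim imageE)
      have "partial j u = (\<lambda>y. (\<lambda>z. partial j L z * (- 1)) (x - y))"
        unfolding L(1) by (rule ext) (simp add: p[OF L(2)])
      moreover have "(\<lambda>z. partial j L z * (- 1)) \<in> test_functions"
        by (intro test_function_mult_const test_function_partial L)
      ultimately show ?thesis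
        by (intro image_eqI[where x="\<lambda>z. partial j L z * (- 1)"]) simp_all
    qed
    show "K (x - y) = 0" if "norm y > R + norm x" for y
      using that norm_triangle_ineq2[of y x] by (intro R) (simp add: norm_minus_commute)
  qed
qed

lemma test_function_support:
  assumes "\<psi> \<in> test_functions"
  obtains R where "\<And>z. norm z > R \<Longrightarrow> \<psi> z = 0"
  using assms by (auto simp: test_functions_iff)

lemma test_function_conv_integrable:
  fixes u :: "real^3 \<Rightarrow> complex^'n"
  assumes "K \<in> test_functions" "loc_integrable u"
  shows "integrable lborel (\<lambda>y. K (x - y) *s u y)"
proof -
  obtain R where R: "\<And>z. norm z > R \<Longrightarrow> K z = 0" using test_function_support[OF assms(1)] by blast
  show ?thesis
    by (rule conv_integrable[OF test_function_continuous[OF assms(1)] R assms(2)])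
qed

lemma test_function_integrable:
  fixes u :: "real^3 \<Rightarrow> complex^'n"
  assumes "\<psi> \<in> test_functions" "loc_integrable u"
  shows "integrable lborel (\<lambda>y. \<psi> y *s u y)"
  using test_function_conv_integrable[OF test_function_reflect(1)[OF assms(1), of 0] assms(2), of 0] by simp

lemma test_function_conv_has_derivative:
  fixes u :: "real^3 \<Rightarrow> complex^'n"
  assumes "K \<in> test_functions" "loc_integrable u"
  shows "(conv K u has_derivative (\<lambda>h. \<Sum>j\<in>UNIV. (h $ j) *\<^sub>R conv (partial j K) u x)) (at x)"
proof -
  obtain R where R: "\<And>z. norm z > R \<Longrightarrow> K z = 0" using test_function_support[OF assms(1)] by blast
  show ?thesis
    by (rule conv_has_derivative[OF test_function_differentiable[OF assms(1)]
          test_function_continuous[OF test_function_partial[OF assms(1)]] R assms(2)])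
qed

lemma partial_conv:
  fixes u :: "real^3 \<Rightarrow> complex^'n"
  assumes "K \<in> test_functions" "loc_integrable u"
  shows "(\<lambda>x. conv K u x $ c) differentiable (at x)"
    and "partial j (\<lambda>x. conv K u x $ c) x = conv (partial j K) u x $ c"
proof -
  note d = bounded_linear.has_derivative[OF bounded_linear_vec_nth[of c] test_function_conv_has_derivative[OF assms, of x]]
  then show "(\<lambda>x. conv K u x $ c) differentiable (at x)" by (auto simp: differentiable_def)
  show "partial j (\<lambda>x. conv K u x $ c) x = conv (partial j K) u x $ c"
    by (subst partial_eqI[OF d]) (simp add: axis_def if_distrib[of "\<lambda>t. t *\<^sub>R _"] cong: if_cong)
qed

lemma test_spinor_conv:
  fixes u :: "real^3 \<Rightarrow> complex^2"
  assumes K: "K \<in> test_functions" and u: "loc_integrable u" and R: "\<And>y. norm y > R \<Longrightarrow> u y = 0"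
  shows "test_spinor (conv K u)"
  unfolding test_spinor_def
proof
  fix c
  obtain r where r: "\<And>z. norm z > r \<Longrightarrow> K z = 0" using test_function_support[OF K] by blast
  show "(\<lambda>x. conv K u x $ c) \<in> test_functions"
  proof (rule test_function_of_partial_closed_class[of _ "(\<lambda>K x. conv K u x $ c) ` test_functions" "R + r"])
    show "(\<lambda>x. conv K u x $ c) \<in> (\<lambda>K x. conv K u x $ c) ` test_functions" using K by blast
    show "v differentiable (at x)" if "v \<in> (\<lambda>K x. conv K u x $ c) ` test_functions" for v x
      using that partial_conv(1)[OF _ u] by blast
    show "partial j v \<in> (\<lambda>K x. conv K u x $ c) ` test_functions"
      if "v \<in> (\<lambda>K x. conv K u x $ c) ` test_functions" for v j
    proof -
      obtain L where L: "v = (\<lambda>x. conv L u x $ c)" "L \<in> test_functions" using \<open>v \<in> _\<close> by (elim imageE)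
      have "partial j v = (\<lambda>x. conv (partial j L) u x $ c)"
        unfolding L(1) by (rule ext) (rule partial_conv(2)[OF L(2) u])
      then show ?thesis using test_function_partial[OF L(2)] by blast
    qed
    show "conv K u x $ c = 0" if "norm x > R + r" for x
      using conv_outside[OF r R that] by simp
  qed
qed

text \<open>Testing the weak equation against \<open>\<lambda>y. K (x - y)\<close> turns it into a pointwise identity; the reflection
  contributes the sign that moving the derivative to the test function has produced.\<close>

lemma weyl_conv:
  assumes "weak_weyl u g" and K: "K \<in> test_functions" and u: "loc_integrable u"
  shows "weyl (conv K u) x = conv K g x"
proof -
  have "spinor_partial j (conv K u) x = conv (partial j K) u x" for j
    by (simp add: spinor_partial_def partial_conv(2)[OF K u])
  then have "weyl (conv K u) x = (\<Sum>j\<in>UNIV. pauli j *v conv (partial j K) u x)"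
    by (simp add: weyl_def)
  also have "\<dots> = (\<Sum>j\<in>UNIV. LINT y|lborel. pauli j *v (partial j K (x - y) *s u y))"
    unfolding conv_def
    by (intro sum.cong refl integral_bounded_linear[OF pauli_bounded_linear, symmetric]
        test_function_conv_integrable test_function_partial K u)
  also have "\<dots> = (LINT y|lborel. (\<Sum>j\<in>UNIV. pauli j *v (partial j K (x - y) *s u y)))"
    by (intro Bochner_Integration.integral_sum[symmetric] integrable_bounded_linear[OF pauli_bounded_linear]
        test_function_conv_integrable test_function_partial K u)
  also have "\<dots> = - (LINT y|lborel. (\<Sum>j\<in>UNIV. pauli j *v (partial j (\<lambda>y. K (x - y)) y *s u y)))"
  proof -
    have "pauli j *v (partial j (\<lambda>y. K (x - y)) y *s u y) = - (pauli j *v (partial j K (x - y) *s u y))" for j y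
      by (simp add: test_function_reflect(2)[OF K] pauli_scalar pauli_minus vector_scalar_mult_minus)
    then show ?thesis by (simp add: sum_negf)
  qed
  also have "\<dots> = conv K g x"
    using assms(1) test_function_reflect(1)[OF K, of x] by (simp add: weak_weyl_def conv_def)
  finally show ?thesis .
qed

text \<open>Leibniz' rule for weak solutions: the test function \<open>\<xi> \<psi>\<close> in the equation for \<open>u\<close> is the test function
  \<open>\<psi>\<close> in the equation for \<open>\<xi> u\<close>, up to the derivative of \<open>\<xi>\<close>.\<close>

lemma weak_weyl_localize:
  assumes w: "weak_weyl u g" and u: "loc_integrable u" and g: "loc_integrable g"
    and \<xi>: "(\<lambda>x. complex_of_real (\<xi> x)) \<in> test_functions"
    and d: "\<And>j x. partial j (\<lambda>x. complex_of_real (\<xi> x)) x = complex_of_real (d j x)"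
  shows "weak_weyl (\<lambda>x. \<xi> x *\<^sub>R u x) (\<lambda>x. \<xi> x *\<^sub>R g x + (\<Sum>j\<in>UNIV. d j x *\<^sub>R (pauli j *v u x)))"
  unfolding weak_weyl_def
proof
  fix \<psi> assume \<psi>: "\<psi> \<in> test_functions"
  let ?X = "\<lambda>x. complex_of_real (\<xi> x)"
  have p: "partial j (\<lambda>x. ?X x * \<psi> x) x = of_real (d j x) * \<psi> x + ?X x * partial j \<psi> x" for j x
    by (simp add: partial_mult test_function_differentiable \<xi> \<psi> d)
  have i1: "integrable lborel (\<lambda>x. (?X x * partial j \<psi> x) *s u x)" for j
    by (intro test_function_integrable test_function_mult test_function_partial \<xi> \<psi> u)
  have i2: "integrable lborel (\<lambda>x. (of_real (d j x) * \<psi> x) *s u x)" for j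
    using test_function_integrable[OF test_function_mult[OF test_function_partial[OF \<xi>, of j] \<psi>] u]
    by (simp add: d)
  have i3: "integrable lborel (\<lambda>x. (?X x * \<psi> x) *s g x)"
    by (intro test_function_integrable test_function_mult \<xi> \<psi> g)
  note pi = integrable_bounded_linear[OF pauli_bounded_linear]
  have j1: "integrable lborel (\<lambda>x. \<Sum>j\<in>UNIV. pauli j *v ((?X x * partial j \<psi> x) *s u x))"
    by (intro Bochner_Integration.integrable_sum pi i1)
  have j2: "integrable lborel (\<lambda>x. \<Sum>j\<in>UNIV. pauli j *v ((of_real (d j x) * \<psi> x) *s u x))"
    by (intro Bochner_Integration.integrable_sum pi i2)
  have "(LINT x|lborel. (\<Sum>j\<in>UNIV. pauli j *v (partial j (\<lambda>x. ?X x * \<psi> x) x *s u x))) =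
      - (LINT x|lborel. (?X x * \<psi> x) *s g x)"
    using w test_function_mult[OF \<xi> \<psi>] unfolding weak_weyl_def by blast
  moreover have "(\<Sum>j\<in>UNIV. pauli j *v (partial j (\<lambda>x. ?X x * \<psi> x) x *s u x)) =
      (\<Sum>j\<in>UNIV. pauli j *v ((of_real (d j x) * \<psi> x) *s u x)) + (\<Sum>j\<in>UNIV. pauli j *v ((?X x * partial j \<psi> x) *s u x))" for x
    by (simp add: p vec_scalar_add matrix_vector_right_distrib sum.distrib)
  ultimately have "(LINT x|lborel. (\<Sum>j\<in>UNIV. pauli j *v ((of_real (d j x) * \<psi> x) *s u x))
      + (\<Sum>j\<in>UNIV. pauli j *v ((?X x * partial j \<psi> x) *s u x))) = - (LINT x|lborel. (?X x * \<psi> x) *s g x)"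
    by (simp only:)
  then have "(LINT x|lborel. (\<Sum>j\<in>UNIV. pauli j *v ((of_real (d j x) * \<psi> x) *s u x)))
      + (LINT x|lborel. (\<Sum>j\<in>UNIV. pauli j *v ((?X x * partial j \<psi> x) *s u x))) = - (LINT x|lborel. (?X x * \<psi> x) *s g x)"
    by (simp only: Bochner_Integration.integral_add[OF j2 j1])
  moreover have "a + b = - c \<Longrightarrow> b = - (c + a)" for a b c :: "complex^2"
    by (metis add.commute add.inverse_inverse add_diff_cancel_left' diff_minus_eq_add minus_add_distrib uminus_add_conv_diff)
  ultimately have "(LINT x|lborel. (\<Sum>j\<in>UNIV. pauli j *v ((?X x * partial j \<psi> x) *s u x))) =
      - ((LINT x|lborel. (?X x * \<psi> x) *s g x) + (LINT x|lborel. (\<Sum>j\<in>UNIV. pauli j *v ((of_real (d j x) * \<psi> x) *s u x))))"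
    by blast
  also have "\<dots> = - (LINT x|lborel. (?X x * \<psi> x) *s g x + (\<Sum>j\<in>UNIV. pauli j *v ((of_real (d j x) * \<psi> x) *s u x)))"
    by (simp only: Bochner_Integration.integral_add[OF i3 j2])
  also have "(\<lambda>x. (?X x * \<psi> x) *s g x + (\<Sum>j\<in>UNIV. pauli j *v ((of_real (d j x) * \<psi> x) *s u x))) =
      (\<lambda>x. \<psi> x *s (\<xi> x *\<^sub>R g x + (\<Sum>j\<in>UNIV. d j x *\<^sub>R (pauli j *v u x))))"
    by (auto simp: fun_eq_iff vec_eq_iff pauli_scalar sum_distrib_left sum_component algebra_simps scaleR_conv_of_real[where 'a=complex])
  also have "(\<lambda>x. \<Sum>j\<in>UNIV. pauli j *v ((?X x * partial j \<psi> x) *s u x)) =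
      (\<lambda>x. \<Sum>j\<in>UNIV. pauli j *v (partial j \<psi> x *s (\<xi> x *\<^sub>R u x)))"
    by (intro ext sum.cong refl arg_cong[where f="(*v) (pauli _)"])
      (simp add: vec_eq_iff scaleR_conv_of_real[where 'a=complex])
  finally show "(LINT x|lborel. (\<Sum>j\<in>UNIV. pauli j *v (partial j \<psi> x *s (\<xi> x *\<^sub>R u x)))) =
      - (LINT x|lborel. \<psi> x *s (\<xi> x *\<^sub>R g x + (\<Sum>j\<in>UNIV. d j x *\<^sub>R (pauli j *v u x))))" .
qed

text \<open>Friedrichs' identity of weak and strong extensions: mollification commutes with the operator, whose
  coefficients are constant, so it approximates \<open>u\<close> and its image at the same time.\<close>

lemma weak_weyl_approximation:
  assumes w: "weak_weyl u g" and u: "square_integrable lborel u" and g: "square_integrable lborel g"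
    and R: "\<And>x. norm x > R \<Longrightarrow> u x = 0"
  shows "test_spinor (mollify n u)" "\<And>x. norm x > R + 1 \<Longrightarrow> mollify n u x = 0"
    and "(\<lambda>n. mean_square lborel (\<lambda>x. mollify n u x - u x)) \<longlonglongrightarrow> 0"
    and "(\<lambda>n. mean_square lborel (\<lambda>x. weyl (mollify n u) x - g x)) \<longlonglongrightarrow> 0"
    and "square_integrable lborel (weyl (mollify n u))"
proof -
  note ul = square_integrable_loc_integrable[OF u]
  show "test_spinor (mollify n u)"
    unfolding mollify_def by (rule test_spinor_conv[OF mollifier_test_function ul R])
  show "\<And>x. norm x > R + 1 \<Longrightarrow> mollify n u x = 0"
    by (rule mollify_outside[OF R])
  have m: "weyl (mollify n u) = mollify n g" for n
    unfolding mollify_def by (rule ext) (rule weyl_conv[OF w mollifier_test_function ul])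
  show "(\<lambda>n. mean_square lborel (\<lambda>x. mollify n u x - u x)) \<longlonglongrightarrow> 0"
    by (rule mollify_converges[OF u])
  show "(\<lambda>n. mean_square lborel (\<lambda>x. weyl (mollify n u) x - g x)) \<longlonglongrightarrow> 0"
    unfolding m by (rule mollify_converges[OF g])
  show "square_integrable lborel (weyl (mollify n u))"
    unfolding m by (rule mollify_mean_square_le[OF g])
qed

lemma test_spinor_support:
  assumes "test_spinor v"
  obtains R where "\<And>x. norm x > R \<Longrightarrow> v x = 0"
proof -
  obtain R1 where R1: "\<And>z. norm z > R1 \<Longrightarrow> v z $ 1 = 0"
    using assms test_function_support[of "\<lambda>x. v x $ 1"] unfolding test_spinor_def by blast
  obtain R2 where R2: "\<And>z. norm z > R2 \<Longrightarrow> v z $ 2 = 0"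
    using assms test_function_support[of "\<lambda>x. v x $ 2"] unfolding test_spinor_def by blast
  show ?thesis
    by (rule that[of "max R1 R2"]) (use R1 R2 in \<open>simp add: vec_eq_iff forall_2\<close>)
qed

lemma test_spinor_integrable:
  assumes "test_spinor v"
  shows "square_integrable lborel v" "continuous_on UNIV v"
proof -
  have "continuous_on UNIV (\<lambda>x. v x $ c)" for c
    using assms by (auto simp: test_spinor_def intro: test_function_continuous)
  then have "continuous_on UNIV (\<lambda>x. \<chi> c. v x $ c)" by (rule continuous_on_vec_lambda)
  then show c: "continuous_on UNIV v" by simp
  obtain R where "\<And>x. norm x > R \<Longrightarrow> v x = 0" using test_spinor_support[OF assms] by blast
  then show "square_integrable lborel v"
    by (rule continuous_compact_support_square_integrable(2)[OF c])
qed

lemma test_spinor_partial: "test_spinor v \<Longrightarrow> test_spinor (spinor_partial j v)"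
  by (simp add: test_spinor_def spinor_partial_def test_function_partial)

lemma weyl_square_integrable: "test_spinor v \<Longrightarrow> square_integrable lborel (weyl v)"
proof -
  assume v: "test_spinor v"
  have *: "square_integrable lborel (\<lambda>x. pauli j *v spinor_partial j v x)" for j
  proof (rule square_integrable_bound[OF test_spinor_integrable(1)[OF test_spinor_partial[OF v, of j]]])
    show "(\<lambda>x. pauli j *v spinor_partial j v x) \<in> borel_measurable lborel"
      using test_spinor_integrable(2)[OF test_spinor_partial[OF v, of j]]
      by (simp add: borel_measurable_continuous_onI bounded_linear.continuous_on[OF pauli_bounded_linear])
    show "norm (pauli j *v spinor_partial j v x) \<le> 1 * norm (spinor_partial j v x)" for x
      by (simp add: norm_pauli)
  qed
  have "weyl v = (\<lambda>x. (pauli 1 *v spinor_partial 1 v x + pauli 2 *v spinor_partial 2 v x) + pauli 3 *v spinor_partial 3 v x)"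
    by (simp add: weyl_def fun_eq_iff sum_3)
  then show ?thesis by (simp add: square_integrable_add(1) *)
qed

text \<open>The conjugates of the components of \<open>v\<close> are test functions for the equation of \<open>u\<close>. Summing the real
  parts of the resulting identities gives the real inner product, under which the Pauli matrices are
  symmetric.\<close>

lemma weak_weyl_green_test:
  assumes w: "weak_weyl u g" and u: "loc_integrable u" and g: "loc_integrable g" and v: "test_spinor v"
  shows "(LINT x|lborel. g x \<bullet> v x) = - (LINT x|lborel. u x \<bullet> weyl v x)"
proof -
  define \<psi> where "\<psi> c x = cnj (v x $ c)" for c x
  have \<psi>: "\<psi> c \<in> test_functions" for c
    using v test_function_cnj unfolding \<psi>_def test_spinor_def by blast
  have vd: "(\<lambda>x. v x $ c) differentiable (at x)" for c x
    using v by (auto simp: test_spinor_def intro: test_function_differentiable)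
  have p: "partial j (\<psi> c) x = cnj (spinor_partial j v x $ c)" for j c x
    by (simp add: \<psi>_def[abs_def] partial_cnj[OF vd] spinor_partial_def)
  define F where "F c x = (\<Sum>j\<in>UNIV. pauli j *v (partial j (\<psi> c) x *s u x))" for c x
  have F: "integrable lborel (F c)" for c
    unfolding F_def
    by (intro Bochner_Integration.integrable_sum integrable_bounded_linear[OF pauli_bounded_linear]
        test_function_integrable test_function_partial \<psi> u)
  have G: "integrable lborel (\<lambda>x. \<psi> c x *s g x)" for c
    by (intro test_function_integrable \<psi> g)
  have eq: "(LINT x|lborel. F c x) = - (LINT x|lborel. \<psi> c x *s g x)" for c
    using w \<psi>[of c] by (simp add: weak_weyl_def F_def)
  have bl: "bounded_linear (\<lambda>z::complex^2. Re (z $ c))" for c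
    by (intro bounded_linear_compose[OF bounded_linear_Re bounded_linear_vec_nth])
  have eq': "(LINT x|lborel. Re (F c x $ c)) = - (LINT x|lborel. Re ((\<psi> c x *s g x) $ c))" for c
    using eq[of c] integral_bounded_linear[OF bl[of c] F[of c]] integral_bounded_linear[OF bl[of c] G[of c]] by simp
  have inn: "(a :: complex^2) \<bullet> b = (\<Sum>c\<in>UNIV. Re (cnj (b $ c) * a $ c))" for a b
    by (simp add: inner_vec_def inner_complex_def algebra_simps)
  have uw: "u x \<bullet> weyl v x = (\<Sum>c\<in>UNIV. Re (F c x $ c))" for x
  proof -
    have "u x \<bullet> weyl v x = (\<Sum>j\<in>UNIV. (pauli j *v u x) \<bullet> spinor_partial j v x)"
      by (simp add: weyl_def inner_sum_right pauli_selfadjoint)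
    also have "\<dots> = (\<Sum>j\<in>UNIV. \<Sum>c\<in>UNIV. Re ((pauli j *v (partial j (\<psi> c) x *s u x)) $ c))"
      by (simp add: inn p pauli_scalar)
    also have "\<dots> = (\<Sum>c\<in>UNIV. \<Sum>j\<in>UNIV. Re ((pauli j *v (partial j (\<psi> c) x *s u x)) $ c))"
      by (rule sum.swap)
    also have "\<dots> = (\<Sum>c\<in>UNIV. Re (F c x $ c))" by (simp add: F_def)
    finally show ?thesis .
  qed
  have gv: "g x \<bullet> v x = (\<Sum>c\<in>UNIV. Re ((\<psi> c x *s g x) $ c))" for x
    by (simp add: inn \<psi>_def)
  have "(LINT x|lborel. g x \<bullet> v x) = (\<Sum>c\<in>UNIV. LINT x|lborel. Re ((\<psi> c x *s g x) $ c))"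
    unfolding gv by (intro Bochner_Integration.integral_sum integrable_bounded_linear[OF bl] G)
  also have "\<dots> = - (\<Sum>c\<in>UNIV. LINT x|lborel. Re (F c x $ c))"
    by (simp add: eq' sum_negf)
  also have "(\<Sum>c\<in>UNIV. LINT x|lborel. Re (F c x $ c)) = (LINT x|lborel. u x \<bullet> weyl v x)"
    unfolding uw by (intro Bochner_Integration.integral_sum[symmetric] integrable_bounded_linear[OF bl] F)
  finally show ?thesis .
qed

text \<open>Both sides are continuous in \<open>v\<close> with respect to the mean squares of \<open>v\<close> and of its image \<open>h\<close>, so \<open>v\<close>
  may be replaced by its mollifications.\<close>

lemma weak_weyl_green:
  assumes u: "weak_weyl u g" "square_integrable lborel u" "square_integrable lborel g"
    and v: "weak_weyl v h" "square_integrable lborel v" "square_integrable lborel h"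
    and R: "\<And>x. norm x > R \<Longrightarrow> v x = 0"
  shows "(LINT x|lborel. g x \<bullet> v x) = - (LINT x|lborel. u x \<bullet> h x)"
proof -
  note a = weak_weyl_approximation[OF v R]
  have "(LINT x|lborel. mollify n v x \<bullet> g x) = - (LINT x|lborel. weyl (mollify n v) x \<bullet> u x)" for n
    using weak_weyl_green_test[OF u(1) square_integrable_loc_integrable[OF u(2)] square_integrable_loc_integrable[OF u(3)] a(1)]
    by (simp add: inner_commute)
  then have "(\<lambda>n. LINT x|lborel. mollify n v x \<bullet> g x) = (\<lambda>n. - (LINT x|lborel. weyl (mollify n v) x \<bullet> u x))"
    by (simp only:)
  moreover have "(\<lambda>n. LINT x|lborel. mollify n v x \<bullet> g x) \<longlonglongrightarrow> (LINT x|lborel. v x \<bullet> g x)"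
    by (rule mean_square_convergent_bilinear[OF mollify_mean_square_le(1)[OF v(2)] v(2) u(3) a(3) bounded_bilinear_inner])
  moreover have "(\<lambda>n. - (LINT x|lborel. weyl (mollify n v) x \<bullet> u x)) \<longlonglongrightarrow> - (LINT x|lborel. h x \<bullet> u x)"
    by (rule tendsto_minus, rule mean_square_convergent_bilinear[OF a(5) v(3) u(2) a(4) bounded_bilinear_inner])
  ultimately have "(LINT x|lborel. v x \<bullet> g x) = - (LINT x|lborel. h x \<bullet> u x)"
    by (simp only:) (rule LIMSEQ_unique)
  then show ?thesis by (simp add: inner_commute)
qed

section \<open>Cutting off weak solutions\<close>

definition loc_square_integrable :: "('a::euclidean_space \<Rightarrow> 'b::euclidean_space) \<Rightarrow> bool" where
  "loc_square_integrable u \<longleftrightarrow> u \<in> borel_measurable borel \<and>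
     (\<forall>R. square_integrable lborel (\<lambda>x. indicator (cball 0 R) x *\<^sub>R u x))"

lemma loc_square_integrable_loc_integrable:
  assumes "loc_square_integrable u"
  shows "loc_integrable u"
  unfolding loc_integrable_def
proof (intro conjI allI)
  show "u \<in> borel_measurable borel" using assms by (simp add: loc_square_integrable_def)
  fix R
  have "loc_integrable (\<lambda>x. indicator (cball 0 R) x *\<^sub>R u x)"
    using assms by (intro square_integrable_loc_integrable) (simp add: loc_square_integrable_def)
  then have "integrable lborel (\<lambda>x. indicator (cball 0 R) x *\<^sub>R (indicator (cball 0 R) x *\<^sub>R u x))"
    unfolding loc_integrable_def by blast
  also have "(\<lambda>x. indicator (cball 0 R) x *\<^sub>R (indicator (cball 0 R) x *\<^sub>R u x)) = (\<lambda>x. indicator (cball 0 R) x *\<^sub>R u x)"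
    by (auto simp: indicator_def)
  finally show "integrable lborel (\<lambda>x. indicator (cball 0 R) x *\<^sub>R u x)" .
qed

lemma loc_square_integrable_bounded_support:
  fixes u :: "'a::euclidean_space \<Rightarrow> 'b::euclidean_space"
  assumes u: "loc_square_integrable u" and v: "v \<in> borel_measurable borel"
    and le: "\<And>x. norm (v x) \<le> c * norm (u x)" and out: "\<And>x. norm x > R \<Longrightarrow> v x = 0"
  shows "square_integrable lborel v"
proof (rule square_integrable_bound)
  show "square_integrable lborel (\<lambda>x. indicator (cball 0 R) x *\<^sub>R u x)"
    using u by (simp add: loc_square_integrable_def)
  show "norm (v x) \<le> c * norm (indicator (cball 0 R) x *\<^sub>R u x)" for x
    using le[of x] out[of x] by (cases "norm x > R") auto
qed (use v in simp)

lemma loc_square_integrable_bound: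
  fixes u :: "'a::euclidean_space \<Rightarrow> 'b::euclidean_space"
  assumes u: "loc_square_integrable u" and v: "v \<in> borel_measurable borel"
    and le: "\<And>x. norm (v x) \<le> c * norm (u x)"
  shows "loc_square_integrable v"
  unfolding loc_square_integrable_def
proof (intro conjI allI v)
  fix R
  show "square_integrable lborel (\<lambda>x. indicator (cball 0 R) x *\<^sub>R v x)"
  proof (rule square_integrable_bound)
    show "square_integrable lborel (\<lambda>x. indicator (cball 0 R) x *\<^sub>R u x)"
      using u by (simp add: loc_square_integrable_def)
    show "(\<lambda>x. indicator (cball 0 R) x *\<^sub>R v x) \<in> borel_measurable lborel"
      using v by (intro borel_measurable_scaleR borel_measurable_indicator) simp_all
    show "norm (indicator (cball 0 R) x *\<^sub>R v x) \<le> c * norm (indicator (cball 0 R) x *\<^sub>R u x)" for x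
      using le[of x] by (auto simp: indicator_def)
  qed
qed

lemma loc_square_integrable_add:
  assumes "loc_square_integrable u" "loc_square_integrable v"
  shows "loc_square_integrable (\<lambda>x. u x + v x)"
  using assms unfolding loc_square_integrable_def by (auto simp: scaleR_add_right intro: square_integrable_add(1))

text \<open>Supported in the ball of radius \<open>R\<close>; the factor \<open>exp 1\<close> normalizes the value at the origin, and so the
  pointwise limit for \<open>R \<rightarrow> \<infinity>\<close>, to \<open>1\<close>.\<close>

definition cutoff :: "real \<Rightarrow> real^3 \<Rightarrow> real" where
  "cutoff R x = exp 1 * bump 1 (1 / R\<^sup>2) x"

definition cutoff_partial :: "real \<Rightarrow> 3 \<Rightarrow> real^3 \<Rightarrow> real" where
  "cutoff_partial R j x = exp 1 * (- 2 * (1 / R\<^sup>2) * (x $ j) * flat_exp 2 (1 - 1 / R\<^sup>2 * (norm x)\<^sup>2))"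

lemma cutoff_test_function: "R > 0 \<Longrightarrow> (\<lambda>x. complex_of_real (cutoff R x)) \<in> test_functions"
  using test_function_mult_const[OF bump_test_function[of "1 / R\<^sup>2" 1], of "of_real (exp 1)"]
  by (simp add: cutoff_def mult.commute)

lemma cutoff_partial:
  "partial j (\<lambda>x. complex_of_real (cutoff R x)) x = complex_of_real (cutoff_partial R j x)"
proof -
  have "((\<lambda>x. complex_of_real (exp 1) * complex_of_real (bump 1 (1 / R\<^sup>2) x)) has_derivative
     (\<lambda>h. complex_of_real (exp 1) * of_real (- 2 * (1 / R\<^sup>2) * (x \<bullet> h) * (flat_exp (0 + 2) (1 - (1 / R\<^sup>2) * (norm x)\<^sup>2)
        - real 0 * flat_exp (0 + 1) (1 - (1 / R\<^sup>2) * (norm x)\<^sup>2))))) (at x)"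
    unfolding bump_def by (intro has_derivative_mult_right has_derivative_flat_exp_norm)
  from partial_eqI[OF this, of j] show ?thesis
    by (simp add: cutoff_def cutoff_partial_def inner_axis numeral_2_eq_2)
qed

lemma cutoff_continuous: "R > 0 \<Longrightarrow> continuous_on UNIV (cutoff R)"
  unfolding cutoff_def by (intro continuous_intros bump_continuous) simp

lemma cutoff_partial_continuous: "R > 0 \<Longrightarrow> continuous_on UNIV (cutoff_partial R j)"
  using continuous_on_Re[OF test_function_continuous[OF test_function_partial[OF cutoff_test_function[of R], of j], of UNIV]]
  by (simp add: cutoff_partial)

lemma cutoff_nonneg: "cutoff R x \<ge> 0"
  by (simp add: cutoff_def bump_nonneg)

lemma cutoff_le_1: "cutoff R x \<le> 1"
proof -
  define t where "t = 1 - 1 / R\<^sup>2 * (norm x)\<^sup>2"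
  have t: "t \<le> 1" by (simp add: t_def)
  have "exp 1 * flat_exp 0 t \<le> 1"
  proof (cases "t > 0")
    case True
    then have "1 + (- 1 / t) \<le> 0" using t by (simp add: field_simps)
    then have "exp (1 + (- 1 / t)) \<le> 1" by simp
    then show ?thesis using True by (simp add: flat_exp_def exp_add[symmetric])
  qed (simp add: flat_exp_def)
  then show ?thesis by (simp add: cutoff_def bump_def t_def)
qed

lemma cutoff_outside: "R > 0 \<Longrightarrow> norm x \<ge> R \<Longrightarrow> cutoff R x = 0"
  using bump_outside[of "1 / R\<^sup>2" R 1 x] by (simp add: cutoff_def)

lemma cutoff_tendsto_1: "(\<lambda>n. cutoff (real n + 1) x) \<longlonglongrightarrow> 1"
proof -
  have "(\<lambda>n. 1 / (real n + 1)) \<longlonglongrightarrow> 0"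
    by (rule tendsto_inverse_real_plus_1)
  from tendsto_mult[OF tendsto_power[OF this, of 2] tendsto_const[of "(norm x)\<^sup>2"]]
  have t: "(\<lambda>n. 1 - 1 / (real n + 1)\<^sup>2 * (norm x)\<^sup>2) \<longlonglongrightarrow> 1"
    using tendsto_diff[OF tendsto_const[of 1]] by (fastforce simp: power_divide)
  have "isCont (flat_exp 0) 1"
    by (rule DERIV_isCont[OF flat_exp_has_derivative])
  from isCont_tendsto_compose[OF this t]
  have "(\<lambda>n. exp 1 * flat_exp 0 (1 - 1 / (real n + 1)\<^sup>2 * (norm x)\<^sup>2)) \<longlonglongrightarrow> exp 1 * flat_exp 0 1"
    by (intro tendsto_intros)
  then show ?thesis by (simp add: cutoff_def bump_def flat_exp_def[of 0 1] exp_add[symmetric])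
qed

lemma flat_exp_2_le: "flat_exp 2 t \<le> 4"
proof (cases "t > 0")
  case True
  have "1 / (2 * t) \<le> exp (1 / (2 * t))" using exp_ge_add_one_self[of "1 / (2 * t)"] by linarith
  then have "(1 / (2 * t))\<^sup>2 \<le> (exp (1 / (2 * t)))\<^sup>2" using True by (intro power_mono) auto
  also have "(exp (1 / (2 * t)))\<^sup>2 = exp (1 / t)" by (simp flip: exp_double)
  finally have "1 / t\<^sup>2 \<le> 4 * exp (1 / t)" by (simp add: power2_eq_square)
  then have "exp (- 1 / t) * (1 / t\<^sup>2) \<le> exp (- 1 / t) * (4 * exp (1 / t))"
    by (intro mult_left_mono) auto
  also have "\<dots> = 4" by (simp add: exp_minus)
  finally show ?thesis using True by (simp add: flat_exp_def)
qed (simp add: flat_exp_def)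

lemma cutoff_partial_outside: "R > 0 \<Longrightarrow> norm x \<ge> R \<Longrightarrow> cutoff_partial R j x = 0"
proof -
  assume *: "R > 0" "norm x \<ge> R"
  then have "R\<^sup>2 \<le> (norm x)\<^sup>2" by (intro power_mono) auto
  then have "1 \<le> 1 / R\<^sup>2 * (norm x)\<^sup>2" using * by (simp add: le_divide_eq)
  then have "\<not> 1 - 1 / R\<^sup>2 * (norm x)\<^sup>2 > 0" by linarith
  then show ?thesis by (simp add: cutoff_partial_def flat_exp_def)
qed

text \<open>The factor \<open>norm x\<close> is kept because in the proof of square integrability the bound must tend to \<open>0\<close>
  at fixed \<open>x\<close> even after division by the square of \<open>1 / R\<close>.\<close>

lemma cutoff_partial_le:
  assumes "R > 0"
  shows "\<bar>cutoff_partial R j x\<bar> \<le> 24 * (norm x / R\<^sup>2)"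
proof -
  have "\<bar>cutoff_partial R j x\<bar> = (2 * (1 / R\<^sup>2)) * (exp 1 * (\<bar>x $ j\<bar> * flat_exp 2 (1 - 1 / R\<^sup>2 * (norm x)\<^sup>2)))"
    using flat_exp_nonneg[of 2] by (simp add: cutoff_partial_def abs_mult)
  also have "\<dots> \<le> (2 * (1 / R\<^sup>2)) * (3 * (norm x * 4))"
    using flat_exp_nonneg component_le_norm_cart[of x j] flat_exp_2_le exp_le
    by (intro mult_left_mono mult_mono) auto
  finally show ?thesis by simp
qed

text \<open>The commutator of the Weyl operator with multiplication by the cutoff.\<close>

definition weyl_cutoff :: "real \<Rightarrow> real^3 \<Rightarrow> complex^2 \<Rightarrow> complex^2" where
  "weyl_cutoff R x a = (\<Sum>j\<in>UNIV. cutoff_partial R j x *\<^sub>R (pauli j *v a))"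

lemma weyl_cutoff_selfadjoint: "weyl_cutoff R x a \<bullet> b = a \<bullet> weyl_cutoff R x b"
  by (simp add: weyl_cutoff_def inner_sum_left inner_sum_right pauli_selfadjoint)

lemma weyl_cutoff_outside: "R > 0 \<Longrightarrow> norm x \<ge> R \<Longrightarrow> weyl_cutoff R x a = 0"
  by (simp add: weyl_cutoff_def cutoff_partial_outside)

lemma norm_weyl_cutoff_le:
  assumes "R > 0"
  shows "norm (weyl_cutoff R x a) \<le> 72 * (norm x / R\<^sup>2) * norm a"
proof -
  have "norm (weyl_cutoff R x a) \<le> (\<Sum>j\<in>(UNIV::3 set). 24 * (norm x / R\<^sup>2) * norm a)"
    unfolding weyl_cutoff_def
  proof (rule sum_norm_le)
    show "norm (cutoff_partial R j x *\<^sub>R (pauli j *v a)) \<le> 24 * (norm x / R\<^sup>2) * norm a" for j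
      using mult_right_mono[OF cutoff_partial_le[OF assms, of j x] norm_ge_zero[of a]] by (simp add: norm_pauli)
  qed
  then show ?thesis by simp
qed

lemma norm_weyl_cutoff_le_inverse:
  assumes "R > 0"
  shows "norm (weyl_cutoff R x a) \<le> 72 / R * norm a"
proof (cases "norm x \<ge> R")
  case False
  then have "norm x / R\<^sup>2 \<le> 1 / R" using assms by (simp add: power2_eq_square field_simps)
  then have "72 * (norm x / R\<^sup>2) * norm a \<le> 72 * (1 / R) * norm a"
    by (intro mult_right_mono mult_left_mono) auto
  with norm_weyl_cutoff_le[OF assms, of x a] show ?thesis by simp
qed (use assms weyl_cutoff_outside in simp)

lemma weyl_cutoff_measurable:
  assumes "R > 0" "u \<in> borel_measurable borel"
  shows "(\<lambda>x. weyl_cutoff R x (u x)) \<in> borel_measurable borel"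
proof -
  have "(\<lambda>x. pauli j *v u x) \<in> borel_measurable borel" for j
    by (rule borel_measurable_bounded_linear[OF pauli_bounded_linear assms(2)])
  moreover have "cutoff_partial R j \<in> borel_measurable borel" for j
    by (intro borel_measurable_continuous_onI cutoff_partial_continuous assms)
  ultimately show ?thesis
    unfolding weyl_cutoff_def by (intro borel_measurable_sum borel_measurable_scaleR)
qed

lemma cutoff_square_integrable:
  fixes u :: "real^3 \<Rightarrow> complex^2"
  assumes R: "R > 0" and u: "loc_square_integrable u"
  shows "square_integrable lborel (\<lambda>x. cutoff R x *\<^sub>R u x)"
    and "square_integrable lborel (\<lambda>x. weyl_cutoff R x (u x))"
proof -
  have um: "u \<in> borel_measurable borel" using u by (simp add: loc_square_integrable_def)
  show "square_integrable lborel (\<lambda>x. cutoff R x *\<^sub>R u x)"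
  proof (rule loc_square_integrable_bounded_support[OF u])
    show "(\<lambda>x. cutoff R x *\<^sub>R u x) \<in> borel_measurable borel"
      by (intro borel_measurable_scaleR borel_measurable_continuous_onI cutoff_continuous R um)
    show "norm (cutoff R x *\<^sub>R u x) \<le> 1 * norm (u x)" for x
      using cutoff_nonneg[of R x] cutoff_le_1[of R x] by (simp add: mult_left_le_one_le)
    show "cutoff R x *\<^sub>R u x = 0" if "norm x > R" for x
      using cutoff_outside[OF R, of x] that by simp
  qed
  show "square_integrable lborel (\<lambda>x. weyl_cutoff R x (u x))"
  proof (rule loc_square_integrable_bounded_support[OF u])
    show "(\<lambda>x. weyl_cutoff R x (u x)) \<in> borel_measurable borel"
      by (rule weyl_cutoff_measurable[OF R um])
    show "norm (weyl_cutoff R x (u x)) \<le> (72 / R) * norm (u x)" for x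
      by (rule norm_weyl_cutoff_le_inverse[OF R])
    show "weyl_cutoff R x (u x) = 0" if "norm x > R" for x
      using weyl_cutoff_outside[OF R, of x] that by simp
  qed
qed

lemma weak_weyl_cutoff:
  assumes "weak_weyl u g" "loc_square_integrable u" "loc_square_integrable g" "R > 0"
  shows "weak_weyl (\<lambda>x. cutoff R x *\<^sub>R u x) (\<lambda>x. cutoff R x *\<^sub>R g x + weyl_cutoff R x (u x))"
    and "square_integrable lborel (\<lambda>x. cutoff R x *\<^sub>R g x + weyl_cutoff R x (u x))"
proof -
  show "weak_weyl (\<lambda>x. cutoff R x *\<^sub>R u x) (\<lambda>x. cutoff R x *\<^sub>R g x + weyl_cutoff R x (u x))"
    unfolding weyl_cutoff_def
    by (rule weak_weyl_localize[OF assms(1) loc_square_integrable_loc_integrable[OF assms(2)]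
          loc_square_integrable_loc_integrable[OF assms(3)] cutoff_test_function[OF assms(4)] cutoff_partial])
  show "square_integrable lborel (\<lambda>x. cutoff R x *\<^sub>R g x + weyl_cutoff R x (u x))"
    by (intro square_integrable_add(1) cutoff_square_integrable assms)
qed

section \<open>Vanishing of the companion spinor\<close>

text \<open>The power \<open>- 2 * s\<close> of the Japanese bracket: the weight that goes with squared norms.\<close>

definition weight :: "real \<Rightarrow> real^3 \<Rightarrow> real" where
  "weight s x = (1 + (norm x)\<^sup>2) powr (- s)"

lemma weight_pos: "weight s x > 0"
proof -
  have "1 + (norm x)\<^sup>2 > 0" by (simp add: add_pos_nonneg)
  then show ?thesis by (simp add: weight_def)
qed

lemma weight_measurable: "weight s \<in> borel_measurable borel"
  unfolding weight_def by measurable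

lemma one_le_weight:
  assumes "norm x \<le> R" "R \<ge> 1" "s \<ge> 0"
  shows "1 \<le> (2 * R\<^sup>2) powr s * weight s x"
proof -
  have q: "1 + (norm x)\<^sup>2 > 0" by (simp add: add_pos_nonneg)
  have "(norm x)\<^sup>2 \<le> R\<^sup>2" "1\<^sup>2 \<le> R\<^sup>2" using assms by (intro power_mono; simp)+
  then have "1 + (norm x)\<^sup>2 \<le> 2 * R\<^sup>2" by simp
  then have "(1 + (norm x)\<^sup>2) powr s \<le> (2 * R\<^sup>2) powr s"
    using assms q by (intro powr_mono2) auto
  then have "(1 + (norm x)\<^sup>2) powr s * weight s x \<le> (2 * R\<^sup>2) powr s * weight s x"
    using weight_pos[of s x] by (intro mult_right_mono) auto
  moreover have "(1 + (norm x)\<^sup>2) powr s * weight s x = 1"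
    using q by (simp add: weight_def powr_add[symmetric])
  ultimately show ?thesis by simp
qed

definition weighted_square_integrable :: "real \<Rightarrow> (real^3 \<Rightarrow> 'b::euclidean_space) \<Rightarrow> bool" where
  "weighted_square_integrable s u \<longleftrightarrow> u \<in> borel_measurable borel \<and> integrable lborel (\<lambda>x. weight s x * (norm (u x))\<^sup>2)"

lemma weighted_loc_square_integrable:
  assumes u: "weighted_square_integrable s u" and s: "s \<ge> 0"
  shows "loc_square_integrable u"
  unfolding loc_square_integrable_def square_integrable_def
proof (intro conjI allI)
  show um [measurable]: "u \<in> borel_measurable borel" using u by (simp add: weighted_square_integrable_def)
  fix R
  show "(\<lambda>x. indicator (cball 0 R) x *\<^sub>R u x) \<in> borel_measurable lborel"
    using um by (intro borel_measurable_scaleR borel_measurable_indicator) simp_all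
  then have *: "(\<lambda>x. (norm (indicator (cball 0 R) x *\<^sub>R u x))\<^sup>2) \<in> borel_measurable lborel"
    by (rule borel_measurable_power[OF measurable_compose[OF _ borel_measurable_norm]])
  show "integrable lborel (\<lambda>x. (norm (indicator (cball 0 R) x *\<^sub>R u x))\<^sup>2)"
  proof (rule Bochner_Integration.integrable_bound)
    show "integrable lborel (\<lambda>x. (2 * (max 1 R)\<^sup>2) powr s * (weight s x * (norm (u x))\<^sup>2))"
      using u by (intro integrable_mult_right) (simp add: weighted_square_integrable_def)
    show "AE x in lborel. norm ((norm (indicator (cball 0 R) x *\<^sub>R u x))\<^sup>2) \<le> norm ((2 * (max 1 R)\<^sup>2) powr s * (weight s x * (norm (u x))\<^sup>2))"
    proof (intro always_eventually allI)
      fix x :: "real^3"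
      show "norm ((norm (indicator (cball 0 R) x *\<^sub>R u x))\<^sup>2) \<le> norm ((2 * (max 1 R)\<^sup>2) powr s * (weight s x * (norm (u x))\<^sup>2))"
      proof (cases "norm x \<le> R")
        case True
        then have "1 * (norm (u x))\<^sup>2 \<le> ((2 * (max 1 R)\<^sup>2) powr s * weight s x) * (norm (u x))\<^sup>2"
          using s by (intro mult_right_mono one_le_weight) auto
        then show ?thesis using True weight_pos[of s x] by (simp add: abs_mult mult.assoc)
      qed simp
    qed
  qed (rule *)
qed

lemma weighted_young_inequality:
  fixes a b k :: real
  assumes "k > 0"
  shows "2 * (a * b) \<le> k / 2 * a\<^sup>2 + 2 / k * b\<^sup>2"
proof -
  have "0 \<le> 2 / k * (k / 2 * a - b)\<^sup>2" using assms by simp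
  also have "\<dots> = k / 2 * a\<^sup>2 + 2 / k * b\<^sup>2 - 2 * (a * b)"
    using assms by (simp add: power2_diff power_mult_distrib power_divide right_diff_distrib distrib_left)
      (simp add: power2_eq_square)
  finally show ?thesis by simp
qed

text \<open>The zero order term of the Weyl equation, \<open>P = \<i> \<sigma> . A\<close>. The decay is imposed on the squared norm,
  so that \<open>\<rho>\<close> is the exponent of the vector potential.\<close>

locale weyl_potential =
  fixes P :: "real^3 \<Rightarrow> complex^2 \<Rightarrow> complex^2" and C :: real and \<rho> :: real
  assumes antisymmetric: "P x a \<bullet> b = - (a \<bullet> P x b)"
    and decay: "(norm (P x a))\<^sup>2 \<le> C * weight \<rho> x * (norm a)\<^sup>2"
    and measurable: "u \<in> borel_measurable borel \<Longrightarrow> (\<lambda>x. P x (u x)) \<in> borel_measurable borel"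
    and \<rho>: "\<rho> \<ge> 0" and C: "C \<ge> 0"
begin

lemma norm_potential_le: "norm (P x a) \<le> sqrt C * norm a"
proof -
  have "weight \<rho> x \<le> 1"
    using powr_mono2'[of "-\<rho>" 1 "1 + (norm x)\<^sup>2"] \<rho> by (simp add: weight_def)
  then have "C * weight \<rho> x * (norm a)\<^sup>2 \<le> C * 1 * (norm a)\<^sup>2"
    using C by (intro mult_right_mono mult_left_mono) auto
  then have "(norm (P x a))\<^sup>2 \<le> (sqrt C * norm a)\<^sup>2"
    using decay[of x a] C by (simp add: power_mult_distrib)
  then show ?thesis
    by (rule power2_le_imp_le) (simp add: C)
qed

lemma loc_square_integrable_potential:
  assumes "loc_square_integrable u"
  shows "loc_square_integrable (\<lambda>x. P x (u x))"
  by (rule loc_square_integrable_bound[OF assms _ norm_potential_le])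
    (use assms measurable in \<open>simp add: loc_square_integrable_def\<close>)

text \<open>Green's identity for \<open>\<xi> u\<close> and \<open>\<xi> w\<close>, with \<open>\<xi>\<close> the cutoff: the potential drops out by antisymmetry, and
  what remains is \<open>\<kappa> \<integral>|\<xi> u|\<^sup>2\<close> and twice the pairing of \<open>\<xi> u\<close> with the commutator applied to \<open>w\<close>. Young's
  inequality absorbs half of the former.\<close>

lemma caccioppoli:
  assumes u: "weak_weyl u (\<lambda>x. P x (u x))" "loc_square_integrable u"
    and w: "weak_weyl w (\<lambda>x. P x (w x) + \<kappa> *\<^sub>R u x)" "loc_square_integrable w"
    and \<kappa>: "\<kappa> \<noteq> 0" and R: "R > 0"
  shows "\<bar>\<kappa>\<bar> / 2 * (LINT x|lborel. (norm (cutoff R x *\<^sub>R u x))\<^sup>2)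
    \<le> 2 / \<bar>\<kappa>\<bar> * (LINT x|lborel. (norm (weyl_cutoff R x (w x)))\<^sup>2)"
proof -
  note pu = loc_square_integrable_potential[OF u(2)] and pw = loc_square_integrable_potential[OF w(2)]
  have "loc_square_integrable (\<lambda>x. \<kappa> *\<^sub>R u x)"
  proof (rule loc_square_integrable_bound[OF u(2)])
    have "u \<in> borel_measurable borel" using u(2) by (simp add: loc_square_integrable_def)
    then show "(\<lambda>x. \<kappa> *\<^sub>R u x) \<in> borel_measurable borel" by simp
    show "norm (\<kappa> *\<^sub>R u x) \<le> \<bar>\<kappa>\<bar> * norm (u x)" for x by simp
  qed
  then have pw': "loc_square_integrable (\<lambda>x. P x (w x) + \<kappa> *\<^sub>R u x)"
    by (intro loc_square_integrable_add pw)
  let ?U = "\<lambda>x. cutoff R x *\<^sub>R u x" and ?W = "\<lambda>x. cutoff R x *\<^sub>R w x"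
  let ?G = "\<lambda>x. cutoff R x *\<^sub>R P x (u x) + weyl_cutoff R x (u x)"
  let ?H = "\<lambda>x. cutoff R x *\<^sub>R (P x (w x) + \<kappa> *\<^sub>R u x) + weyl_cutoff R x (w x)"
  have sU: "square_integrable lborel ?U" and sW: "square_integrable lborel ?W"
    by (intro cutoff_square_integrable R u w)+
  have sD: "square_integrable lborel (\<lambda>x. weyl_cutoff R x (w x))"
    by (intro cutoff_square_integrable R u w)
  note gU = weak_weyl_cutoff[OF u pu R] and gW = weak_weyl_cutoff[OF w pw' R]
  have "(LINT x|lborel. ?G x \<bullet> ?W x) = - (LINT x|lborel. ?U x \<bullet> ?H x)"
    by (rule weak_weyl_green[OF gU(1) sU gU(2) gW(1) sW gW(2), where R=R]) (simp add: cutoff_outside R)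
  then have "(LINT x|lborel. ?G x \<bullet> ?W x) + (LINT x|lborel. ?U x \<bullet> ?H x) = 0" by linarith
  then have "(LINT x|lborel. ?G x \<bullet> ?W x + ?U x \<bullet> ?H x) = 0"
    by (simp only: Bochner_Integration.integral_add[OF
        square_integrable_bilinear[OF gU(2) sW bounded_bilinear_inner]
        square_integrable_bilinear[OF sU gW(2) bounded_bilinear_inner]])
  also have "(\<lambda>x. ?G x \<bullet> ?W x + ?U x \<bullet> ?H x) = (\<lambda>x. 2 * (?U x \<bullet> weyl_cutoff R x (w x)) + \<kappa> * (norm (?U x))\<^sup>2)"
  proof (rule ext)
    fix x
    have "P x (u x) \<bullet> w x = - (u x \<bullet> P x (w x))" by (rule antisymmetric)
    moreover have "weyl_cutoff R x (u x) \<bullet> w x = u x \<bullet> weyl_cutoff R x (w x)" by (rule weyl_cutoff_selfadjoint)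
    moreover have "(norm (?U x))\<^sup>2 = cutoff R x * cutoff R x * (u x \<bullet> u x)"
      by (simp only: power2_norm_eq_inner inner_scaleR_left inner_scaleR_right mult.assoc)
    ultimately show "?G x \<bullet> ?W x + ?U x \<bullet> ?H x = 2 * (?U x \<bullet> weyl_cutoff R x (w x)) + \<kappa> * (norm (?U x))\<^sup>2"
      by (simp only: inner_add_left inner_add_right inner_scaleR_left inner_scaleR_right) (simp add: algebra_simps)
  qed
  finally have zero: "(LINT x|lborel. 2 * (?U x \<bullet> weyl_cutoff R x (w x)) + \<kappa> * (norm (?U x))\<^sup>2) = 0" .
  have i1: "integrable lborel (\<lambda>x. ?U x \<bullet> weyl_cutoff R x (w x))"
    by (rule square_integrable_bilinear[OF sU sD bounded_bilinear_inner])
  have i2: "integrable lborel (\<lambda>x. (norm (?U x))\<^sup>2)" "integrable lborel (\<lambda>x. (norm (weyl_cutoff R x (w x)))\<^sup>2)"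
    using sU sD by (auto simp: square_integrable_def)
  have "\<bar>\<kappa>\<bar> * (LINT x|lborel. (norm (?U x))\<^sup>2) = \<bar>LINT x|lborel. 2 * (?U x \<bullet> weyl_cutoff R x (w x))\<bar>"
  proof -
    have "(LINT x|lborel. 2 * (?U x \<bullet> weyl_cutoff R x (w x))) + (LINT x|lborel. \<kappa> * (norm (?U x))\<^sup>2) = 0"
      using zero Bochner_Integration.integral_add[OF integrable_mult_right[OF i1, of 2] integrable_mult_right[OF i2(1), of \<kappa>]]
      by (simp only:)
    then have "(LINT x|lborel. 2 * (?U x \<bullet> weyl_cutoff R x (w x))) + \<kappa> * (LINT x|lborel. (norm (?U x))\<^sup>2) = 0"
      by (simp only: integral_mult_right_zero)
    then have "\<kappa> * (LINT x|lborel. (norm (?U x))\<^sup>2) = - (LINT x|lborel. 2 * (?U x \<bullet> weyl_cutoff R x (w x)))"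
      by linarith
    then have "\<bar>\<kappa> * (LINT x|lborel. (norm (?U x))\<^sup>2)\<bar> = \<bar>LINT x|lborel. 2 * (?U x \<bullet> weyl_cutoff R x (w x))\<bar>"
      by simp
    then show ?thesis by (simp add: abs_mult)
  qed
  also have "\<dots> \<le> (LINT x|lborel. \<bar>\<kappa>\<bar> / 2 * (norm (?U x))\<^sup>2 + 2 / \<bar>\<kappa>\<bar> * (norm (weyl_cutoff R x (w x)))\<^sup>2)"
  proof -
    have "norm (LINT x|lborel. 2 * (?U x \<bullet> weyl_cutoff R x (w x)))
      \<le> (LINT x|lborel. \<bar>\<kappa>\<bar> / 2 * (norm (?U x))\<^sup>2 + 2 / \<bar>\<kappa>\<bar> * (norm (weyl_cutoff R x (w x)))\<^sup>2)"
    proof (rule Bochner_Integration.integral_norm_bound_integral)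
      fix x
      have k: "\<bar>\<kappa>\<bar> > 0" using \<kappa> by simp
      define a b where "a = norm (?U x)" and "b = norm (weyl_cutoff R x (w x))"
      have "2 * (a * b) \<le> \<bar>\<kappa>\<bar> / 2 * a\<^sup>2 + 2 / \<bar>\<kappa>\<bar> * b\<^sup>2"
        by (rule weighted_young_inequality[OF k])
      moreover have "\<bar>?U x \<bullet> weyl_cutoff R x (w x)\<bar> \<le> a * b"
        unfolding a_def b_def by (rule Cauchy_Schwarz_ineq2)
      ultimately show "norm (2 * (?U x \<bullet> weyl_cutoff R x (w x))) \<le> \<bar>\<kappa>\<bar> / 2 * (norm (?U x))\<^sup>2 + 2 / \<bar>\<kappa>\<bar> * (norm (weyl_cutoff R x (w x)))\<^sup>2"
        unfolding a_def[symmetric] b_def[symmetric] by (simp add: abs_mult)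
    qed (intro Bochner_Integration.integrable_add integrable_mult_right i1 i2)+
    then show ?thesis by (simp only: real_norm_def)
  qed
  also have "\<dots> = \<bar>\<kappa>\<bar> / 2 * (LINT x|lborel. (norm (?U x))\<^sup>2) + 2 / \<bar>\<kappa>\<bar> * (LINT x|lborel. (norm (weyl_cutoff R x (w x)))\<^sup>2)"
    by (simp only: Bochner_Integration.integral_add[OF integrable_mult_right[OF i2(1)] integrable_mult_right[OF i2(2)]]
        integral_mult_right_zero)
  finally show ?thesis by linarith
qed

end

text \<open>The commutator is of size \<open>1 / R\<close> and lives in the ball of radius \<open>R\<close>, where the weight is at least of
  order \<open>R\<close> to the power \<open>- 2 * s\<close>.\<close>

lemma weyl_cutoff_weighted_le:
  assumes w: "weighted_square_integrable s w" and s: "s \<ge> 0" and R: "R \<ge> 1"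
  shows "(LINT x|lborel. (norm (weyl_cutoff R x (w x)))\<^sup>2)
     \<le> 72\<^sup>2 * 2 powr s * (R\<^sup>2) powr (s - 1) * (LINT x|lborel. weight s x * (norm (w x))\<^sup>2)"
proof -
  let ?c = "72\<^sup>2 * 2 powr s * (R\<^sup>2) powr (s - 1)"
  have R0: "R > 0" using R by simp
  have "(LINT x|lborel. (norm (weyl_cutoff R x (w x)))\<^sup>2) \<le> (LINT x|lborel. ?c * (weight s x * (norm (w x))\<^sup>2))"
  proof (rule Bochner_Integration.integral_mono)
    show "integrable lborel (\<lambda>x. (norm (weyl_cutoff R x (w x)))\<^sup>2)"
      using cutoff_square_integrable(2)[OF R0 weighted_loc_square_integrable[OF w s]]
      by (simp add: square_integrable_def)
    show "integrable lborel (\<lambda>x. ?c * (weight s x * (norm (w x))\<^sup>2))"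
      using w by (simp add: weighted_square_integrable_def)
    fix x :: "real^3"
    show "(norm (weyl_cutoff R x (w x)))\<^sup>2 \<le> ?c * (weight s x * (norm (w x))\<^sup>2)"
    proof (cases "norm x \<ge> R")
      case True
      then show ?thesis using weyl_cutoff_outside[OF R0 True] weight_pos[of s x] by simp
    next
      case False
      have "(norm (weyl_cutoff R x (w x)))\<^sup>2 \<le> (72 * (1 / R) * norm (w x))\<^sup>2"
        using norm_weyl_cutoff_le_inverse[OF R0, of x "w x"] by (intro power_mono) auto
      also have "\<dots> = 72\<^sup>2 * (1 / R\<^sup>2) * (1 * (norm (w x))\<^sup>2)"
        by (simp add: power_mult_distrib power_divide)
      also have "\<dots> \<le> 72\<^sup>2 * (1 / R\<^sup>2) * (((2 * R\<^sup>2) powr s * weight s x) * (norm (w x))\<^sup>2)"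
        using False R s by (intro mult_left_mono mult_right_mono one_le_weight) auto
      also have "\<dots> = ?c * (weight s x * (norm (w x))\<^sup>2)"
        using R0 by (simp add: powr_mult powr_diff)
      finally show ?thesis .
    qed
  qed
  then show ?thesis by simp
qed

text \<open>By the two preceding estimates the mean square of \<open>u\<close>, cut off at radius \<open>R\<close>, is of order \<open>R\<close> to the
  power \<open>2 * s - 2\<close>. As \<open>s < 1\<close>, it tends to \<open>0\<close>.\<close>

lemma (in weyl_potential) companion_component_zero:
  assumes u: "weak_weyl u (\<lambda>x. P x (u x))" "loc_square_integrable u"
    and w: "weak_weyl w (\<lambda>x. P x (w x) + \<kappa> *\<^sub>R u x)" "weighted_square_integrable s w"
    and \<kappa>: "\<kappa> \<noteq> 0" and s: "0 \<le> s" "s < 1"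
  shows "AE x in lborel. u x = 0"
proof -
  define I where "I = (LINT x|lborel. weight s x * (norm (w x))\<^sup>2)"
  define N where "N n = (LINT x|lborel. (norm (cutoff (real n + 1) x *\<^sub>R u x))\<^sup>2)" for n
  define B where "B n = 4 / \<kappa>\<^sup>2 * (72\<^sup>2 * 2 powr s * ((real n + 1)\<^sup>2) powr (s - 1) * I)" for n
  have um: "u \<in> borel_measurable borel" using u(2) by (simp add: loc_square_integrable_def)
  have NB: "N n \<le> B n" for n
  proof -
    have "\<bar>\<kappa>\<bar> / 2 * N n \<le> 2 / \<bar>\<kappa>\<bar> * (LINT x|lborel. (norm (weyl_cutoff (real n + 1) x (w x)))\<^sup>2)"
      unfolding N_def
      by (rule caccioppoli[OF u w(1) weighted_loc_square_integrable[OF w(2) s(1)] \<kappa>]) simp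
    also have "\<dots> \<le> 2 / \<bar>\<kappa>\<bar> * (72\<^sup>2 * 2 powr s * ((real n + 1)\<^sup>2) powr (s - 1) * I)"
      unfolding I_def by (intro mult_left_mono weyl_cutoff_weighted_le w s) auto
    finally have "2 / \<bar>\<kappa>\<bar> * (\<bar>\<kappa>\<bar> / 2 * N n) \<le> 2 / \<bar>\<kappa>\<bar> * (2 / \<bar>\<kappa>\<bar> * (72\<^sup>2 * 2 powr s * ((real n + 1)\<^sup>2) powr (s - 1) * I))"
      by (intro mult_left_mono) auto
    moreover have "2 / \<bar>\<kappa>\<bar> * (\<bar>\<kappa>\<bar> / 2 * N n) = N n" using \<kappa> by simp
    moreover have "2 / \<bar>\<kappa>\<bar> * (2 / \<bar>\<kappa>\<bar> * (72\<^sup>2 * 2 powr s * ((real n + 1)\<^sup>2) powr (s - 1) * I)) = B n"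
      by (simp add: B_def power2_eq_square)
    ultimately show ?thesis by simp
  qed
  have "(\<lambda>n. ((real n + 1)\<^sup>2) powr (s - 1)) \<longlonglongrightarrow> 0"
  proof (rule tendsto_neg_powr)
    show "s - 1 < 0" using s by simp
    have "filterlim (\<lambda>n. real n + 1) at_top sequentially"
      by (rule filterlim_at_top_mono[OF filterlim_real_sequentially]) simp
    then show "filterlim (\<lambda>n. (real n + 1)\<^sup>2) at_top sequentially"
      by (rule filterlim_pow_at_top[rotated]) simp
  qed
  from tendsto_mult[OF tendsto_const[of "4 / \<kappa>\<^sup>2 * (72\<^sup>2 * 2 powr s)"] tendsto_mult[OF this tendsto_const[of I]]]
  have B0: "B \<longlonglongrightarrow> 0" by (simp add: B_def[abs_def] mult.assoc)
  have *: "integrable lborel (\<lambda>x. (norm (u x))\<^sup>2) \<and> (LINT x|lborel. (norm (u x))\<^sup>2) \<le> e" if e: "e > 0" for e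
  proof -
    obtain n0 where n0: "\<And>n. n \<ge> n0 \<Longrightarrow> B n < e"
      using order_tendstoD(2)[OF B0 e] unfolding eventually_sequentially by blast
    have 1: "integrable lborel (\<lambda>x. (norm (cutoff (real n + 1) x *\<^sub>R u x))\<^sup>2)" for n
      using cutoff_square_integrable(1)[OF _ u(2), of "real n + 1"] by (simp add: square_integrable_def)
    have 2: "(LINT x|lborel. (norm (cutoff (real n + 1) x *\<^sub>R u x))\<^sup>2) \<le> e" if "n \<ge> n0" for n
      using NB[of n] n0[OF that] by (simp add: N_def)
    have 3: "AE x in lborel. (\<lambda>n. (norm (cutoff (real n + 1) x *\<^sub>R u x))\<^sup>2) \<longlonglongrightarrow> (norm (u x))\<^sup>2"
    proof (intro always_eventually allI)
      fix x
      have "(\<lambda>n. (norm (cutoff (real n + 1) x *\<^sub>R u x))\<^sup>2) \<longlonglongrightarrow> (norm (1 *\<^sub>R u x))\<^sup>2"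
        by (intro tendsto_intros cutoff_tendsto_1)
      then show "(\<lambda>n. (norm (cutoff (real n + 1) x *\<^sub>R u x))\<^sup>2) \<longlonglongrightarrow> (norm (u x))\<^sup>2" by simp
    qed
    note lim = integrable_limit_of_bounded_integrals[where f="\<lambda>n x. (norm (cutoff (real n + 1) x *\<^sub>R u x))\<^sup>2" and N=n0 and K=e, OF 1 _ 2 _ 3]
    show ?thesis using lim um e by auto
  qed
  have i: "integrable lborel (\<lambda>x. (norm (u x))\<^sup>2)" using *[of 1] by simp
  have "(LINT x|lborel. (norm (u x))\<^sup>2) \<le> 0"
  proof (rule field_le_epsilon)
    fix e :: real assume "e > 0"
    from *[OF this] show "(LINT x|lborel. (norm (u x))\<^sup>2) \<le> 0 + e" by simp
  qed
  moreover have "(LINT x|lborel. (norm (u x))\<^sup>2) \<ge> 0" by simp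
  ultimately have "(LINT x|lborel. (norm (u x))\<^sup>2) = 0" by linarith
  then show ?thesis
    using integral_nonneg_eq_0_iff_AE[OF i] by simp
qed

section \<open>Integral identities for smooth spinors\<close>

lemma test_function_mixed_partials:
  assumes "\<psi> \<in> test_functions"
  shows "partial i (partial j \<psi>) x = partial j (partial i \<psi>) x"
proof -
  have *: "L (partial i (partial j \<psi>) x) = L (partial j (partial i \<psi>) x)" if L: "bounded_linear L" for L :: "complex \<Rightarrow> real"
  proof -
    interpret L: bounded_linear L by fact
    have d: "((\<lambda>x. L (\<phi> x)) has_derivative (\<lambda>h. \<Sum>k\<in>UNIV. h $ k * L (partial k \<phi> x))) (at x)"
      if "\<phi> \<in> test_functions" for \<phi> x
      using L.has_derivative[OF differentiable_has_partial_derivative[OF test_function_differentiable[OF that, of x]]]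
      by (simp add: L.sum L.scaleR)
    have e: "(\<Sum>k\<in>UNIV. axis l 1 $ k * g k) = g l" for g :: "3 \<Rightarrow> real" and l
      by (simp add: axis_def if_distrib[of "\<lambda>t. t * _"] cong: if_cong)
    have c: "continuous_on UNIV (\<lambda>x. L (partial k (partial l \<psi>) x))" for k l
      by (intro L.continuous_on test_function_continuous test_function_partial assms)
    show ?thesis
      using mixed_derivatives_eq[OF d[OF assms], of "axis j 1" "\<lambda>x h. \<Sum>k\<in>UNIV. h $ k * L (partial k (partial j \<psi>) x)" "axis i 1"
          "\<lambda>x h. \<Sum>k\<in>UNIV. h $ k * L (partial k (partial i \<psi>) x)" x]
      by (simp add: e c d test_function_partial assms)
  qed
  show ?thesis
    using *[OF bounded_linear_Re] *[OF bounded_linear_Im] by (simp add: complex_eq_iff)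
qed

lemma spinor_mixed_partials:
  assumes "test_spinor v"
  shows "spinor_partial i (spinor_partial j v) x = spinor_partial j (spinor_partial i v) x"
  using assms by (simp add: spinor_partial_def vec_eq_iff test_spinor_def test_function_mixed_partials)

lemma test_spinor_has_derivative:
  assumes "test_spinor v"
  shows "(v has_derivative (\<lambda>h. \<Sum>k\<in>UNIV. h $ k *\<^sub>R spinor_partial k v x)) (at x)"
proof -
  have "((\<lambda>x. \<Sum>c\<in>UNIV. (v x $ c) *s axis c 1) has_derivative
      (\<lambda>h. \<Sum>c\<in>UNIV. (\<Sum>k\<in>UNIV. h $ k *\<^sub>R partial k (\<lambda>y. v y $ c) x) *s (axis c 1 :: complex^2))) (at x)"
    using assms
    by (intro has_derivative_sum
        bounded_linear.has_derivative[OF bounded_bilinear.bounded_linear_left[OF bounded_bilinear_vector_scalar_mult]]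
        differentiable_has_partial_derivative test_function_differentiable)
      (simp add: test_spinor_def)
  moreover have "(\<Sum>c\<in>UNIV. (a $ c) *s axis c 1) = a" for a :: "complex^2"
    by (simp add: vec_eq_iff forall_2 sum_2 axis_def)
  moreover have "(\<Sum>c\<in>UNIV. (\<Sum>k\<in>UNIV. h $ k *\<^sub>R partial k (\<lambda>y. v y $ c) x) *s (axis c 1 :: complex^2))
     = (\<Sum>k\<in>UNIV. h $ k *\<^sub>R spinor_partial k v x)" for h :: "real^3"
    by (simp add: vec_eq_iff forall_2 sum_2 axis_def spinor_partial_def)
  ultimately show ?thesis by simp
qed

lemma weyl_outside:
  assumes "\<And>x. norm x > R \<Longrightarrow> v x = 0" "norm x > R"
  shows "weyl v x = 0"
proof -
  have "spinor_partial k v x = 0" for k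
    using partial_outside_support[of R "\<lambda>y. v y $ _" x k] assms by (simp add: spinor_partial_def vec_eq_iff)
  then show ?thesis by (simp add: weyl_def)
qed

lemma spinor_integration_by_parts:
  fixes b :: "real^3 \<Rightarrow> real" and k :: 3
  assumes b: "\<And>x. (b has_derivative (\<lambda>h. \<Sum>k\<in>UNIV. h $ k * db k x)) (at x)" "\<And>k. continuous_on UNIV (db k)"
    and y: "test_spinor y" and z: "test_spinor z" and N: "bounded_linear N"
  defines "I \<equiv> \<lambda>x. db k x * (y x \<bullet> N (z x)) + b x * (spinor_partial k y x \<bullet> N (z x)) + b x * (y x \<bullet> N (spinor_partial k z x))"
  shows "integrable lborel I" "(LINT x|lborel. I x) = 0"
proof -
  interpret N: bounded_linear N by fact
  define D where "D x h = b x * (y x \<bullet> N (\<Sum>k\<in>UNIV. h $ k *\<^sub>R spinor_partial k z x)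
      + (\<Sum>k\<in>UNIV. h $ k *\<^sub>R spinor_partial k y x) \<bullet> N (z x)) + (\<Sum>k\<in>UNIV. h $ k * db k x) * (y x \<bullet> N (z x))" for x h
  have d: "((\<lambda>x. b x * (y x \<bullet> N (z x))) has_derivative D x) (at x)" for x
    unfolding D_def
    by (intro has_derivative_mult has_derivative_inner b N.has_derivative test_spinor_has_derivative y z)
  have e: "(\<Sum>k\<in>UNIV. axis l 1 $ k * g k) = g l" "(\<Sum>k\<in>UNIV. axis l 1 $ k *\<^sub>R u k) = u l"
    for g :: "3 \<Rightarrow> real" and u :: "3 \<Rightarrow> complex^2" and l
    by (simp_all add: axis_def if_distrib[of "\<lambda>t. t * _"] if_distrib[of "\<lambda>t. t *\<^sub>R _"] cong: if_cong)
  have Dk: "D x (axis k 1) = db k x * (y x \<bullet> N (z x)) + b x * (spinor_partial k y x \<bullet> N (z x)) + b x * (y x \<bullet> N (spinor_partial k z x))" for x k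
    by (simp only: D_def e) (simp add: algebra_simps)
  have bc: "continuous_on UNIV b"
    using b(1) by (auto intro!: continuous_at_imp_continuous_on has_derivative_continuous)
  have c: "continuous_on UNIV (\<lambda>x. D x (axis k 1))" for k
    unfolding Dk
    by (intro continuous_intros b bc N.continuous_on test_spinor_integrable(2) test_spinor_partial y z)
  obtain R where R: "\<And>x. norm x > R \<Longrightarrow> y x = 0" using test_spinor_support[OF y] by blast
  have out: "b x * (y x \<bullet> N (z x)) = 0" if "norm x > R" for x using R[OF that] by simp
  have I: "I = (\<lambda>x. D x (axis k 1))" by (simp add: I_def Dk)
  show "integrable lborel I" "(LINT x|lborel. I x) = 0"
    unfolding I using integral_derivative_eq_0[OF d c out] by blast+
qed

definition pauli_product :: "3 \<Rightarrow> 3 \<Rightarrow> complex^2 \<Rightarrow> complex^2" where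
  "pauli_product i j a = pauli i *v (pauli j *v a)"

lemma pauli_product_bounded_linear: "bounded_linear (pauli_product i j)"
  unfolding pauli_product_def by (rule bounded_linear_compose[OF pauli_bounded_linear pauli_bounded_linear])

lemma pauli_product_skew: "i \<noteq> j \<Longrightarrow> a \<bullet> pauli_product i j b = - (pauli_product i j a \<bullet> b)"
  by (simp add: pauli_product_def pauli_selfadjoint[symmetric] pauli_anticommute[of i j a])

text \<open>The integrand is the divergence of the field with \<open>i\<close>-th component \<open>h * (v \<bullet> S\<^sub>i (S\<^sub>j (\<partial>\<^sub>j v)))\<close> and \<open>j\<close>-th
  component \<open>- h * (v \<bullet> S\<^sub>i (S\<^sub>j (\<partial>\<^sub>i v)))\<close>, where \<open>S\<close> stands for the Pauli matrices. The second
  derivatives cancel by symmetry, and since the product of two different Pauli matrices is skew, the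
  two terms of first order in each factor agree.\<close>

lemma spinor_curl_identity:
  fixes h :: "real^3 \<Rightarrow> real" and i j :: 3
  assumes h: "\<And>x. (h has_derivative (\<lambda>k. \<Sum>j\<in>UNIV. k $ j * dh j x)) (at x)" "\<And>j. continuous_on UNIV (dh j)"
    and v: "test_spinor v" and ij: "i \<noteq> j"
  defines "I \<equiv> \<lambda>x. 2 * h x * (spinor_partial i v x \<bullet> pauli_product i j (spinor_partial j v x))
      + (dh i x * (v x \<bullet> pauli_product i j (spinor_partial j v x)) - dh j x * (v x \<bullet> pauli_product i j (spinor_partial i v x)))"
  shows "integrable lborel I" "(LINT x|lborel. I x) = 0"
proof -
  note A = spinor_integration_by_parts[OF h v test_spinor_partial[OF v, of j] pauli_product_bounded_linear[of i j], where k=i]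
  note B = spinor_integration_by_parts[OF h v test_spinor_partial[OF v, of i] pauli_product_bounded_linear[of i j], where k=j]
  let ?A = "\<lambda>x. dh i x * (v x \<bullet> pauli_product i j (spinor_partial j v x)) +
     h x * (spinor_partial i v x \<bullet> pauli_product i j (spinor_partial j v x)) +
     h x * (v x \<bullet> pauli_product i j (spinor_partial i (spinor_partial j v) x))"
  let ?B = "\<lambda>x. dh j x * (v x \<bullet> pauli_product i j (spinor_partial i v x)) +
     h x * (spinor_partial j v x \<bullet> pauli_product i j (spinor_partial i v x)) +
     h x * (v x \<bullet> pauli_product i j (spinor_partial j (spinor_partial i v) x))"
  have eq: "I = (\<lambda>x. ?A x - ?B x)"
  proof (rule ext)
    fix x
    have "spinor_partial j v x \<bullet> pauli_product i j (spinor_partial i v x) =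
        - (spinor_partial i v x \<bullet> pauli_product i j (spinor_partial j v x))"
      by (simp add: pauli_product_skew[OF ij, of "spinor_partial j v x"] inner_commute)
    then show "I x = ?A x - ?B x"
      by (simp add: I_def spinor_mixed_partials[OF v, of i j])
  qed
  show "integrable lborel I" unfolding eq by (rule Bochner_Integration.integrable_diff[OF A(1) B(1)])
  show "(LINT x|lborel. I x) = 0"
    unfolding eq Bochner_Integration.integral_diff[OF A(1) B(1)] A(2) B(2) by simp
qed

lemma norm_weyl_square:
  "(norm (weyl v x))\<^sup>2 = (\<Sum>k\<in>UNIV. (norm (spinor_partial k v x))\<^sup>2)
    + 2 * (spinor_partial 1 v x \<bullet> pauli_product 1 2 (spinor_partial 2 v x))
    + 2 * (spinor_partial 1 v x \<bullet> pauli_product 1 3 (spinor_partial 3 v x))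
    + 2 * (spinor_partial 2 v x \<bullet> pauli_product 2 3 (spinor_partial 3 v x))"
proof -
  have *: "(norm (a + b + c))\<^sup>2 = (norm a)\<^sup>2 + (norm b)\<^sup>2 + (norm c)\<^sup>2 + 2 * (a \<bullet> b) + 2 * (a \<bullet> c) + 2 * (b \<bullet> c)"
    for a b c :: "complex^2"
    by (simp add: power2_norm_eq_inner inner_add_left inner_add_right inner_commute)
  show ?thesis
    unfolding weyl_def sum_3 * by (simp add: norm_pauli pauli_selfadjoint pauli_product_def)
qed

text \<open>The cross terms in the square of the Weyl operator are divergences, so it has the same energy as
  the gradient.\<close>

lemma weyl_energy:
  assumes v: "test_spinor v"
  shows "(LINT x|lborel. (norm (weyl v x))\<^sup>2) = (\<Sum>k\<in>UNIV. LINT x|lborel. (norm (spinor_partial k v x))\<^sup>2)"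
proof -
  have h: "((\<lambda>_::real^3. 1::real) has_derivative (\<lambda>k. \<Sum>j\<in>UNIV. k $ j * (\<lambda>_ _. 0) j x)) (at x)" for x
    by simp
  note T = spinor_curl_identity[where h="\<lambda>_. 1" and dh="\<lambda>_ _. 0", OF h continuous_on_const v, simplified]
  have s: "integrable lborel (\<lambda>x. (norm (spinor_partial k v x))\<^sup>2)" for k
    using test_spinor_integrable(1)[OF test_spinor_partial[OF v]] by (simp add: square_integrable_def)
  have t: "integrable lborel (\<lambda>x. spinor_partial i v x \<bullet> pauli_product i j (spinor_partial j v x))"
    "(LINT x|lborel. spinor_partial i v x \<bullet> pauli_product i j (spinor_partial j v x)) = 0" if "i \<noteq> j" for i j
    using T[OF that] by simp_all
  show ?thesis
    unfolding norm_weyl_square by (simp add: s t)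
qed

section \<open>A Hardy inequality for the Weyl operator\<close>

text \<open>Put \<open>D k = p (S\<^sub>k X - x\<^sub>k v) - b x\<^sub>k v\<close> with \<open>X = \<Sum>j. x\<^sub>j S\<^sub>j v\<close>. The left hand side is the sum over \<open>k\<close> of
  \<open>h |a k|\<^sup>2 - 2 (a k \<bullet> D k)\<close>, hence at least \<open>- (\<Sum>k. |D k|\<^sup>2) / h\<close>. The spinors \<open>T k = S\<^sub>k X - x\<^sub>k v\<close> are
  tangential, in that \<open>\<Sum>k. x\<^sub>k T k = 0\<close>, so the angular part (with \<open>p\<close>) and the radial part (with \<open>b\<close>)
  of \<open>D\<close> do not interfere, and \<open>\<Sum>k. |T k|\<^sup>2\<close> is only \<open>2 |x|\<^sup>2 |v|\<^sup>2\<close>. Using the tangential part alone in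
  the angular square is what makes the resulting constant good enough for all exponents below \<open>1\<close>.\<close>

lemma completing_the_square:
  fixes x :: "real^3" and v :: "complex^2" and a :: "3 \<Rightarrow> complex^2"
  assumes h: "h > 0"
  shows "h * (\<Sum>k\<in>UNIV. (norm (a k))\<^sup>2)
      - 2 * p * ((x $ 1 * (v \<bullet> pauli_product 1 2 (a 2)) - x $ 2 * (v \<bullet> pauli_product 1 2 (a 1)))
        + (x $ 1 * (v \<bullet> pauli_product 1 3 (a 3)) - x $ 3 * (v \<bullet> pauli_product 1 3 (a 1)))
        + (x $ 2 * (v \<bullet> pauli_product 2 3 (a 3)) - x $ 3 * (v \<bullet> pauli_product 2 3 (a 2))))
      + 2 * b * (\<Sum>k\<in>UNIV. x $ k * (v \<bullet> a k))
    \<ge> - ((2 * p\<^sup>2 + b\<^sup>2) * (norm x)\<^sup>2 / h * (norm v)\<^sup>2)"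
proof -
  define X where "X = (\<Sum>j\<in>UNIV. x $ j *\<^sub>R (pauli j *v v))"
  define T where "T k = pauli k *v X - x $ k *\<^sub>R v" for k
  \<comment> \<open>\<open>D k / h\<close> is the minimizer of the quadratic form in \<open>a k\<close>\<close>
  define D where "D k = p *\<^sub>R T k - (b * x $ k) *\<^sub>R v" for k
  have q: "(norm x)\<^sup>2 = (x $ 1)\<^sup>2 + (x $ 2)\<^sup>2 + (x $ 3)\<^sup>2"
    by (simp only: power2_norm_eq_inner) (simp add: inner_vec_def sum_3 power2_eq_square)
  have swap: "pauli 2 *v (pauli 1 *v c) = - (pauli 1 *v (pauli 2 *v c))"
    "pauli 3 *v (pauli 1 *v c) = - (pauli 1 *v (pauli 3 *v c))"
    "pauli 3 *v (pauli 2 *v c) = - (pauli 2 *v (pauli 3 *v c))" for c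
    by (rule pauli_anticommute; simp)+
  note expand = pauli_scaleR matrix_vector_right_distrib matrix_vector_mult_diff_distrib pauli_minus pauli_pauli swap
  \<comment> \<open>Clifford relation: the square of \<open>x . \<sigma>\<close> is \<open>|x|\<^sup>2\<close>\<close>
  have XX: "(\<Sum>j\<in>UNIV. x $ j *\<^sub>R (pauli j *v X)) = (norm x)\<^sup>2 *\<^sub>R v"
    unfolding X_def q
    by (simp add: sum_3 expand algebra_simps power2_eq_square)
  have X_sym: "X \<bullet> v = v \<bullet> X" by (rule inner_commute)
  have normX: "X \<bullet> X = (norm x)\<^sup>2 * (v \<bullet> v)"
  proof -
    have "X \<bullet> X = (\<Sum>j\<in>UNIV. x $ j *\<^sub>R (pauli j *v X)) \<bullet> v"
      by (subst (2) X_def) (simp add: inner_sum_left inner_sum_right pauli_selfadjoint)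
    then show ?thesis by (simp add: XX)
  qed
  have vX: "(\<Sum>k\<in>UNIV. x $ k * ((pauli k *v X) \<bullet> v)) = (norm x)\<^sup>2 * (v \<bullet> v)"
    using arg_cong[OF XX, of "\<lambda>z. z \<bullet> v"] by (simp add: inner_sum_left)
  have D2: "(\<Sum>k\<in>UNIV. (norm (D k))\<^sup>2) = (2 * p\<^sup>2 + b\<^sup>2) * (norm x)\<^sup>2 * (norm v)\<^sup>2"
  proof -
    have Tv: "(\<Sum>k\<in>UNIV. x $ k * (T k \<bullet> v)) = 0"
    proof -
      have "(\<Sum>k\<in>UNIV. x $ k * (T k \<bullet> v)) = (\<Sum>k\<in>UNIV. x $ k * ((pauli k *v X) \<bullet> v)) - (\<Sum>k\<in>UNIV. (x $ k)\<^sup>2) * (v \<bullet> v)"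
        by (simp add: T_def inner_diff_left right_diff_distrib sum_subtractf sum_distrib_right power2_eq_square mult.assoc)
      then show ?thesis by (simp add: vX q sum_3)
    qed
    have TT: "(\<Sum>k\<in>UNIV. T k \<bullet> T k) = 2 * (norm x)\<^sup>2 * (v \<bullet> v)"
    proof -
      have E: "T k \<bullet> T k = X \<bullet> X - 2 * (x $ k * ((pauli k *v X) \<bullet> v)) + (x $ k)\<^sup>2 * (v \<bullet> v)" for k
        by (simp add: T_def inner_diff_left inner_diff_right pauli_selfadjoint[of k X "pauli k *v X"] pauli_pauli
            inner_commute[of v "pauli k *v X"] power2_eq_square right_diff_distrib)
      have "(\<Sum>k\<in>UNIV. T k \<bullet> T k) = 3 * (X \<bullet> X) - 2 * (\<Sum>k\<in>UNIV. x $ k * ((pauli k *v X) \<bullet> v)) + (\<Sum>k\<in>UNIV. (x $ k)\<^sup>2) * (v \<bullet> v)"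
        by (simp only: E sum_3) (simp add: algebra_simps)
      then show ?thesis by (simp add: normX vX) (simp add: q sum_3 algebra_simps)
    qed
    have E: "(norm (D k))\<^sup>2 = p\<^sup>2 * (T k \<bullet> T k) - 2 * p * b * (x $ k * (T k \<bullet> v)) + b\<^sup>2 * ((x $ k)\<^sup>2 * (v \<bullet> v))" for k
      by (simp only: D_def power2_norm_eq_inner)
        (simp add: inner_diff_left inner_diff_right inner_commute[of v "T k"] power2_eq_square algebra_simps)
    have "(\<Sum>k\<in>UNIV. (norm (D k))\<^sup>2) = p\<^sup>2 * (\<Sum>k\<in>UNIV. T k \<bullet> T k) - 2 * p * b * (\<Sum>k\<in>UNIV. x $ k * (T k \<bullet> v))
        + b\<^sup>2 * ((\<Sum>k\<in>UNIV. (x $ k)\<^sup>2) * (v \<bullet> v))"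
      by (simp only: E sum_3) (simp add: algebra_simps)
    moreover have "(\<Sum>k\<in>UNIV. (x $ k)\<^sup>2) = (norm x)\<^sup>2" by (simp only: q sum_3)
    ultimately show ?thesis
      by (simp only: TT Tv power2_norm_eq_inner[of v]) (simp add: algebra_simps)
  qed
  have aT: "(\<Sum>k\<in>UNIV. a k \<bullet> T k) =
      (x $ 1 * (v \<bullet> pauli_product 1 2 (a 2)) - x $ 2 * (v \<bullet> pauli_product 1 2 (a 1)))
        + (x $ 1 * (v \<bullet> pauli_product 1 3 (a 3)) - x $ 3 * (v \<bullet> pauli_product 1 3 (a 1)))
        + (x $ 2 * (v \<bullet> pauli_product 2 3 (a 3)) - x $ 3 * (v \<bullet> pauli_product 2 3 (a 2)))"
  proof -
    have m: "v \<bullet> pauli_product i j c = c \<bullet> (pauli j *v (pauli i *v v))" for i j c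
      by (simp only: pauli_product_def inner_commute[of v] pauli_selfadjoint)
    show ?thesis
      unfolding m T_def X_def
      by (simp add: sum_3 expand inner_add_right inner_diff_right algebra_simps)
  qed
  have aD: "(\<Sum>k\<in>UNIV. a k \<bullet> D k) = p * (\<Sum>k\<in>UNIV. a k \<bullet> T k) - b * (\<Sum>k\<in>UNIV. x $ k * (v \<bullet> a k))"
    by (simp add: D_def inner_diff_right sum_3 inner_commute[of v "a _"] algebra_simps)
  have "0 \<le> h * (\<Sum>k\<in>UNIV. (norm (a k - (1 / h) *\<^sub>R D k))\<^sup>2)"
    using h by (intro mult_nonneg_nonneg sum_nonneg) auto
  also have "\<dots> = h * (\<Sum>k\<in>UNIV. (norm (a k))\<^sup>2) - 2 * (\<Sum>k\<in>UNIV. a k \<bullet> D k) + (\<Sum>k\<in>UNIV. (norm (D k))\<^sup>2) / h"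
  proof -
    have E: "h * (norm (a k - (1 / h) *\<^sub>R D k))\<^sup>2 = h * (norm (a k))\<^sup>2 - 2 * (a k \<bullet> D k) + (norm (D k))\<^sup>2 / h" for k
      using h by (simp add: power2_norm_eq_inner inner_diff_left inner_diff_right inner_commute right_diff_distrib distrib_left)
    show ?thesis
      by (simp only: sum_3 distrib_left E) (simp add: add_divide_distrib)
  qed
  finally show ?thesis
    unfolding aD aT D2 by (simp add: algebra_simps)
qed

lemma radial_has_derivative:
  fixes f :: "real \<Rightarrow> real"
  assumes "(f has_real_derivative f') (at ((norm x)\<^sup>2))"
  shows "((\<lambda>x::real^3. f ((norm x)\<^sup>2)) has_derivative (\<lambda>h. \<Sum>k\<in>UNIV. h $ k * (2 * f' * x $ k))) (at x)"
proof -
  have "((\<lambda>x::real^3. x \<bullet> x) has_derivative (\<lambda>h. 2 * (x \<bullet> h))) (at x)"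
    by (auto intro!: derivative_eq_intros simp: inner_commute)
  from has_derivative_compose[OF this assms[unfolded has_field_derivative_def power2_norm_eq_inner]]
  show ?thesis
    unfolding power2_norm_eq_inner
    by (rule has_derivative_eq_rhs) (simp add: fun_eq_iff inner_vec_def sum_distrib_left algebra_simps)
qed

lemma radial_continuous:
  fixes f :: "real \<Rightarrow> real"
  assumes "continuous_on {0..} f"
  shows "continuous_on UNIV (\<lambda>x::real^3. f ((norm x)\<^sup>2))"
  by (rule continuous_on_compose2[OF assms]) (auto intro!: continuous_intros)

lemma has_derivative_coordinate: "((\<lambda>x::real^3. x $ i) has_derivative (\<lambda>h. \<Sum>k\<in>UNIV. h $ k * (if k = i then 1 else 0))) (at x)"
  by (rule has_derivative_eq_rhs[OF bounded_linear.has_derivative[OF bounded_linear_vec_nth has_derivative_ident]])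
    (simp add: if_distrib[of "\<lambda>t. _ * t"] cong: if_cong)

text \<open>Up to the divergences of the curl fields with weight \<open>H\<close> and of the radial field \<open>B x |v|\<^sup>2\<close>, the right
  integrand minus the left one is the expression bounded below by completing the square with
  \<open>a k = \<partial>\<^sub>k v\<close>, \<open>h = H\<close>, \<open>p = H'\<close> and \<open>b = B\<close>, all functions of \<open>q = |x|\<^sup>2\<close>.\<close>

lemma radial_hardy_inequality:
  fixes H H' B B' :: "real \<Rightarrow> real"
  assumes H: "\<And>q. q \<ge> 0 \<Longrightarrow> (H has_real_derivative H' q) (at q)" "\<And>q. q \<ge> 0 \<Longrightarrow> H q > 0" "continuous_on {0..} H'"
    and B: "\<And>q. q \<ge> 0 \<Longrightarrow> (B has_real_derivative B' q) (at q)" "continuous_on {0..} B'"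
    and v: "test_spinor v"
  defines "q \<equiv> \<lambda>x::real^3. (norm x)\<^sup>2"
  shows "integrable lborel (\<lambda>x. (3 * B (q x) + 2 * q x * B' (q x) - (2 * (H' (q x))\<^sup>2 + (B (q x))\<^sup>2) * q x / H (q x)) * (norm (v x))\<^sup>2)"
    and "(LINT x|lborel. (3 * B (q x) + 2 * q x * B' (q x) - (2 * (H' (q x))\<^sup>2 + (B (q x))\<^sup>2) * q x / H (q x)) * (norm (v x))\<^sup>2)
     \<le> (LINT x|lborel. H (q x) * (norm (weyl v x))\<^sup>2)"
proof -
  have q0: "q x \<ge> 0" for x by (simp add: q_def)
  have Hc: "continuous_on {0..} H" "continuous_on {0..} B"
    using H(1) B(1) by (auto intro!: continuous_at_imp_continuous_on DERIV_isCont)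
  define dh where "dh k x = 2 * H' (q x) * x $ k" for k and x :: "real^3"
  have h: "((\<lambda>x. H (q x)) has_derivative (\<lambda>k. \<Sum>j\<in>UNIV. k $ j * dh j x)) (at x)" for x
    unfolding q_def dh_def by (rule radial_has_derivative[OF H(1)]) simp
  have hc: "continuous_on UNIV (dh k)" for k
    unfolding dh_def q_def by (intro continuous_intros radial_continuous[OF H(3)] bounded_linear.continuous_on[OF bounded_linear_vec_nth])
  define db where "db i k x = 2 * B' (q x) * x $ k * x $ i + B (q x) * (if k = i then 1 else 0)" for i k and x :: "real^3"
  have b: "((\<lambda>x. B (q x) * x $ i) has_derivative (\<lambda>h. \<Sum>k\<in>UNIV. h $ k * db i k x)) (at x)" for i x
    unfolding q_def db_def
    by (rule has_derivative_eq_rhs[OF has_derivative_mult[OF radial_has_derivative[OF B(1)] has_derivative_coordinate]])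
      (auto simp: fun_eq_iff sum_3 algebra_simps)
  have bc: "continuous_on UNIV (db i k)" for i k
    unfolding db_def q_def
    by (intro continuous_intros radial_continuous[OF B(2)] radial_continuous[OF Hc(2)] bounded_linear.continuous_on[OF bounded_linear_vec_nth])
  let ?p = "\<lambda>k. spinor_partial k v"
  define C where "C i j x = 2 * H (q x) * (?p i x \<bullet> pauli_product i j (?p j x))
      + (dh i x * (v x \<bullet> pauli_product i j (?p j x)) - dh j x * (v x \<bullet> pauli_product i j (?p i x)))" for i j x
  have C: "integrable lborel (C i j)" "(LINT x|lborel. C i j x) = 0" if "i \<noteq> j" for i j
    unfolding C_def using spinor_curl_identity[OF h hc v that] by blast+
  define T where "T k x = db k k x * (v x \<bullet> v x) + (B (q x) * x $ k) * (?p k x \<bullet> v x) + (B (q x) * x $ k) * (v x \<bullet> ?p k x)" for k x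
  have T: "integrable lborel (T k)" "(LINT x|lborel. T k x) = 0" for k
    unfolding T_def using spinor_integration_by_parts[OF b bc v v bounded_linear_ident, of k k] by blast+
  have vc: "continuous_on UNIV v" by (rule test_spinor_integrable(2)[OF v])
  have wc: "continuous_on UNIV (weyl v)"
    unfolding weyl_def
    by (intro continuous_intros bounded_linear.continuous_on[OF pauli_bounded_linear] test_spinor_integrable(2) test_spinor_partial v)
  obtain R where R: "\<And>x. norm x > R \<Longrightarrow> v x = 0" using test_spinor_support[OF v] by blast
  have R': "weyl v x = 0" if "norm x > R" for x by (rule weyl_outside[OF R that])
  let ?Z = "\<lambda>x. (3 * B (q x) + 2 * q x * B' (q x) - (2 * (H' (q x))\<^sup>2 + (B (q x))\<^sup>2) * q x / H (q x)) * (norm (v x))\<^sup>2"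
  show Zi: "integrable lborel ?Z"
  proof (rule continuous_compact_support_square_integrable(1))
    have "continuous_on {0..} (\<lambda>q. 3 * B q + 2 * q * B' q - (2 * (H' q)\<^sup>2 + (B q)\<^sup>2) * q / H q)"
      by (intro continuous_intros Hc H B) (use H(2) in force)
    from radial_continuous[OF this] show "continuous_on UNIV ?Z"
      unfolding q_def by (rule continuous_on_mult) (intro continuous_intros vc)
    show "?Z x = 0" if "norm x > R" for x using R[OF that] by simp
  qed
  have Wi: "integrable lborel (\<lambda>x. H (q x) * (norm (weyl v x))\<^sup>2)"
  proof (rule continuous_compact_support_square_integrable(1))
    show "continuous_on UNIV (\<lambda>x. H (q x) * (norm (weyl v x))\<^sup>2)"
      unfolding q_def by (intro continuous_intros wc radial_continuous[OF Hc(1)])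
    show "H (q x) * (norm (weyl v x))\<^sup>2 = 0" if "norm x > R" for x using R'[OF that] by simp
  qed
  define E where "E x = (C 1 2 x + C 1 3 x + C 2 3 x) - (T 1 x + T 2 x + T 3 x)" for x
  have E: "integrable lborel E" "(LINT x|lborel. E x) = 0"
    unfolding E_def using C[of 1 2] C[of 1 3] C[of 2 3] T by simp_all
  have "?Z x \<le> H (q x) * (norm (weyl v x))\<^sup>2 - E x" for x
  proof -
    have sq: "(\<Sum>k\<in>UNIV. (x $ k)\<^sup>2) = q x"
      by (simp only: q_def power2_norm_eq_inner) (simp add: inner_vec_def power2_eq_square)
    have tr: "T 1 x + T 2 x + T 3 x = (3 * B (q x) + 2 * q x * B' (q x)) * (norm (v x))\<^sup>2 + 2 * B (q x) * (\<Sum>k\<in>UNIV. x $ k * (v x \<bullet> ?p k x))"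
      by (simp only: sq[symmetric] power2_norm_eq_inner T_def db_def sum_3 inner_commute[of "?p _ x" "v x"])
        (simp add: algebra_simps power2_eq_square)
    have cr: "C 1 2 x + C 1 3 x + C 2 3 x = H (q x) * ((norm (weyl v x))\<^sup>2 - (\<Sum>k\<in>UNIV. (norm (?p k x))\<^sup>2))
       + 2 * H' (q x) * ((x $ 1 * (v x \<bullet> pauli_product 1 2 (?p 2 x)) - x $ 2 * (v x \<bullet> pauli_product 1 2 (?p 1 x)))
        + (x $ 1 * (v x \<bullet> pauli_product 1 3 (?p 3 x)) - x $ 3 * (v x \<bullet> pauli_product 1 3 (?p 1 x)))
        + (x $ 2 * (v x \<bullet> pauli_product 2 3 (?p 3 x)) - x $ 3 * (v x \<bullet> pauli_product 2 3 (?p 2 x))))"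
      by (simp only: C_def dh_def norm_weyl_square) (simp add: algebra_simps)
    have qx: "(norm x)\<^sup>2 = q x" by (simp only: q_def)
    note sos = completing_the_square[OF H(2)[OF q0[of x]], where x=x and v="v x" and a="\<lambda>k. ?p k x" and p="H' (q x)" and b="B (q x)"]
    have "H (q x) * (norm (weyl v x))\<^sup>2 - E x =
      (3 * B (q x) + 2 * q x * B' (q x)) * (norm (v x))\<^sup>2 +
      (H (q x) * (\<Sum>k\<in>UNIV. (norm (?p k x))\<^sup>2)
      - 2 * H' (q x) * ((x $ 1 * (v x \<bullet> pauli_product 1 2 (?p 2 x)) - x $ 2 * (v x \<bullet> pauli_product 1 2 (?p 1 x)))
        + (x $ 1 * (v x \<bullet> pauli_product 1 3 (?p 3 x)) - x $ 3 * (v x \<bullet> pauli_product 1 3 (?p 1 x)))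
        + (x $ 2 * (v x \<bullet> pauli_product 2 3 (?p 3 x)) - x $ 3 * (v x \<bullet> pauli_product 2 3 (?p 2 x))))
      + 2 * B (q x) * (\<Sum>k\<in>UNIV. x $ k * (v x \<bullet> ?p k x)))"
      unfolding E_def tr cr by (simp add: right_diff_distrib)
    also have "\<dots> \<ge> (3 * B (q x) + 2 * q x * B' (q x)) * (norm (v x))\<^sup>2
        + - ((2 * (H' (q x))\<^sup>2 + (B (q x))\<^sup>2) * q x / H (q x) * (norm (v x))\<^sup>2)"
      using sos unfolding qx by (rule add_left_mono)
    finally show ?thesis by (simp add: left_diff_distrib)
  qed
  then have "(LINT x|lborel. ?Z x) \<le> (LINT x|lborel. H (q x) * (norm (weyl v x))\<^sup>2 - E x)"
    by (intro Bochner_Integration.integral_mono Bochner_Integration.integrable_diff Zi Wi E) simp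
  also have "\<dots> = (LINT x|lborel. H (q x) * (norm (weyl v x))\<^sup>2)"
    using Bochner_Integration.integral_diff[OF Wi E(1)] E(2) by simp
  finally show "(LINT x|lborel. ?Z x) \<le> (LINT x|lborel. H (q x) * (norm (weyl v x))\<^sup>2)" .
qed

text \<open>Comparable to \<open>1\<close> for \<open>|x|\<^sup>2\<close> below \<open>1 / \<delta>\<close> and to a multiple of \<open>weight s x\<close> beyond: a regularization of
  the constant weight \<open>1\<close> against which weighted square integrable functions can be integrated.\<close>

definition damping :: "real \<Rightarrow> real \<Rightarrow> real^3 \<Rightarrow> real" where
  "damping s \<delta> x = (1 + \<delta> * (norm x)\<^sup>2) powr (- s)"

text \<open>Up to the term with \<open>w\<close>, which is small with \<open>\<delta>\<close>, the right hand side is at least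
  \<open>(1 - s) / 4 + s ((1/2 - a)\<^sup>2 + (1 - s) a\<^sup>2)\<close>; half of the first summand pays for \<open>w\<close>.\<close>

lemma hardy_coefficient_bound:
  fixes s \<delta> a w \<theta> :: real
  assumes s: "0 \<le> s" "s < 1" and \<delta>: "0 \<le> \<delta>" "\<delta> \<le> (1 - s) / 4"
    and a: "0 \<le> a" "a \<le> 1" and w: "w = - s * \<delta> * (1 - a)" and \<theta>: "0 \<le> \<theta>" "\<theta> \<le> 1"
  shows "(1 - s) / 8 \<le> 3 * (3/2 - s * a) - 2 * s * a * (1 - a) - 2 * (s * a) * (3/2 - s * a)
      - \<theta> * (2 * (1 - s * a + w)\<^sup>2 + (3/2 - s * a)\<^sup>2)"
proof -
  have sa: "s * a \<le> 1" using mult_mono[of s 1 a 1] s a by simp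
  have w0: "w \<le> 0" using s \<delta> a by (simp add: w)
  have "s * \<delta> * (1 - a) \<le> 1 * \<delta> * 1"
    using s \<delta> a by (intro mult_mono) auto
  then have wabs: "\<bar>w\<bar> \<le> (1 - s) / 4" using w0 \<delta> by (simp add: w)
  have "w\<^sup>2 \<le> ((1 - s) / 4)\<^sup>2"
    using power_mono[OF wabs, of 2] by simp
  also have "\<dots> \<le> (1 - s) / 16"
    using mult_left_mono[of "1 - s" 1 "1 - s"] s by (simp add: power2_eq_square)
  finally have w2: "2 * w\<^sup>2 \<le> (1 - s) / 8" by simp
  define u b where "u = 1 - s * a" and "b = 3/2 - s * a"
  have "u * w \<le> 0" using sa w0 by (intro mult_nonneg_nonpos) (auto simp: u_def)
  then have uw: "(u + w)\<^sup>2 \<le> u\<^sup>2 + w\<^sup>2" by (simp add: power2_sum)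
  have "\<theta> * (2 * (u + w)\<^sup>2 + b\<^sup>2) \<le> 1 * (2 * (u + w)\<^sup>2 + b\<^sup>2)"
    using \<theta> by (intro mult_right_mono) auto
  also have "\<dots> \<le> 2 * u\<^sup>2 + 2 * w\<^sup>2 + b\<^sup>2" using uw by simp
  finally have \<theta>': "\<theta> * (2 * (u + w)\<^sup>2 + b\<^sup>2) \<le> 2 * u\<^sup>2 + 2 * w\<^sup>2 + b\<^sup>2" .
  have "0 \<le> s * ((1/2 - a)\<^sup>2 + (1 - s) * a\<^sup>2)" using s by simp
  then have "0 \<le> s / 4 - s * a + s * (2 - s) * a\<^sup>2"
    by (simp add: power2_eq_square algebra_simps)
  moreover have "3 * b - 2 * s * a * (1 - a) - 2 * (s * a) * b - 2 * u\<^sup>2 - b\<^sup>2 = (1 - s) / 4 + (s / 4 - s * a + s * (2 - s) * a\<^sup>2)"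
    by (simp add: u_def b_def power2_eq_square field_simps)
  ultimately show ?thesis
    using \<theta>' w2 unfolding u_def b_def by linarith
qed

text \<open>For the pure power \<open>H = q powr \<tau>\<close> the optimal choice in the radial inequality is \<open>B = (\<tau> + 1/2) H / q\<close>.
  Here \<open>H = (1 + q) (1 + \<delta> q) powr (- s)\<close> has the local exponent \<open>\<tau> = 1 - s a\<close> with \<open>a = \<delta> q / (1 + \<delta> q)\<close>
  at large \<open>q\<close>, which leads to \<open>B = (3/2 - s a) W\<close>. The exponent varies slowly enough with \<open>q\<close> for the
  derivative of \<open>a\<close> to be harmless, and the constant does not depend on \<open>\<delta>\<close>.\<close>

lemma damped_hardy_inequality:
  assumes s: "0 \<le> s" "s < 1" and \<delta>: "0 \<le> \<delta>" "\<delta> \<le> (1 - s) / 4" and v: "test_spinor v"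
  shows "(1 - s) / 8 * (LINT x|lborel. damping s \<delta> x * (norm (v x))\<^sup>2)
    \<le> (LINT x|lborel. (1 + (norm x)\<^sup>2) * damping s \<delta> x * (norm (weyl v x))\<^sup>2)"
proof -
  define W where "W q = (1 + \<delta> * q) powr (- s)" for q
  define W' where "W' q = - s * \<delta> * (1 + \<delta> * q) powr (- s - 1)" for q
  define A where "A q = \<delta> * q / (1 + \<delta> * q)" for q
  define A' where "A' q = \<delta> / (1 + \<delta> * q)\<^sup>2" for q
  define H where "H q = (1 + q) * W q" for q
  define H' where "H' q = W q + (1 + q) * W' q" for q
  define B where "B q = (3/2 - s * A q) * W q" for q
  define B' where "B' q = - s * A' q * W q + (3/2 - s * A q) * W' q" for q
  have pos: "1 + \<delta> * q > 0" if "q \<ge> 0" for q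
    using that \<delta> by (simp add: add_pos_nonneg)
  have Wpos: "W q > 0" if "q \<ge> 0" for q using pos[OF that] by (simp add: W_def)
  have dW: "(W has_real_derivative W' q) (at q)" if "q \<ge> 0" for q
    unfolding W_def[abs_def] W'_def using pos[OF that]
    by (auto intro!: derivative_eq_intros simp: powr_diff)
  have dA: "(A has_real_derivative A' q) (at q)" if "q \<ge> 0" for q
    unfolding A_def[abs_def] A'_def using pos[OF that]
    by (auto intro!: derivative_eq_intros simp: power2_eq_square field_simps)
  have dH: "(H has_real_derivative H' q) (at q)" if "q \<ge> 0" for q
    unfolding H_def[abs_def] H'_def by (auto intro!: derivative_eq_intros dW that)
  have dB: "(B has_real_derivative B' q) (at q)" if "q \<ge> 0" for q
    unfolding B_def[abs_def] B'_def by (auto intro!: derivative_eq_intros dW dA that)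
  have c: "continuous_on {0..} W" "continuous_on {0..} A"
    using dW dA by (auto intro!: continuous_at_imp_continuous_on DERIV_isCont)
  have nz: "\<forall>q\<in>{0..}. 1 + \<delta> * q \<noteq> 0" "\<forall>q\<in>{0..}. (1 + \<delta> * q)\<^sup>2 \<noteq> 0" using pos by force+
  have cW': "continuous_on {0..} W'"
    unfolding W'_def by (intro continuous_intros nz)
  have cA': "continuous_on {0..} A'"
    unfolding A'_def by (intro continuous_intros nz)
  have cH': "continuous_on {0..} H'"
    unfolding H'_def by (intro continuous_intros c cW')
  have cB': "continuous_on {0..} B'"
    unfolding B'_def by (intro continuous_intros c cW' cA')
  have Hpos: "H q > 0" if "q \<ge> 0" for q using Wpos[OF that] that by (simp add: H_def)
  have Z: "(1 - s) / 8 * W q \<le> 3 * B q + 2 * q * B' q - (2 * (H' q)\<^sup>2 + (B q)\<^sup>2) * q / H q" if q: "q \<ge> 0" for q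
  proof -
    define a w \<theta> where "a = A q" and "w = - s * \<delta> * (1 - a)" and "\<theta> = q / (1 + q)"
    note p = pos[OF q] and Wp = Wpos[OF q]
    have a1: "1 - a = 1 / (1 + \<delta> * q)" using p by (simp add: a_def A_def field_simps)
    have a01: "0 \<le> a" "a \<le> 1" using p q \<delta> by (auto simp: a_def A_def)
    have W': "W' q = W q * w"
      using p by (simp add: W'_def W_def w_def a1 powr_diff)
    have aq: "\<delta> * (1 - a) * q = a" by (simp add: a1) (simp add: a_def A_def)
    have A': "A' q * q = a * (1 - a)"
      unfolding a1 by (simp add: A'_def a_def A_def power2_eq_square)
    have wq: "q * w = - s * a" using aq by (simp add: w_def mult.commute mult.left_commute)
    have H1: "H' q = W q * (1 - s * a + w)"
    proof -
      have "H' q = W q * (1 + w + q * w)" by (simp add: H'_def W' algebra_simps)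
      then show ?thesis unfolding wq by (simp add: algebra_simps)
    qed
    have B1: "B q = W q * (3/2 - s * a)" by (simp add: B_def a_def)
    have B2: "q * B' q = W q * (- s * a * (1 - a) - s * a * (3/2 - s * a))"
    proof -
      have "q * B' q = W q * (- s * (A' q * q) + (3/2 - s * a) * (q * w))"
        by (simp add: B'_def W' a_def algebra_simps)
      then show ?thesis unfolding wq A' by (simp add: algebra_simps)
    qed
    have HB: "(2 * (H' q)\<^sup>2 + (B q)\<^sup>2) * q / H q = W q * (\<theta> * (2 * (1 - s * a + w)\<^sup>2 + (3/2 - s * a)\<^sup>2))"
    proof -
      have "(2 * (y * c)\<^sup>2 + (y * b)\<^sup>2) * q / ((1 + q) * y) = y * (q / (1 + q) * (2 * c\<^sup>2 + b\<^sup>2))"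
        if "y > 0" for y c b :: real
        using that q by (simp add: power_mult_distrib power2_eq_square[of y] divide_simps) (simp add: algebra_simps)
      then show ?thesis unfolding H1 B1 H_def \<theta>_def using Wp by blast
    qed
    have "3 * B q + 2 * q * B' q - (2 * (H' q)\<^sup>2 + (B q)\<^sup>2) * q / H q =
      W q * (3 * (3/2 - s * a) - 2 * s * a * (1 - a) - 2 * (s * a) * (3/2 - s * a)
      - \<theta> * (2 * (1 - s * a + w)\<^sup>2 + (3/2 - s * a)\<^sup>2))"
    proof -
      define X where "X = (2 * (H' q)\<^sup>2 + (B q)\<^sup>2) * q / H q"
      have "2 * q * B' q = 2 * (q * B' q)" by simp
      then show ?thesis
        using HB unfolding X_def[symmetric] by (simp only: B1 B2) (simp add: algebra_simps)
    qed
    moreover have "W q * ((1 - s) / 8) \<le> \<dots>"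
      using Wp q by (intro mult_left_mono hardy_coefficient_bound[OF s \<delta> a01 w_def]) (auto simp: \<theta>_def)
    ultimately show ?thesis by (simp add: mult.commute)
  qed
  note hardy = radial_hardy_inequality[OF dH Hpos cH' dB cB' v]
  have dmp: "damping s \<delta> x = W ((norm x)\<^sup>2)" for x by (simp add: damping_def W_def)
  obtain R where R: "\<And>x. norm x > R \<Longrightarrow> v x = 0" using test_spinor_support[OF v] by blast
  have i: "integrable lborel (\<lambda>x. (1 - s) / 8 * (damping s \<delta> x * (norm (v x))\<^sup>2))"
  proof (rule continuous_compact_support_square_integrable(1))
    show "continuous_on UNIV (\<lambda>x. (1 - s) / 8 * (damping s \<delta> x * (norm (v x))\<^sup>2))"
      unfolding dmp by (intro continuous_intros radial_continuous[OF c(1)] test_spinor_integrable(2)[OF v])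
    show "(1 - s) / 8 * (damping s \<delta> x * (norm (v x))\<^sup>2) = 0" if "norm x > R" for x using R[OF that] by simp
  qed
  have "(LINT x|lborel. (1 - s) / 8 * (damping s \<delta> x * (norm (v x))\<^sup>2)) \<le> (LINT x|lborel. H ((norm x)\<^sup>2) * (norm (weyl v x))\<^sup>2)"
  proof (rule order_trans[OF Bochner_Integration.integral_mono[OF i hardy(1)] hardy(2)])
    fix x :: "real^3"
    have "(1 - s) / 8 * (damping s \<delta> x * (norm (v x))\<^sup>2) = ((1 - s) / 8 * W ((norm x)\<^sup>2)) * (norm (v x))\<^sup>2"
      by (simp add: dmp)
    also have "\<dots> \<le> (3 * B ((norm x)\<^sup>2) + 2 * (norm x)\<^sup>2 * B' ((norm x)\<^sup>2) - (2 * (H' ((norm x)\<^sup>2))\<^sup>2 + (B ((norm x)\<^sup>2))\<^sup>2) * (norm x)\<^sup>2 / H ((norm x)\<^sup>2)) * (norm (v x))\<^sup>2"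
      by (rule mult_right_mono[OF Z]) auto
    finally show "(1 - s) / 8 * (damping s \<delta> x * (norm (v x))\<^sup>2) \<le> \<dots>" .
  qed
  then show ?thesis by (simp add: H_def dmp)
qed

section \<open>Square integrability of weighted solutions\<close>

lemma damping_pos: "\<delta> \<ge> 0 \<Longrightarrow> damping s \<delta> x > 0"
proof -
  assume "\<delta> \<ge> 0"
  then have "1 + \<delta> * (norm x)\<^sup>2 > 0" by (simp add: add_pos_nonneg)
  then show ?thesis by (simp add: damping_def)
qed

lemma damping_le_1: "\<delta> \<ge> 0 \<Longrightarrow> s \<ge> 0 \<Longrightarrow> damping s \<delta> x \<le> 1"
  using powr_mono2'[of "- s" 1 "1 + \<delta> * (norm x)\<^sup>2"] by (simp add: damping_def)

lemma damping_measurable: "damping s \<delta> \<in> borel_measurable borel"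
  unfolding damping_def by measurable

lemma damping_le_weight:
  assumes "0 < \<delta>" "\<delta> \<le> 1" "s \<ge> 0"
  shows "damping s \<delta> x \<le> \<delta> powr (- s) * weight s x"
proof -
  have q: "1 + (norm x)\<^sup>2 > 0" by (simp add: add_pos_nonneg)
  have "\<delta> * (1 + (norm x)\<^sup>2) \<le> 1 + \<delta> * (norm x)\<^sup>2" using assms by (simp add: distrib_left)
  then have "(1 + \<delta> * (norm x)\<^sup>2) powr (- s) \<le> (\<delta> * (1 + (norm x)\<^sup>2)) powr (- s)"
    using assms q by (intro powr_mono2') auto
  also have "\<dots> = \<delta> powr (- s) * weight s x"
    using assms q by (simp add: powr_mult weight_def)
  finally show ?thesis by (simp add: damping_def)
qed

lemma damping_tendsto_1:
  assumes "\<delta> \<longlonglongrightarrow> 0"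
  shows "(\<lambda>n. damping s (\<delta> n) x) \<longlonglongrightarrow> 1"
proof -
  have "(\<lambda>n. 1 + \<delta> n * (norm x)\<^sup>2) \<longlonglongrightarrow> 1 + 0 * (norm x)\<^sup>2"
    by (intro tendsto_intros assms)
  from tendsto_powr[OF this tendsto_const[of "- s"]] show ?thesis by (simp add: damping_def)
qed

lemma damped_hardy_inequality_weak:
  assumes s: "0 \<le> s" "s < 1" and \<delta>: "0 \<le> \<delta>" "\<delta> \<le> (1 - s) / 4"
    and w: "weak_weyl u g" and u: "square_integrable lborel u" and g: "square_integrable lborel g"
    and R: "\<And>x. norm x > R \<Longrightarrow> u x = 0" "\<And>x. norm x > R \<Longrightarrow> g x = 0"
  shows "(1 - s) / 8 * (LINT x|lborel. damping s \<delta> x * (norm (u x))\<^sup>2)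
    \<le> (LINT x|lborel. (1 + (norm x)\<^sup>2) * damping s \<delta> x * (norm (g x))\<^sup>2)"
proof -
  note a = weak_weyl_approximation[where R=R, OF w u g R(1)]
  have out: "weyl (mollify n u) x = 0" if "norm x > R + 1" for n x
    by (rule weyl_outside[where R="R + 1", OF a(2) that])
  define h :: "real^3 \<Rightarrow> real" where "h x = indicator (cball 0 (R + 1)) x * ((1 + (norm x)\<^sup>2) * damping s \<delta> x)" for x
  have h_eq: "h x * (norm (f x))\<^sup>2 = (1 + (norm x)\<^sup>2) * damping s \<delta> x * (norm (f x))\<^sup>2"
    if "\<And>x. norm x > R + 1 \<Longrightarrow> f x = 0" for f :: "real^3 \<Rightarrow> complex^2" and x
    using that[of x] by (cases "norm x > R + 1") (auto simp: h_def)
  have hm: "h \<in> borel_measurable lborel"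
    unfolding h_def using damping_measurable[of s \<delta>] by (intro borel_measurable_times borel_measurable_indicator) auto
  have hb: "\<bar>h x\<bar> \<le> 1 + (R + 1)\<^sup>2" for x
  proof (cases "norm x \<le> R + 1")
    case True
    then have "(norm x)\<^sup>2 \<le> (R + 1)\<^sup>2" by (intro power_mono) auto
    then have "(1 + (norm x)\<^sup>2) * damping s \<delta> x \<le> (1 + (R + 1)\<^sup>2) * 1"
      using damping_le_1[OF \<delta>(1) s(1), of x] damping_pos[OF \<delta>(1), of s x] by (intro mult_mono) auto
    then show ?thesis using True damping_pos[OF \<delta>(1), of s x] by (simp add: h_def abs_mult)
  qed (simp add: h_def)
  have "(\<lambda>n. (1 - s) / 8 * (LINT x|lborel. damping s \<delta> x * (norm (mollify n u x))\<^sup>2))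
      \<longlonglongrightarrow> (1 - s) / 8 * (LINT x|lborel. damping s \<delta> x * (norm (u x))\<^sup>2)"
  proof (intro tendsto_mult tendsto_const mean_square_convergent_weighted[where K=1, OF mollify_mean_square_le(1)[OF u] u a(3)])
    show "damping s \<delta> \<in> borel_measurable lborel" using damping_measurable by simp
    show "\<bar>damping s \<delta> x\<bar> \<le> 1" for x
      using damping_pos[OF \<delta>(1), of s x] damping_le_1[OF \<delta>(1) s(1), of x] by simp
  qed
  moreover have "(\<lambda>n. LINT x|lborel. h x * (norm (weyl (mollify n u) x))\<^sup>2) \<longlonglongrightarrow> (LINT x|lborel. h x * (norm (g x))\<^sup>2)"
    by (rule mean_square_convergent_weighted[OF a(5) g a(4) hm hb])
  moreover have "(1 - s) / 8 * (LINT x|lborel. damping s \<delta> x * (norm (mollify n u x))\<^sup>2)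
      \<le> (LINT x|lborel. h x * (norm (weyl (mollify n u) x))\<^sup>2)" for n
  proof -
    have "h x * (norm (weyl (mollify n u) x))\<^sup>2 = (1 + (norm x)\<^sup>2) * damping s \<delta> x * (norm (weyl (mollify n u) x))\<^sup>2" for x
      by (rule h_eq) (rule out)
    then show ?thesis by (simp only: damped_hardy_inequality[OF s \<delta> a(1)])
  qed
  ultimately have "(1 - s) / 8 * (LINT x|lborel. damping s \<delta> x * (norm (u x))\<^sup>2) \<le> (LINT x|lborel. h x * (norm (g x))\<^sup>2)"
    by (intro LIMSEQ_le) auto
  moreover have "g x = 0" if "norm x > R + 1" for x using R(2)[of x] that by simp
  ultimately show ?thesis by (simp only: h_eq[of g])
qed

text \<open>The commutator is negligible at infinity: with \<open>|x| \<le> R\<close> on its support, the factors \<open>1 + |x|\<^sup>2\<close> and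
  \<open>(|x| / R\<^sup>2)\<^sup>2\<close> have a bounded product that tends to \<open>0\<close> pointwise, while the damping supplies the
  integrable majorant.\<close>

lemma cutoff_commutator_tendsto_0:
  assumes w: "weighted_square_integrable s w" and s: "0 \<le> s" and \<delta>: "0 < \<delta>" "\<delta> \<le> 1"
  shows "integrable lborel (\<lambda>x. (1 + (norm x)\<^sup>2) * damping s \<delta> x * (norm (weyl_cutoff (real n + 1) x (w x)))\<^sup>2)"
    and "(\<lambda>n. LINT x|lborel. (1 + (norm x)\<^sup>2) * damping s \<delta> x * (norm (weyl_cutoff (real n + 1) x (w x)))\<^sup>2) \<longlonglongrightarrow> 0"
proof -
  let ?f = "\<lambda>n x. (1 + (norm x)\<^sup>2) * damping s \<delta> x * (norm (weyl_cutoff (real n + 1) x (w x)))\<^sup>2"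
  let ?g = "\<lambda>x. 2 * 72\<^sup>2 * \<delta> powr (- s) * (weight s x * (norm (w x))\<^sup>2)"
  have wm: "w \<in> borel_measurable borel" using w by (simp add: weighted_square_integrable_def)
  have "(\<lambda>x. weyl_cutoff (real n + 1) x (w x)) \<in> borel_measurable borel" for n
    by (rule weyl_cutoff_measurable[OF _ wm]) simp
  then have fm: "?f n \<in> borel_measurable lborel" for n
    using damping_measurable[of s \<delta>] by measurable
  have gi: "integrable lborel ?g" using w by (simp add: weighted_square_integrable_def)
  have base: "?f n x \<le> (1 + (norm x)\<^sup>2) * damping s \<delta> x * (72\<^sup>2 * ((norm x)\<^sup>2 / (real n + 1)^4) * (norm (w x))\<^sup>2)" for n x
  proof (intro mult_left_mono)
    have "(norm (weyl_cutoff (real n + 1) x (w x)))\<^sup>2 \<le> (72 * (norm x / (real n + 1)\<^sup>2) * norm (w x))\<^sup>2"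
      by (intro power_mono norm_weyl_cutoff_le) auto
    then show "(norm (weyl_cutoff (real n + 1) x (w x)))\<^sup>2 \<le> 72\<^sup>2 * ((norm x)\<^sup>2 / (real n + 1)^4) * (norm (w x))\<^sup>2"
      by (simp add: power_mult_distrib power_divide flip: power_mult)
    show "0 \<le> (1 + (norm x)\<^sup>2) * damping s \<delta> x" using damping_pos[of \<delta> s x] \<delta> by simp
  qed
  have f0: "?f n x \<ge> 0" for n x using damping_pos[of \<delta> s x] \<delta> by simp
  have fg: "?f n x \<le> ?g x" for n x
  proof (cases "norm x \<ge> real n + 1")
    case True
    then have "weyl_cutoff (real n + 1) x (w x) = 0" by (intro weyl_cutoff_outside) auto
    then show ?thesis using weight_pos[of s x] by simp
  next
    case False
    define r where "r = (real n + 1)\<^sup>2"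
    have r: "r \<ge> 1" "(norm x)\<^sup>2 \<le> r"
      using False by (auto simp: r_def intro!: power_mono)
    have r4: "(real n + 1)^4 = r * r" by (simp add: r_def power2_eq_square power4_eq_xxxx)
    have "(1 + (norm x)\<^sup>2) * (norm x)\<^sup>2 \<le> (2 * r) * r"
      using r by (intro mult_mono) auto
    then have k: "(1 + (norm x)\<^sup>2) * ((norm x)\<^sup>2 / (real n + 1)^4) \<le> 2"
      using r unfolding r4 by (simp add: divide_simps)
    have "(1 + (norm x)\<^sup>2) * damping s \<delta> x * (72\<^sup>2 * ((norm x)\<^sup>2 / (real n + 1)^4) * (norm (w x))\<^sup>2)
      = ((1 + (norm x)\<^sup>2) * ((norm x)\<^sup>2 / (real n + 1)^4)) * (72\<^sup>2 * (norm (w x))\<^sup>2 * damping s \<delta> x)"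
      by (simp only: mult_ac)
    also have "\<dots> \<le> 2 * (72\<^sup>2 * (norm (w x))\<^sup>2 * (\<delta> powr (- s) * weight s x))"
      using k damping_le_weight[OF \<delta> s, of x] damping_pos[of \<delta> s x] \<delta> by (intro mult_mono) auto
    also have "\<dots> = ?g x" by (simp only: mult_ac)
    finally show ?thesis using base[of x n] by linarith
  qed
  show "integrable lborel (?f n)" for n
  proof (rule Bochner_Integration.integrable_bound[OF gi fm], intro always_eventually allI)
    show "norm (?f n x) \<le> norm (?g x)" for x unfolding real_norm_def
      using fg[of x n] f0[of x n] by linarith
  qed
  have "(\<lambda>n. LINT x|lborel. ?f n x) \<longlonglongrightarrow> (LINT x|(lborel :: (real^3) measure). 0)"
  proof (rule integral_dominated_convergence[where w="?g"])
    show "AE x in lborel. (\<lambda>n. ?f n x) \<longlonglongrightarrow> 0"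
    proof (intro always_eventually allI)
      fix x :: "real^3"
      let ?K = "(1 + (norm x)\<^sup>2) * damping s \<delta> x * (72\<^sup>2 * (norm x)\<^sup>2 * (norm (w x))\<^sup>2)"
      have "(\<lambda>n. 1 / (real n + 1)) \<longlonglongrightarrow> 0"
        by (rule tendsto_inverse_real_plus_1)
      from tendsto_mult[OF tendsto_const[of ?K] tendsto_power[OF this, of 4]]
      have "(\<lambda>n. ?K * (1 / (real n + 1))^4) \<longlonglongrightarrow> 0" by simp
      moreover have "norm (?f n x) \<le> ?K * (1 / (real n + 1))^4" for n
        using base[of x n] f0[of x n] by (simp add: power_divide)
      ultimately show "(\<lambda>n. ?f n x) \<longlonglongrightarrow> 0"
        by (rule Lim_null_comparison[OF always_eventually[OF allI], rotated])
    qed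
    show "AE x in lborel. norm (?f n x) \<le> ?g x" for n
      using fg f0 by (intro always_eventually) auto
  qed (use fm gi in simp_all)
  then show "(\<lambda>n. LINT x|lborel. ?f n x) \<longlonglongrightarrow> 0" by simp
qed

text \<open>The damped Hardy inequality is applied to the solution cut off at radius \<open>n + 1\<close>. Its right hand side
  consists of the potential term, where \<open>(1 + |x|\<^sup>2) |P w|\<^sup>2\<close> is dominated by the given weighted norm of \<open>w\<close>
  thanks to \<open>s \<le> \<rho> - 1\<close>, and of the commutator, which disappears as \<open>n\<close> grows. The resulting bound is
  independent of \<open>\<delta>\<close>, and Fatou's lemma for \<open>\<delta> \<rightarrow> 0\<close> removes the damping.\<close>

lemma (in weyl_potential) weighted_solution_square_integrable:
  assumes w: "weak_weyl w (\<lambda>x. P x (w x))" "weighted_square_integrable s w"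
    and s: "0 \<le> s" "s < 1" "s \<le> \<rho> - 1"
  shows "square_integrable lborel w"
proof -
  define I where "I = (LINT x|lborel. weight s x * (norm (w x))\<^sup>2)"
  have wm: "w \<in> borel_measurable borel" using w(2) by (simp add: weighted_square_integrable_def)
  have wi: "integrable lborel (\<lambda>x. weight s x * (norm (w x))\<^sup>2)" using w(2) by (simp add: weighted_square_integrable_def)
  have I0: "I \<ge> 0" unfolding I_def
    by (intro integral_nonneg_AE always_eventually allI mult_nonneg_nonneg less_imp_le[OF weight_pos]) simp
  note wl = weighted_loc_square_integrable[OF w(2) s(1)]
  note pl = loc_square_integrable_potential[OF wl]
  have P_le: "(1 + (norm x)\<^sup>2) * (norm (P x (w x)))\<^sup>2 \<le> C * (weight s x * (norm (w x))\<^sup>2)" for x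
  proof -
    have q: "1 + (norm x)\<^sup>2 \<ge> 1" by simp
    have "(1 + (norm x)\<^sup>2) * weight \<rho> x = (1 + (norm x)\<^sup>2) powr (1 - \<rho>)"
      using q by (simp add: weight_def powr_diff powr_minus divide_inverse)
    also have "\<dots> \<le> weight s x"
      unfolding weight_def using s q by (intro powr_mono) auto
    finally have *: "(1 + (norm x)\<^sup>2) * weight \<rho> x \<le> weight s x" .
    have "(1 + (norm x)\<^sup>2) * (norm (P x (w x)))\<^sup>2 \<le> (1 + (norm x)\<^sup>2) * (C * weight \<rho> x * (norm (w x))\<^sup>2)"
      by (intro mult_left_mono decay) simp
    also have "\<dots> = C * (((1 + (norm x)\<^sup>2) * weight \<rho> x) * (norm (w x))\<^sup>2)" by (simp only: mult_ac)
    also have "\<dots> \<le> C * (weight s x * (norm (w x))\<^sup>2)"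
      using * C by (intro mult_left_mono mult_right_mono) auto
    finally show ?thesis .
  qed
  \<comment> \<open>the reciprocal of the Hardy constant, times the potential term, plus \<open>2\<close> for the commutator once it is below \<open>1\<close>\<close>
  define M where "M = 8 / (1 - s) * (2 * C * I + 2)"
  have M0: "M \<ge> 0" using s C I0 by (simp add: M_def)
  have damped: "integrable lborel (\<lambda>x. damping s \<delta> x * (norm (w x))\<^sup>2) \<and> (LINT x|lborel. damping s \<delta> x * (norm (w x))\<^sup>2) \<le> M"
    if \<delta>: "0 < \<delta>" "\<delta> \<le> (1 - s) / 4" for \<delta>
  proof -
    have \<delta>1: "\<delta> \<le> 1" using \<delta> s by simp
    note d0 = damping_pos[of \<delta> s] and d1 = damping_le_1[of \<delta> s]
    note comm = cutoff_commutator_tendsto_0[OF w(2) s(1) \<delta>(1) \<delta>1]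
    obtain n0 where n0: "\<And>n. n \<ge> n0 \<Longrightarrow> (LINT x|lborel. (1 + (norm x)\<^sup>2) * damping s \<delta> x * (norm (weyl_cutoff (real n + 1) x (w x)))\<^sup>2) < 1"
      using order_tendstoD(2)[OF comm(2), of 1] unfolding eventually_sequentially by auto
    let ?f = "\<lambda>n x. damping s \<delta> x * (norm (cutoff (real n + 1) x *\<^sub>R w x))\<^sup>2"
    have fi: "integrable lborel (?f n)" for n
    proof (rule Bochner_Integration.integrable_bound)
      have sq: "square_integrable lborel (\<lambda>x. cutoff (real n + 1) x *\<^sub>R w x)"
        by (intro cutoff_square_integrable wl) simp
      then show "integrable lborel (\<lambda>x. (norm (cutoff (real n + 1) x *\<^sub>R w x))\<^sup>2)"
        by (simp add: square_integrable_def)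
      from sq have "(\<lambda>x. cutoff (real n + 1) x *\<^sub>R w x) \<in> borel_measurable lborel" by (simp only: square_integrable_def)
      then show "?f n \<in> borel_measurable lborel" using damping_measurable[of s \<delta>] by measurable
      show "AE x in lborel. norm (?f n x) \<le> norm ((norm (cutoff (real n + 1) x *\<^sub>R w x))\<^sup>2)"
      proof (intro always_eventually allI)
        fix x
        have "?f n x \<le> 1 * (norm (cutoff (real n + 1) x *\<^sub>R w x))\<^sup>2"
          using d1[of x] \<delta> s by (intro mult_right_mono) auto
        then show "norm (?f n x) \<le> norm ((norm (cutoff (real n + 1) x *\<^sub>R w x))\<^sup>2)"
          using d0[of x] \<delta> by (simp add: abs_mult)
      qed
    qed
    have f_le: "(LINT x|lborel. ?f n x) \<le> M" if n: "n \<ge> n0" for n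
    proof -
      let ?R = "real n + 1"
      have R: "?R > 0" by simp
      let ?G = "\<lambda>x. cutoff ?R x *\<^sub>R P x (w x) + weyl_cutoff ?R x (w x)"
      note cut = weak_weyl_cutoff[OF w(1) wl pl R]
      have "(1 - s) / 8 * (LINT x|lborel. ?f n x) \<le> (LINT x|lborel. (1 + (norm x)\<^sup>2) * damping s \<delta> x * (norm (?G x))\<^sup>2)"
        by (rule damped_hardy_inequality_weak[OF s(1,2) less_imp_le[OF \<delta>(1)] \<delta>(2) cut(1) cutoff_square_integrable(1)[OF R wl] cut(2), where R="?R"])
          (simp_all add: cutoff_outside weyl_cutoff_outside)
      also have "\<dots> \<le> (LINT x|lborel. 2 * C * (weight s x * (norm (w x))\<^sup>2)
          + 2 * ((1 + (norm x)\<^sup>2) * damping s \<delta> x * (norm (weyl_cutoff ?R x (w x)))\<^sup>2))"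
      proof (rule integral_mono')
        show "integrable lborel (\<lambda>x. 2 * C * (weight s x * (norm (w x))\<^sup>2)
          + 2 * ((1 + (norm x)\<^sup>2) * damping s \<delta> x * (norm (weyl_cutoff ?R x (w x)))\<^sup>2))"
          by (intro Bochner_Integration.integrable_add integrable_mult_right wi comm(1))
        fix x
        define k where "k = (1 + (norm x)\<^sup>2) * damping s \<delta> x"
        have k: "0 \<le> k" "k \<le> 1 + (norm x)\<^sup>2"
          using d0[of x] d1[of x] \<delta> s by (auto simp: k_def intro!: mult_left_le)
        have "(norm (cutoff ?R x *\<^sub>R P x (w x)))\<^sup>2 \<le> (norm (P x (w x)))\<^sup>2"
          using cutoff_nonneg[of ?R x] cutoff_le_1[of ?R x] by (intro power_mono) (auto intro!: mult_left_le_one_le)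
        then have "k * (norm (cutoff ?R x *\<^sub>R P x (w x)))\<^sup>2 \<le> (1 + (norm x)\<^sup>2) * (norm (P x (w x)))\<^sup>2"
          using k by (intro mult_mono) auto
        also have "\<dots> \<le> C * (weight s x * (norm (w x))\<^sup>2)" by (rule P_le)
        finally have 1: "k * (norm (cutoff ?R x *\<^sub>R P x (w x)))\<^sup>2 \<le> C * (weight s x * (norm (w x))\<^sup>2)" .
        have "k * (norm (?G x))\<^sup>2 \<le> k * (2 * (norm (cutoff ?R x *\<^sub>R P x (w x)))\<^sup>2 + 2 * (norm (weyl_cutoff ?R x (w x)))\<^sup>2)"
          using k by (intro mult_left_mono norm_add_sq_le) auto
        also have "\<dots> \<le> 2 * C * (weight s x * (norm (w x))\<^sup>2) + 2 * (k * (norm (weyl_cutoff ?R x (w x)))\<^sup>2)"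
          using 1 by (simp add: distrib_left)
        finally show "(1 + (norm x)\<^sup>2) * damping s \<delta> x * (norm (?G x))\<^sup>2 \<le> 2 * C * (weight s x * (norm (w x))\<^sup>2)
          + 2 * ((1 + (norm x)\<^sup>2) * damping s \<delta> x * (norm (weyl_cutoff ?R x (w x)))\<^sup>2)"
          by (simp add: k_def)
        show "0 \<le> 2 * C * (weight s x * (norm (w x))\<^sup>2) + 2 * ((1 + (norm x)\<^sup>2) * damping s \<delta> x * (norm (weyl_cutoff ?R x (w x)))\<^sup>2)"
          using C weight_pos[of s x] d0[of x] \<delta> by (intro add_nonneg_nonneg mult_nonneg_nonneg) auto
      qed
      also have "\<dots> = 2 * C * I + 2 * (LINT x|lborel. (1 + (norm x)\<^sup>2) * damping s \<delta> x * (norm (weyl_cutoff ?R x (w x)))\<^sup>2)"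
        unfolding I_def
        by (simp only: Bochner_Integration.integral_add[OF integrable_mult_right[OF wi] integrable_mult_right[OF comm(1)]]
            integral_mult_right_zero)
      also have "\<dots> \<le> 2 * C * I + 2" using n0[OF n] by simp
      finally have "8 / (1 - s) * ((1 - s) / 8 * (LINT x|lborel. ?f n x)) \<le> M"
        unfolding M_def using s by (intro mult_left_mono) auto
      then show ?thesis using s by simp
    qed
    have lim: "AE x in lborel. (\<lambda>n. ?f n x) \<longlonglongrightarrow> damping s \<delta> x * (norm (w x))\<^sup>2"
    proof (intro always_eventually allI)
      fix x
      have "(\<lambda>n. ?f n x) \<longlonglongrightarrow> damping s \<delta> x * (norm (1 *\<^sub>R w x))\<^sup>2"
        by (intro tendsto_intros cutoff_tendsto_1)
      then show "(\<lambda>n. ?f n x) \<longlonglongrightarrow> damping s \<delta> x * (norm (w x))\<^sup>2" by simp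
    qed
    have m: "(\<lambda>x. damping s \<delta> x * (norm (w x))\<^sup>2) \<in> borel_measurable lborel"
      using damping_measurable[of s \<delta>] wm by measurable
    have nn: "?f n x \<ge> 0" "damping s \<delta> x * (norm (w x))\<^sup>2 \<ge> 0" for n x
      using d0[of x] \<delta> by simp_all
    show ?thesis
      using integrable_limit_of_bounded_integrals[where f="?f" and N=n0 and K=M, OF fi nn(1) f_le m lim nn(2) M0] by blast
  qed
  \<comment> \<open>starts at the largest value that the damped Hardy inequality admits\<close>
  define \<delta> where "\<delta> n = (1 - s) / 4 * (1 / (real n + 1))" for n
  have \<delta>: "0 < \<delta> n" "\<delta> n \<le> (1 - s) / 4" for n
    using s mult_left_mono[of "1 / (real n + 1)" 1 "(1 - s) / 4"] by (simp_all add: \<delta>_def)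
  have "(\<lambda>n. 1 / (real n + 1)) \<longlonglongrightarrow> 0"
    by (rule tendsto_inverse_real_plus_1)
  from tendsto_mult[OF tendsto_const[of "(1 - s) / 4"] this] have \<delta>0: "\<delta> \<longlonglongrightarrow> 0"
    by (simp add: \<delta>_def[abs_def])
  have lim: "AE x in lborel. (\<lambda>n. damping s (\<delta> n) x * (norm (w x))\<^sup>2) \<longlonglongrightarrow> (norm (w x))\<^sup>2"
  proof (intro always_eventually allI)
    fix x
    have "(\<lambda>n. damping s (\<delta> n) x * (norm (w x))\<^sup>2) \<longlonglongrightarrow> 1 * (norm (w x))\<^sup>2"
      by (intro tendsto_intros damping_tendsto_1 \<delta>0)
    then show "(\<lambda>n. damping s (\<delta> n) x * (norm (w x))\<^sup>2) \<longlonglongrightarrow> (norm (w x))\<^sup>2" by simp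
  qed
  have nn: "damping s (\<delta> n) x * (norm (w x))\<^sup>2 \<ge> 0" for n x
    using damping_pos[of "\<delta> n" s x] \<delta>(1)[of n] by simp
  have m: "(\<lambda>x. (norm (w x))\<^sup>2) \<in> borel_measurable lborel" using wm by measurable
  have "integrable lborel (\<lambda>x. (norm (w x))\<^sup>2)"
    using integrable_limit_of_bounded_integrals(1)[where f="\<lambda>n x. damping s (\<delta> n) x * (norm (w x))\<^sup>2" and N=0 and K=M,
        OF conjunct1[OF damped[OF \<delta>]] nn conjunct2[OF damped[OF \<delta>]] m lim _ M0] by simp
  then show ?thesis using wm by (simp add: square_integrable_def)
qed

section \<open>The gradient of a weak solution\<close>

lemma square_integrable_loc_square_integrable:
  fixes u :: "'a::euclidean_space \<Rightarrow> 'b::euclidean_space"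
  assumes "square_integrable lborel u"
  shows "loc_square_integrable u"
  unfolding loc_square_integrable_def
proof (intro conjI allI)
  show um: "u \<in> borel_measurable borel" using assms by (simp add: square_integrable_def)
  show "square_integrable lborel (\<lambda>x. indicator (cball 0 R) x *\<^sub>R u x)" for R
  proof (rule square_integrable_bound[OF assms])
    show "(\<lambda>x. indicator (cball 0 R) x *\<^sub>R u x) \<in> borel_measurable lborel"
      using um by (intro borel_measurable_scaleR borel_measurable_indicator) simp_all
    show "norm (indicator (cball 0 R) x *\<^sub>R u x) \<le> 1 * norm (u x)" for x
      by (simp add: indicator_def)
  qed
qed

lemma cutoff_mean_square_tendsto_0:
  fixes u :: "real^3 \<Rightarrow> complex^2"
  assumes u: "square_integrable lborel u"
  shows "(\<lambda>n. mean_square lborel (\<lambda>x. cutoff (real n + 1) x *\<^sub>R u x - u x)) \<longlonglongrightarrow> 0"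
proof -
  have um: "u \<in> borel_measurable borel" using u by (simp add: square_integrable_def)
  have "(\<lambda>n. LINT x|lborel. (norm (cutoff (real n + 1) x *\<^sub>R u x - u x))\<^sup>2) \<longlonglongrightarrow> (LINT x|(lborel :: (real^3) measure). 0)"
  proof (rule integral_dominated_convergence[where w="\<lambda>x. (norm (u x))\<^sup>2"])
    show "integrable lborel (\<lambda>x. (norm (u x))\<^sup>2)" using u by (simp add: square_integrable_def)
    show "(\<lambda>x. (norm (cutoff (real n + 1) x *\<^sub>R u x - u x))\<^sup>2) \<in> borel_measurable lborel" for n
    proof -
      have "cutoff (real n + 1) \<in> borel_measurable borel"
        by (intro borel_measurable_continuous_onI cutoff_continuous) simp
      then show ?thesis using um by measurable
    qed
    show "AE x in lborel. (\<lambda>n. (norm (cutoff (real n + 1) x *\<^sub>R u x - u x))\<^sup>2) \<longlonglongrightarrow> 0"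
    proof (intro always_eventually allI)
      fix x
      have "(\<lambda>n. (norm (cutoff (real n + 1) x *\<^sub>R u x - u x))\<^sup>2) \<longlonglongrightarrow> (norm (1 *\<^sub>R u x - u x))\<^sup>2"
        by (intro tendsto_intros cutoff_tendsto_1)
      then show "(\<lambda>n. (norm (cutoff (real n + 1) x *\<^sub>R u x - u x))\<^sup>2) \<longlonglongrightarrow> 0" by simp
    qed
    show "AE x in lborel. norm ((norm (cutoff (real n + 1) x *\<^sub>R u x - u x))\<^sup>2) \<le> (norm (u x))\<^sup>2" for n
    proof (intro always_eventually allI)
      fix x
      have "cutoff (real n + 1) x *\<^sub>R u x - u x = (cutoff (real n + 1) x - 1) *\<^sub>R u x"
        by (simp add: scaleR_diff_left)
      then have "norm (cutoff (real n + 1) x *\<^sub>R u x - u x) = \<bar>cutoff (real n + 1) x - 1\<bar> * norm (u x)" by simp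
      also have "\<dots> \<le> 1 * norm (u x)"
        using cutoff_nonneg[of "real n + 1" x] cutoff_le_1[of "real n + 1" x] by (intro mult_right_mono) auto
      finally show "norm ((norm (cutoff (real n + 1) x *\<^sub>R u x - u x))\<^sup>2) \<le> (norm (u x))\<^sup>2"
        by (simp add: power_mono)
    qed
  qed simp
  then show ?thesis by (simp add: mean_square_def)
qed

lemma weyl_cutoff_mean_square_tendsto_0:
  assumes u: "square_integrable lborel u"
  shows "(\<lambda>n. mean_square lborel (\<lambda>x. weyl_cutoff (real n + 1) x (u x))) \<longlonglongrightarrow> 0"
proof (rule Lim_null_comparison[OF always_eventually])
  show "(\<lambda>n. (72 * (1 / (real n + 1)))\<^sup>2 * mean_square lborel u) \<longlonglongrightarrow> 0"
    using tendsto_mult[OF tendsto_power[OF tendsto_mult[OF tendsto_const[of 72] tendsto_inverse_real_plus_1], of 2] tendsto_const[of "mean_square lborel u"]]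
    by simp
  show "\<forall>n. norm (mean_square lborel (\<lambda>x. weyl_cutoff (real n + 1) x (u x))) \<le> (72 * (1 / (real n + 1)))\<^sup>2 * mean_square lborel u"
  proof
    fix n
    let ?c = "72 * (1 / (real n + 1))"
    have "mean_square lborel (\<lambda>x. weyl_cutoff (real n + 1) x (u x)) \<le> mean_square lborel (\<lambda>x. ?c *\<^sub>R u x)"
    proof (rule mean_square_mono)
      have um: "u \<in> borel_measurable borel" using u by (simp add: square_integrable_def)
      show "(\<lambda>x. weyl_cutoff (real n + 1) x (u x)) \<in> borel_measurable lborel"
        using weyl_cutoff_measurable[OF _ um, of "real n + 1"] by simp
      show "square_integrable lborel (\<lambda>x. ?c *\<^sub>R u x)"
        by (rule square_integrable_bound[OF u, of _ "?c"]) (use um in simp_all)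
      show "norm (weyl_cutoff (real n + 1) x (u x)) \<le> norm (?c *\<^sub>R u x)" for x
        using norm_weyl_cutoff_le_inverse[of "real n + 1" x "u x"] by simp
    qed
    also have "\<dots> = ?c\<^sup>2 * mean_square lborel u"
      by (simp only: mean_square_def norm_scaleR power_mult_distrib integral_mult_right_zero power2_abs)
    finally show "norm (mean_square lborel (\<lambda>x. weyl_cutoff (real n + 1) x (u x))) \<le> ?c\<^sup>2 * mean_square lborel u"
      by simp
  qed
qed

lemma mean_square_triangle:
  assumes "square_integrable M u" "square_integrable M v" "square_integrable M w"
  shows "mean_square M (\<lambda>x. u x - w x) \<le> 2 * mean_square M (\<lambda>x. u x - v x) + 2 * mean_square M (\<lambda>x. v x - w x)"
  using square_integrable_add(2)[OF square_integrable_diff(1)[OF assms(1,2)] square_integrable_diff(1)[OF assms(2,3)]]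
  by simp

lemma weak_weyl_test_spinor_approximation:
  assumes w: "weak_weyl u g" and u: "square_integrable lborel u" and g: "square_integrable lborel g" and e: "e > 0"
  shows "\<exists>v. test_spinor v \<and> mean_square lborel (\<lambda>x. v x - u x) < e \<and> mean_square lborel (\<lambda>x. weyl v x - g x) < e"
proof -
  note ul = square_integrable_loc_square_integrable[OF u] and gl = square_integrable_loc_square_integrable[OF g]
  let ?U = "\<lambda>n x. cutoff (real n + 1) x *\<^sub>R u x"
  let ?G = "\<lambda>n x. cutoff (real n + 1) x *\<^sub>R g x + weyl_cutoff (real n + 1) x (u x)"
  have U: "square_integrable lborel (?U n)" for n by (intro cutoff_square_integrable ul) simp
  have cg: "square_integrable lborel (\<lambda>x. cutoff (real n + 1) x *\<^sub>R g x)" for n by (intro cutoff_square_integrable gl) simp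
  have cu: "square_integrable lborel (\<lambda>x. weyl_cutoff (real n + 1) x (u x))" for n by (intro cutoff_square_integrable ul) simp
  have G: "square_integrable lborel (?G n)" for n by (intro square_integrable_add cg cu)
  \<comment> \<open>errors from cutting off enter four times into the image, those from mollifying twice\<close>
  have e4: "e / 16 > 0" using e by simp
  obtain n where n: "mean_square lborel (\<lambda>x. ?U n x - u x) < e / 16"
    "mean_square lborel (\<lambda>x. cutoff (real n + 1) x *\<^sub>R g x - g x) < e / 16"
    "mean_square lborel (\<lambda>x. weyl_cutoff (real n + 1) x (u x)) < e / 16"
    using eventually_conj[OF order_tendstoD(2)[OF cutoff_mean_square_tendsto_0[OF u] e4]
      eventually_conj[OF order_tendstoD(2)[OF cutoff_mean_square_tendsto_0[OF g] e4]
        order_tendstoD(2)[OF weyl_cutoff_mean_square_tendsto_0[OF u] e4]]]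
    unfolding eventually_sequentially by blast
  have Gg: "mean_square lborel (\<lambda>x. ?G n x - g x) < e / 4"
  proof -
    have "mean_square lborel (\<lambda>x. ?G n x - g x) = mean_square lborel (\<lambda>x. (cutoff (real n + 1) x *\<^sub>R g x - g x) + weyl_cutoff (real n + 1) x (u x))"
      by (simp add: algebra_simps)
    also have "\<dots> \<le> 2 * mean_square lborel (\<lambda>x. cutoff (real n + 1) x *\<^sub>R g x - g x) + 2 * mean_square lborel (\<lambda>x. weyl_cutoff (real n + 1) x (u x))"
      by (intro square_integrable_add square_integrable_diff cg cu g)
    finally show ?thesis using n by linarith
  qed
  have R: "real n + 1 > 0" by simp
  have out: "?U n x = 0" if "norm x > real n + 1" for x
    using cutoff_outside[OF R, of x] that by simp
  note a = weak_weyl_approximation[where R="real n + 1", OF weak_weyl_cutoff(1)[OF w ul gl R] U G out]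
  obtain m where m: "mean_square lborel (\<lambda>x. mollify m (?U n) x - ?U n x) < e / 16"
    "mean_square lborel (\<lambda>x. weyl (mollify m (?U n)) x - ?G n x) < e / 16"
    using eventually_conj[OF order_tendstoD(2)[OF a(3) e4] order_tendstoD(2)[OF a(4) e4]]
    unfolding eventually_sequentially by blast
  have "mean_square lborel (\<lambda>x. mollify m (?U n) x - u x) < e"
    using mean_square_triangle[OF mollify_mean_square_le(1)[OF U] U u, of m n n] m n e by linarith
  moreover have "mean_square lborel (\<lambda>x. weyl (mollify m (?U n)) x - g x) < e"
    using mean_square_triangle[OF a(5) G g, of m n] m Gg e by linarith
  ultimately show ?thesis using a(1)[of m] by blast
qed

lemma test_spinor_diff:
  assumes "test_spinor v" "test_spinor w"
  shows "test_spinor (\<lambda>x. v x - w x)"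
    and "spinor_partial k (\<lambda>x. v x - w x) x = spinor_partial k v x - spinor_partial k w x"
    and "weyl (\<lambda>x. v x - w x) x = weyl v x - weyl w x"
proof -
  have neg: "(\<lambda>x. w x $ c * (- 1)) \<in> test_functions" for c
    using assms(2) by (intro test_function_mult_const) (simp add: test_spinor_def)
  have p: "partial k (\<lambda>x. v x $ c - w x $ c) x = partial k (\<lambda>x. v x $ c) x - partial k (\<lambda>x. w x $ c) x" for c k
  proof -
    have dw: "(\<lambda>x. w x $ c) differentiable (at x)" and dv: "(\<lambda>x. v x $ c) differentiable (at x)" for x
      using assms by (auto simp: test_spinor_def intro: test_function_differentiable)
    have "partial k (\<lambda>x. w x $ c * (- 1)) x = - partial k (\<lambda>x. w x $ c) x"
      by (subst partial_mult[OF dw]) auto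
    then show ?thesis
      using partial_add[where j=k and x=x, OF dv test_function_differentiable[OF neg]] by simp
  qed
  show "test_spinor (\<lambda>x. v x - w x)"
    unfolding test_spinor_def
  proof
    fix c
    have "(\<lambda>x. v x $ c) \<in> test_functions" using assms(1) by (simp add: test_spinor_def)
    from test_function_add[OF this neg] show "(\<lambda>x. (v x - w x) $ c) \<in> test_functions" by simp
  qed
  show sp: "spinor_partial k (\<lambda>x. v x - w x) x = spinor_partial k v x - spinor_partial k w x" for k
    by (simp add: spinor_partial_def vec_eq_iff p)
  show "weyl (\<lambda>x. v x - w x) x = weyl v x - weyl w x"
    by (simp add: weyl_def sp matrix_vector_mult_diff_distrib sum_subtractf)
qed

text \<open>By the energy identity the gradients of smooth approximants form a Cauchy sequence; its limit is
  the weak gradient.\<close>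

lemma weak_weyl_gradient:
  assumes w: "weak_weyl u g" and u: "square_integrable lborel u" and g: "square_integrable lborel g"
  shows "\<exists>d. square_integrable lborel d \<and> (\<forall>c. \<forall>\<psi>\<in>test_functions.
     (LINT x|lborel. u x $ c * partial k \<psi> x) = - (LINT x|lborel. d x $ c * \<psi> x))"
proof -
  have "\<exists>v. test_spinor v \<and> mean_square lborel (\<lambda>x. v x - u x) < 1 / (real n + 1) \<and> mean_square lborel (\<lambda>x. weyl v x - g x) < 1 / (real n + 1)" for n
    by (rule weak_weyl_test_spinor_approximation[OF w u g]) simp
  from choice[OF allI, OF this] obtain v where v0: "\<forall>n. test_spinor (v n) \<and>
    mean_square lborel (\<lambda>x. v n x - u x) < 1 / (real n + 1) \<and> mean_square lborel (\<lambda>x. weyl (v n) x - g x) < 1 / (real n + 1)" ..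
  then have v: "\<And>n. test_spinor (v n)" "\<And>n. mean_square lborel (\<lambda>x. v n x - u x) < 1 / (real n + 1)"
    "\<And>n. mean_square lborel (\<lambda>x. weyl (v n) x - g x) < 1 / (real n + 1)" by simp_all
  note sv = test_spinor_integrable(1)[OF v(1)] and sp = test_spinor_integrable(1)[OF test_spinor_partial[OF v(1)]]
    and sw = weyl_square_integrable[OF v(1)]
  have cauchy: "mean_square lborel (\<lambda>x. spinor_partial k (v m) x - spinor_partial k (v n) x) < 2 * (1 / (real m + 1)) + 2 * (1 / (real n + 1))" for m n
  proof -
    have "mean_square lborel (\<lambda>x. spinor_partial k (v m) x - spinor_partial k (v n) x)
        = (LINT x|lborel. (norm (spinor_partial k (\<lambda>x. v m x - v n x) x))\<^sup>2)"
      by (simp add: mean_square_def test_spinor_diff(2)[OF v(1) v(1)])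
    also have "\<dots> \<le> (\<Sum>k\<in>UNIV. LINT x|lborel. (norm (spinor_partial k (\<lambda>x. v m x - v n x) x))\<^sup>2)"
      by (rule member_le_sum) auto
    also have "\<dots> = mean_square lborel (\<lambda>x. weyl (v m) x - weyl (v n) x)"
      by (simp add: weyl_energy[OF test_spinor_diff(1)[OF v(1) v(1)], symmetric] mean_square_def test_spinor_diff(3)[OF v(1) v(1)])
    also have "\<dots> \<le> 2 * mean_square lborel (\<lambda>x. weyl (v m) x - g x) + 2 * mean_square lborel (\<lambda>x. g x - weyl (v n) x)"
      by (rule mean_square_triangle[OF sw g sw])
    also have "mean_square lborel (\<lambda>x. g x - weyl (v n) x) = mean_square lborel (\<lambda>x. weyl (v n) x - g x)"
      by (simp add: mean_square_def norm_minus_commute)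
    finally show ?thesis using v(3)[of m] v(3)[of n] by linarith
  qed
  obtain d where d: "square_integrable lborel d" "(\<lambda>n. mean_square lborel (\<lambda>x. spinor_partial k (v n) x - d x)) \<longlonglongrightarrow> 0"
  proof (rule mean_square_complete[of lborel "\<lambda>n. spinor_partial k (v n)"])
    show "square_integrable lborel (spinor_partial k (v n))" for n by (rule sp)
    fix e :: real assume "e > 0"
    then have "e / 4 > 0" by simp
    from order_tendstoD(2)[OF tendsto_inverse_real_plus_1 this]
    obtain N where N: "\<And>n. n \<ge> N \<Longrightarrow> 1 / (real n + 1) < e / 4" unfolding eventually_sequentially by blast
    have "mean_square lborel (\<lambda>x. spinor_partial k (v m) x - spinor_partial k (v n) x) < e" if "m \<ge> N" "n \<ge> N" for m n
      using cauchy[of m n] N[OF that(1)] N[OF that(2)] by linarith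
    then show "\<exists>N. \<forall>m\<ge>N. \<forall>n\<ge>N. mean_square lborel (\<lambda>x. spinor_partial k (v m) x - spinor_partial k (v n) x) < e" by blast
  qed
  have vu: "(\<lambda>n. mean_square lborel (\<lambda>x. v n x - u x)) \<longlonglongrightarrow> 0"
    by (rule Lim_null_comparison[OF always_eventually tendsto_inverse_real_plus_1]) (simp add: less_imp_le[OF v(2)])
  have "(LINT x|lborel. u x $ c * partial k \<psi> x) = - (LINT x|lborel. d x $ c * \<psi> x)" if \<psi>: "\<psi> \<in> test_functions" for c \<psi>
  proof -
    have tsq: "square_integrable lborel \<phi>" if \<phi>: "\<phi> \<in> test_functions" for \<phi>
    proof -
      obtain R where R: "\<And>z. norm z > R \<Longrightarrow> \<phi> z = 0" using test_function_support[OF \<phi>] by blast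
      show ?thesis by (rule continuous_compact_support_square_integrable(2)[OF test_function_continuous[OF \<phi>] R])
    qed
    have B: "bounded_bilinear (\<lambda>(a :: complex^2) z. a $ c * z)"
      by (rule bounded_bilinear.comp1[OF bounded_bilinear_mult bounded_linear_vec_nth])
    have vc: "(\<lambda>x. v n x $ c) \<in> test_functions" for n using v(1)[of n] by (simp add: test_spinor_def)
    have parts: "(LINT x|lborel. v n x $ c * partial k \<psi> x) = - (LINT x|lborel. spinor_partial k (v n) x $ c * \<psi> x)" for n
    proof -
      note prod = test_function_mult[OF vc[of n] \<psi>]
      obtain R where R: "\<And>z. norm z > R \<Longrightarrow> v n z $ c * \<psi> z = 0" using test_function_support[OF prod] by blast
      have "(LINT x|lborel. partial k (\<lambda>x. v n x $ c * \<psi> x) x) = 0"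
        by (rule integral_partial_eq_0[OF test_function_differentiable[OF prod] test_function_continuous[OF test_function_partial[OF prod]] R])
      then have "(LINT x|lborel. spinor_partial k (v n) x $ c * \<psi> x + v n x $ c * partial k \<psi> x) = 0"
        by (simp add: partial_mult[OF test_function_differentiable[OF vc] test_function_differentiable[OF \<psi>]] spinor_partial_def)
      then show ?thesis
        using square_integrable_bilinear[OF sp tsq[OF \<psi>] B, of k n] square_integrable_bilinear[OF sv tsq[OF test_function_partial[OF \<psi>]] B, of n k]
        by (simp add: add_eq_0_iff)
    qed
    have 1: "(\<lambda>n. LINT x|lborel. v n x $ c * partial k \<psi> x) \<longlonglongrightarrow> (LINT x|lborel. u x $ c * partial k \<psi> x)"
      by (rule mean_square_convergent_bilinear[OF sv u tsq[OF test_function_partial[OF \<psi>]] vu B])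
    have 2: "(\<lambda>n. LINT x|lborel. spinor_partial k (v n) x $ c * \<psi> x) \<longlonglongrightarrow> (LINT x|lborel. d x $ c * \<psi> x)"
      by (rule mean_square_convergent_bilinear[OF sp d(1) tsq[OF \<psi>] d(2) B])
    show ?thesis
      by (rule LIMSEQ_unique[OF 1]) (simp only: parts tendsto_minus[OF 2])
  qed
  then show ?thesis using d(1) by blast
qed

lemma borel_measurable_vec:
  fixes f :: "'a \<Rightarrow> 'b::euclidean_space^'n"
  assumes "\<And>k. (\<lambda>x. f x $ k) \<in> borel_measurable M"
  shows "f \<in> borel_measurable M"
proof (subst borel_measurable_euclidean_space, intro ballI)
  fix i :: "'b^'n" assume "i \<in> Basis"
  then obtain k b where i: "i = axis k b" by (auto simp: Basis_vec_def)
  have "(\<lambda>x. f x $ k \<bullet> b) \<in> borel_measurable M" using assms[of k] by measurable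
  then show "(\<lambda>x. f x \<bullet> i) \<in> borel_measurable M" by (simp add: i inner_axis)
qed

section \<open>Borel representatives\<close>

text \<open>All analysis is done with Borel functions, so that Fubini's theorem is available on the product of
  two copies of \<open>lborel\<close>.\<close>

lemma borel_representative:
  fixes f :: "'a::euclidean_space \<Rightarrow> 'b::euclidean_space"
  assumes "f \<in> borel_measurable lebesgue"
  obtains F where "F \<in> borel_measurable borel" "AE x in lborel. f x = F x"
proof -
  have "\<exists>g\<in>borel_measurable borel. AE x in lborel. f x \<bullet> i = g x" for i
  proof -
    have "(\<lambda>x. f x \<bullet> i) \<in> borel_measurable lebesgue" using assms by measurable
    from completion_ex_borel_measurable_real[OF this] show ?thesis by simp
  qed
  then obtain g where g: "\<And>i. g i \<in> borel_measurable borel" "\<And>i. AE x in lborel. f x \<bullet> i = g i x" by metis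
  have "AE x in lborel. \<forall>i\<in>Basis. f x \<bullet> i = g i x"
    using g(2) by (intro AE_finite_allI) auto
  then have "AE x in lborel. f x = (\<Sum>i\<in>Basis. g i x *\<^sub>R i)"
  proof eventually_elim
    case (elim x)
    then have "(\<Sum>i\<in>Basis. g i x *\<^sub>R i) = (\<Sum>i\<in>Basis. (f x \<bullet> i) *\<^sub>R i)"
      by (intro sum.cong) auto
    then show ?case by (simp add: euclidean_representation)
  qed
  moreover have "(\<lambda>x. \<Sum>i\<in>Basis. g i x *\<^sub>R i) \<in> borel_measurable borel" using g(1) by measurable
  ultimately show ?thesis using that by blast
qed

lemma lebesgue_borel_representative:
  fixes g G :: "'a::euclidean_space \<Rightarrow> 'b::euclidean_space"
  assumes G: "G \<in> borel_measurable borel" and AE: "AE x in lborel. g x = G x"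
  shows "g \<in> borel_measurable lebesgue" "integral\<^sup>L lebesgue g = integral\<^sup>L lborel G"
    "integrable lebesgue g \<longleftrightarrow> integrable lborel G"
proof -
  have G': "G \<in> borel_measurable lebesgue" using G by (simp add: measurable_completion)
  have AE': "AE x in lebesgue. g x = G x" using AE by (rule AE_completion)
  then have "AE x in lebesgue. G x = g x" by eventually_elim simp
  then show g: "g \<in> borel_measurable lebesgue" by (rule borel_measurable_AE[OF G'])
  show "integral\<^sup>L lebesgue g = integral\<^sup>L lborel G"
    using integral_cong_AE[OF g G' AE'] G by (simp add: integral_completion)
  show "integrable lebesgue g \<longleftrightarrow> integrable lborel G"
    using integrable_cong_AE[OF g G' AE'] G by (simp add: integrable_completion)
qed

section \<open>Pairs of coupled Weyl equations\<close>

definition has_square_integrable_gradient :: "(real^3 \<Rightarrow> complex^2) \<Rightarrow> bool" where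
  "has_square_integrable_gradient u \<longleftrightarrow> (\<forall>k. \<exists>d. square_integrable lborel d \<and> (\<forall>c. \<forall>\<psi>\<in>test_functions.
     (LINT x|lborel. u x $ c * partial k \<psi> x) = - (LINT x|lborel. d x $ c * \<psi> x)))"

lemma weak_weyl_cong_AE:
  assumes w: "weak_weyl u g" and g: "loc_integrable g" and h: "loc_integrable h" and AE: "AE x in lborel. g x = h x"
  shows "weak_weyl u h"
  unfolding weak_weyl_def
proof
  fix \<psi> assume \<psi>: "\<psi> \<in> test_functions"
  have "(LINT x|lborel. \<psi> x *s g x) = (LINT x|lborel. \<psi> x *s h x)"
  proof (rule integral_cong_AE)
    show "(\<lambda>x. \<psi> x *s g x) \<in> borel_measurable lborel" "(\<lambda>x. \<psi> x *s h x) \<in> borel_measurable lborel"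
      using test_function_integrable[OF \<psi> g] test_function_integrable[OF \<psi> h] by (simp_all add: borel_measurable_integrable)
    show "AE x in lborel. \<psi> x *s g x = \<psi> x *s h x" using AE by eventually_elim simp
  qed
  then show "(LINT x|lborel. (\<Sum>j\<in>UNIV. pauli j *v (partial j \<psi> x *s u x))) = - (LINT x|lborel. \<psi> x *s h x)"
    using w \<psi> by (simp add: weak_weyl_def)
qed

lemma weak_weyl_scalar:
  assumes "weak_weyl u g"
  shows "weak_weyl (\<lambda>x. c *s u x) (\<lambda>x. c *s g x)"
  unfolding weak_weyl_def
proof
  fix \<psi> assume \<psi>: "\<psi> \<in> test_functions"
  then have \<psi>c: "(\<lambda>x. \<psi> x * c) \<in> test_functions" by (rule test_function_mult_const)
  have p: "partial j (\<lambda>x. \<psi> x * c) x = partial j \<psi> x * c" for j x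
    by (subst partial_mult[OF test_function_differentiable[OF \<psi>]]) auto
  show "(LINT x|lborel. (\<Sum>j\<in>UNIV. pauli j *v (partial j \<psi> x *s (c *s u x)))) = - (LINT x|lborel. \<psi> x *s (c *s g x))"
    using bspec[OF assms[unfolded weak_weyl_def] \<psi>c] by (simp add: p vector_smult_assoc)
qed

context weyl_potential
begin

lemma square_integrable_potential:
  assumes "square_integrable lborel u"
  shows "square_integrable lborel (\<lambda>x. P x (u x))"
  by (rule square_integrable_bound[OF assms _ norm_potential_le])
    (use assms measurable in \<open>simp add: square_integrable_def\<close>)

lemma solution_pair:
  assumes u: "weak_weyl u (\<lambda>x. P x (u x))" "weighted_square_integrable s u"
    and w: "weak_weyl w (\<lambda>x. P x (w x) + \<kappa> *\<^sub>R u x)" "weighted_square_integrable s w"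
    and \<kappa>: "\<kappa> \<noteq> 0" and s: "0 \<le> s" "s < 1" "s \<le> \<rho> - 1"
  shows "AE x in lborel. u x = 0"
    and "square_integrable lborel u" "has_square_integrable_gradient u"
    and "square_integrable lborel w" "has_square_integrable_gradient w"
proof -
  note ul = weighted_loc_square_integrable[OF u(2) s(1)] and wl = weighted_loc_square_integrable[OF w(2) s(1)]
  show u0: "AE x in lborel. u x = 0"
    by (rule companion_component_zero[OF u(1) ul w \<kappa> s(1,2)])
  show us: "square_integrable lborel u"
    by (rule weighted_solution_square_integrable[OF u s])
  show "has_square_integrable_gradient u"
    unfolding has_square_integrable_gradient_def
    using weak_weyl_gradient[OF u(1) us square_integrable_potential[OF us]] by blast
  have um: "(\<lambda>x. \<kappa> *\<^sub>R u x) \<in> borel_measurable borel"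
    using us by (intro borel_measurable_scaleR borel_measurable_const) (simp add: square_integrable_def)
  have "loc_square_integrable (\<lambda>x. \<kappa> *\<^sub>R u x)"
    by (rule loc_square_integrable_bound[where c="\<bar>\<kappa>\<bar>", OF ul um]) simp
  then have g: "loc_integrable (\<lambda>x. P x (w x) + \<kappa> *\<^sub>R u x)"
    by (intro loc_square_integrable_loc_integrable loc_square_integrable_add loc_square_integrable_potential wl)
  have h: "loc_integrable (\<lambda>x. P x (w x))"
    by (intro loc_square_integrable_loc_integrable loc_square_integrable_potential wl)
  have "AE x in lborel. P x (w x) + \<kappa> *\<^sub>R u x = P x (w x)"
    using u0 by eventually_elim simp
  from weak_weyl_cong_AE[OF w(1) g h this] have w': "weak_weyl w (\<lambda>x. P x (w x))" .
  show ws: "square_integrable lborel w"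
    by (rule weighted_solution_square_integrable[OF w' w(2) s])
  show "has_square_integrable_gradient w"
    unfolding has_square_integrable_gradient_def
    using weak_weyl_gradient[OF w' ws square_integrable_potential[OF ws]] by blast
qed

end

section \<open>The Dirac operator in spinor components\<close>

definition upper :: "complex^4 \<Rightarrow> complex^2" where "upper V = vector [V $ 1, V $ 2]"
definition lower :: "complex^4 \<Rightarrow> complex^2" where "lower V = vector [V $ 3, V $ 4]"

lemma vector_4_nth:
  "(vector [a, b, c, d] :: 'a::zero^4) $ 1 = a" "(vector [a, b, c, d] :: 'a::zero^4) $ 2 = b"
  "(vector [a, b, c, d] :: 'a::zero^4) $ 3 = c" "(vector [a, b, c, d] :: 'a::zero^4) $ 4 = d"
  by (simp_all add: vector_def)

lemma upper_lower_linear: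
  "bounded_linear upper" "bounded_linear lower"
  by (auto simp: linear_conv_bounded_linear[symmetric] upper_def lower_def vec_eq_iff forall_2 intro!: linearI)

lemma upper_lower_scalar: "upper (c *s V) = c *s upper V" "lower (c *s V) = c *s lower V"
  by (simp_all add: upper_def lower_def vec_eq_iff forall_2)

lemma upper_lower_dirac_alpha:
  "upper (dirac_alpha j *v V) = pauli j *v lower V" "lower (dirac_alpha j *v V) = pauli j *v upper V"
  by (simp_all add: upper_def lower_def dirac_alpha_def block_def vec_eq_iff forall_2 sum_2 sum_4
      matrix_vector_mult_def vector_4_nth)

lemma upper_lower_dirac_beta:
  "upper (dirac_beta *v V) = upper V" "lower (dirac_beta *v V) = - lower V"
  by (simp_all add: upper_def lower_def dirac_beta_def block_def vec_eq_iff forall_2 sum_2 sum_4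
      matrix_vector_mult_def vector_4_nth mat_def)

text \<open>Multiplication by \<open>\<i> \<sigma> . a\<close>, the form in which the magnetic term appears next to the Weyl operator.\<close>

definition weyl_magnetic :: "(real^3 \<Rightarrow> real^3) \<Rightarrow> real^3 \<Rightarrow> complex^2 \<Rightarrow> complex^2" where
  "weyl_magnetic a x v = (\<Sum>j\<in>UNIV. complex_of_real (a x $ j) *s (\<i> *s (pauli j *v v)))"

lemma imaginary_unit_skew: "(\<i> *s (a :: complex^2)) \<bullet> b = - (a \<bullet> (\<i> *s b))"
  by (simp add: inner_vec_def sum_2 inner_complex_def)

lemma weyl_magnetic_potential:
  assumes a: "a \<in> borel_measurable borel" and bound: "\<And>j x. \<bar>a x $ j\<bar> \<le> K * (1 + (norm x)\<^sup>2) powr (- \<rho> / 2)"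
    and K: "K \<ge> 0" and \<rho>: "\<rho> \<ge> 0"
  shows "weyl_potential (weyl_magnetic a) (9 * K\<^sup>2) \<rho>"
proof
  fix x :: "real^3" and v w :: "complex^2"
  have "(complex_of_real r *s (\<i> *s (pauli j *v v))) \<bullet> w = - (v \<bullet> (complex_of_real r *s (\<i> *s (pauli j *v w))))" for r j
    by (simp only: vector_scalar_mult_of_real inner_scaleR_left inner_scaleR_right imaginary_unit_skew
        pauli_selfadjoint pauli_scalar mult_minus_right)
  then show "weyl_magnetic a x v \<bullet> w = - (v \<bullet> weyl_magnetic a x w)"
    by (simp add: weyl_magnetic_def inner_sum_left inner_sum_right sum_negf)
next
  fix x :: "real^3" and v :: "complex^2"
  let ?b = "(1 + (norm x)\<^sup>2) powr (- \<rho> / 2)"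
  have "norm (weyl_magnetic a x v) \<le> (\<Sum>j\<in>(UNIV::3 set). K * ?b * norm v)"
    unfolding weyl_magnetic_def
  proof (rule sum_norm_le)
    show "norm (complex_of_real (a x $ j) *s (\<i> *s (pauli j *v v))) \<le> K * ?b * norm v" for j
      using mult_right_mono[OF bound[of x j] norm_ge_zero[of v]] by (simp add: norm_vector_scalar_mult norm_pauli norm_mult)
  qed
  then have "norm (weyl_magnetic a x v) \<le> 3 * K * ?b * norm v" by simp
  then have "(norm (weyl_magnetic a x v))\<^sup>2 \<le> (3 * K * ?b * norm v)\<^sup>2" by (intro power_mono) auto
  also have "\<dots> = 9 * K\<^sup>2 * (?b * ?b) * (norm v)\<^sup>2" by (simp add: power_mult_distrib power2_eq_square)
  also have "?b * ?b = weight \<rho> x" by (simp add: weight_def powr_add[symmetric])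
  finally show "(norm (weyl_magnetic a x v))\<^sup>2 \<le> 9 * K\<^sup>2 * weight \<rho> x * (norm v)\<^sup>2" .
next
  fix u :: "real^3 \<Rightarrow> complex^2" assume u: "u \<in> borel_measurable borel"
  have "(\<lambda>x. pauli j *v u x) \<in> borel_measurable borel" for j
    by (rule borel_measurable_bounded_linear[OF pauli_bounded_linear u])
  then have p: "(\<lambda>x. \<i> *s (pauli j *v u x)) \<in> borel_measurable borel" for j
    by (intro borel_measurable_bounded_bilinear[OF bounded_bilinear_vector_scalar_mult]) auto
  have aj: "(\<lambda>x. a x $ j) \<in> borel_measurable borel" for j
    by (rule borel_measurable_bounded_linear[OF bounded_linear_vec_nth a])
  show "(\<lambda>x. weyl_magnetic a x (u x)) \<in> borel_measurable borel"
    unfolding weyl_magnetic_def vector_scalar_mult_of_real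
    by (intro borel_measurable_sum borel_measurable_scaleR aj p)
qed (use K \<rho> in auto)

text \<open>The matrices \<open>\<alpha>\<close> exchange the two halves of a spinor while \<open>\<beta>\<close> preserves them, so the equations for
  the two halves arise from one computation with the projections interchanged. At \<open>\<mu> = m\<close> and at
  \<open>\<mu> = - m\<close> one of the two couplings vanishes.\<close>

lemma dirac_eigenvalue_equation_components:
  fixes F :: "real^3 \<Rightarrow> complex^4" and m \<mu> :: real
  assumes F: "loc_integrable F" and aF: "\<And>j. loc_integrable (\<lambda>x. complex_of_real (a x $ j) *s F x)"
    and eq: "\<And>\<psi>. \<psi> \<in> test_functions \<Longrightarrow>
      (\<Sum>j\<in>UNIV. dirac_alpha j *v ((1 / \<i>) *s (- (LINT x|lborel. partial j \<psi> x *s F x))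
        - (LINT x|lborel. \<psi> x *s (complex_of_real (a x $ j) *s F x))))
      + complex_of_real m *s (dirac_beta *v (LINT x|lborel. \<psi> x *s F x)) = complex_of_real \<mu> *s (LINT x|lborel. \<psi> x *s F x)"
  shows "weak_weyl (\<lambda>x. lower (F x)) (\<lambda>x. weyl_magnetic a x (lower (F x)) + (\<i> * of_real (\<mu> - m)) *s upper (F x))"
    and "weak_weyl (\<lambda>x. upper (F x)) (\<lambda>x. weyl_magnetic a x (upper (F x)) + (\<i> * of_real (\<mu> + m)) *s lower (F x))"
proof -
  have unit: "(1 / \<i>) *s (- V) = \<i> *s V" for V :: "complex^'n"
    by (simp add: vec_eq_iff)
  have generic: "weak_weyl (\<lambda>x. p (F x)) (\<lambda>x. weyl_magnetic a x (p (F x)) + (\<i> * c) *s q (F x))"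
    if p: "bounded_linear p" "\<And>c V. p (c *s V) = c *s p V" and q: "bounded_linear q" "\<And>c V. q (c *s V) = c *s q V"
      and alpha: "\<And>j V. q (dirac_alpha j *v V) = pauli j *v p V"
      and rest: "\<And>V. of_real \<mu> *s q V - of_real m *s q (dirac_beta *v V) = c *s q V"
    for p q :: "complex^4 \<Rightarrow> complex^2" and c
    unfolding weak_weyl_def
  proof
    fix \<psi> assume \<psi>: "\<psi> \<in> test_functions"
    interpret p: bounded_linear p by fact
    interpret q: bounded_linear q by fact
    let ?I = "LINT x|lborel. \<psi> x *s F x" and ?D = "\<lambda>j. LINT x|lborel. partial j \<psi> x *s F x"
      and ?A = "\<lambda>j. LINT x|lborel. \<psi> x *s (complex_of_real (a x $ j) *s F x)"
    note iF = test_function_integrable[OF \<psi> F] and iD = test_function_integrable[OF test_function_partial[OF \<psi>] F]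
      and iA = test_function_integrable[OF \<psi> aF]
    have "q (\<Sum>j\<in>UNIV. dirac_alpha j *v (\<i> *s ?D j - ?A j)) + of_real m *s q (dirac_beta *v ?I) = of_real \<mu> *s q ?I"
      using arg_cong[OF eq[OF \<psi>], of q] by (simp add: unit q.add q(2))
    then have "q (\<Sum>j\<in>UNIV. dirac_alpha j *v (\<i> *s ?D j - ?A j)) = c *s q ?I"
      using rest[of ?I] by (simp add: algebra_simps)
    moreover have "q (\<Sum>j\<in>UNIV. dirac_alpha j *v (\<i> *s D j - A j)) =
        (\<Sum>j\<in>UNIV. \<i> *s (pauli j *v p (D j))) - (\<Sum>j\<in>UNIV. pauli j *v p (A j))" for D A :: "3 \<Rightarrow> complex^4"
      by (simp only: q.sum q.diff alpha p.diff p(2) matrix_vector_mult_diff_distrib pauli_scalar sum_subtractf)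
    ultimately have main: "(\<Sum>j\<in>UNIV. \<i> *s (pauli j *v p (?D j))) - (\<Sum>j\<in>UNIV. pauli j *v p (?A j)) = c *s q ?I"
      by (simp only:)
    have D: "(LINT x|lborel. (\<Sum>j\<in>UNIV. pauli j *v (partial j \<psi> x *s p (F x)))) = (\<Sum>j\<in>UNIV. pauli j *v p (?D j))"
    proof -
      have bl: "bounded_linear (\<lambda>V. pauli j *v p V)" for j
        by (rule bounded_linear_compose[OF pauli_bounded_linear p(1)])
      have "(LINT x|lborel. (\<Sum>j\<in>UNIV. pauli j *v p (partial j \<psi> x *s F x))) = (\<Sum>j\<in>UNIV. LINT x|lborel. pauli j *v p (partial j \<psi> x *s F x))"
        by (intro Bochner_Integration.integral_sum integrable_bounded_linear[OF bl] iD)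
      also have "\<dots> = (\<Sum>j\<in>UNIV. pauli j *v p (?D j))"
        by (intro sum.cong refl integral_bounded_linear[OF bl] iD)
      finally show ?thesis by (simp add: p(2))
    qed
    have A: "(LINT x|lborel. \<psi> x *s (weyl_magnetic a x (p (F x)) + (\<i> * c) *s q (F x))) =
        (\<Sum>j\<in>UNIV. \<i> *s (pauli j *v p (?A j))) + (\<i> * c) *s q ?I"
    proof -
      have bl: "bounded_linear (\<lambda>V. \<i> *s (pauli j *v p V))" for j
        by (intro bounded_linear_compose[OF bounded_bilinear.bounded_linear_right[OF bounded_bilinear_vector_scalar_mult]]
            bounded_linear_compose[OF pauli_bounded_linear p(1)])
      have bl': "bounded_linear (\<lambda>V. (\<i> * c) *s q V)"
        by (rule bounded_linear_compose[OF bounded_bilinear.bounded_linear_right[OF bounded_bilinear_vector_scalar_mult] q(1)])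
      have e: "\<psi> x *s (weyl_magnetic a x (p (F x)) + (\<i> * c) *s q (F x)) =
          (\<Sum>j\<in>UNIV. \<i> *s (pauli j *v p (\<psi> x *s (complex_of_real (a x $ j) *s F x)))) + (\<i> * c) *s q (\<psi> x *s F x)" for x
        by (simp add: weyl_magnetic_def p(2) q(2) pauli_scalar vec_eq_iff sum_distrib_left algebra_simps)
      have "(LINT x|lborel. \<psi> x *s (weyl_magnetic a x (p (F x)) + (\<i> * c) *s q (F x))) =
         (LINT x|lborel. (\<Sum>j\<in>UNIV. \<i> *s (pauli j *v p (\<psi> x *s (complex_of_real (a x $ j) *s F x))))) + (LINT x|lborel. (\<i> * c) *s q (\<psi> x *s F x))"
        unfolding e
        by (intro Bochner_Integration.integral_add Bochner_Integration.integrable_sum integrable_bounded_linear[OF bl] integrable_bounded_linear[OF bl'] iA iF)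
      also have "(LINT x|lborel. (\<Sum>j\<in>UNIV. \<i> *s (pauli j *v p (\<psi> x *s (complex_of_real (a x $ j) *s F x))))) =
          (\<Sum>j\<in>UNIV. LINT x|lborel. \<i> *s (pauli j *v p (\<psi> x *s (complex_of_real (a x $ j) *s F x))))"
        by (intro Bochner_Integration.integral_sum integrable_bounded_linear[OF bl] iA)
      also have "\<dots> = (\<Sum>j\<in>UNIV. \<i> *s (pauli j *v p (?A j)))"
        by (intro sum.cong refl integral_bounded_linear[OF bl] iA)
      also have "(LINT x|lborel. (\<i> * c) *s q (\<psi> x *s F x)) = (\<i> * c) *s q ?I"
        by (rule integral_bounded_linear[OF bl' iF])
      finally show ?thesis .
    qed
    have "X = - ((\<Sum>j\<in>UNIV. \<i> *s Y j) + (\<i> * c) *s Z)"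
      if "\<i> *s X - (\<Sum>j\<in>UNIV. Y j) = c *s Z" for X Z :: "complex^2" and Y :: "3 \<Rightarrow> complex^2"
    proof -
      have "(- \<i>) *s (\<i> *s X) = (- \<i>) *s ((\<Sum>j\<in>UNIV. Y j) + c *s Z)"
        using that by (simp add: algebra_simps)
      then show ?thesis
        by (simp add: vec_eq_iff sum_3 algebra_simps)
    qed
    moreover have "(\<Sum>j\<in>UNIV. \<i> *s (pauli j *v p (?D j))) = \<i> *s (\<Sum>j\<in>UNIV. pauli j *v p (?D j))"
      by (simp add: vec_eq_iff sum_3 algebra_simps)
    ultimately show "(LINT x|lborel. (\<Sum>j\<in>UNIV. pauli j *v (partial j \<psi> x *s p (F x)))) =
        - (LINT x|lborel. \<psi> x *s (weyl_magnetic a x (p (F x)) + (\<i> * c) *s q (F x)))"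
      unfolding D A using main by simp
  qed
  show "weak_weyl (\<lambda>x. lower (F x)) (\<lambda>x. weyl_magnetic a x (lower (F x)) + (\<i> * of_real (\<mu> - m)) *s upper (F x))"
    by (rule generic[OF upper_lower_linear(2) upper_lower_scalar(2) upper_lower_linear(1) upper_lower_scalar(1) upper_lower_dirac_alpha(1)])
      (simp add: upper_lower_dirac_beta vec_eq_iff algebra_simps)
  show "weak_weyl (\<lambda>x. upper (F x)) (\<lambda>x. weyl_magnetic a x (upper (F x)) + (\<i> * of_real (\<mu> + m)) *s lower (F x))"
    by (rule generic[OF upper_lower_linear(1) upper_lower_scalar(1) upper_lower_linear(2) upper_lower_scalar(2) upper_lower_dirac_alpha(2)])
      (simp add: upper_lower_dirac_beta vec_eq_iff algebra_simps)
qed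

section \<open>Threshold eigenfunctions of the Dirac operator\<close>

lemma japanese_bracket_powr: "japanese_bracket x powr t = (1 + (norm x)\<^sup>2) powr (t / 2)"
proof -
  have "1 + (norm x)\<^sup>2 \<ge> 0" by simp
  then show ?thesis by (simp add: japanese_bracket_def powr_half_sqrt[symmetric] powr_powr)
qed

lemma weight_eq_japanese_bracket: "weight s x = (japanese_bracket x powr (- s))\<^sup>2"
proof -
  have "1 + (norm x)\<^sup>2 > 0" by (simp add: add_pos_nonneg)
  then show ?thesis
    by (simp add: weight_def japanese_bracket_powr power2_eq_square powr_add[symmetric])
qed

lemma square_integrable_component:
  fixes G :: "real^3 \<Rightarrow> complex^'n"
  assumes G: "square_integrable lborel G" and AE: "AE x in lborel. h x = G x $ c"
  shows "h \<in> L2"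
proof -
  have Gm: "(\<lambda>x. G x $ c) \<in> borel_measurable borel"
  proof -
    have "G \<in> borel_measurable borel" using G by (simp add: square_integrable_def)
    then show ?thesis
      by (rule borel_measurable_bounded_linear[OF bounded_linear_vec_nth])
  qed
  have i: "integrable lborel (\<lambda>x. (norm (G x $ c))\<^sup>2)"
    using square_integrable_bound[OF G, of "\<lambda>x. G x $ c" 1] Gm
    by (simp add: square_integrable_def Finite_Cartesian_Product.norm_nth_le)
  have AE2: "AE x in lborel. (norm (h x))\<^sup>2 = (norm (G x $ c))\<^sup>2" using AE by eventually_elim simp
  have "(\<lambda>x. (norm (G x $ c))\<^sup>2) \<in> borel_measurable borel" using Gm by measurable
  from lebesgue_borel_representative[OF this AE2] i
  have "integrable lebesgue (\<lambda>x. (norm (h x))\<^sup>2)" by simp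
  then show ?thesis
    using lebesgue_borel_representative(1)[OF Gm AE] by (simp add: L2_def)
qed

lemma has_square_integrable_gradient_H1:
  assumes G: "square_integrable lborel G" "has_square_integrable_gradient G" and AE: "AE x in lborel. h x = G x $ c"
  shows "h \<in> H1"
  unfolding H1_def
proof (intro CollectI conjI allI)
  show "h \<in> L2" by (rule square_integrable_component[OF G(1) AE])
  fix j
  obtain d where d: "square_integrable lborel d" "\<And>c \<psi>. \<psi> \<in> test_functions \<Longrightarrow>
     (LINT x|lborel. G x $ c * partial j \<psi> x) = - (LINT x|lborel. d x $ c * \<psi> x)"
    using G(2) unfolding has_square_integrable_gradient_def by blast
  have comp: "(\<lambda>x. H x $ c) \<in> borel_measurable borel" if "square_integrable lborel H" for H :: "real^3 \<Rightarrow> complex^2"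
  proof -
    have "H \<in> borel_measurable borel" using that by (simp add: square_integrable_def)
    then show ?thesis
      by (rule borel_measurable_bounded_linear[OF bounded_linear_vec_nth])
  qed
  have "weak_partial j h (\<lambda>x. d x $ c)"
    unfolding weak_partial_def
  proof
    fix \<psi> assume \<psi>: "\<psi> \<in> test_functions"
    have m: "\<phi> \<in> borel_measurable borel" if "\<phi> \<in> test_functions" for \<phi>
      by (intro borel_measurable_continuous_onI test_function_continuous that)
    have 1: "(LINT x|lebesgue. h x * partial j \<psi> x) = (LINT x|lborel. G x $ c * partial j \<psi> x)"
    proof (rule lebesgue_borel_representative(2))
      show "(\<lambda>x. G x $ c * partial j \<psi> x) \<in> borel_measurable borel"
        using comp[OF G(1)] m[OF test_function_partial[OF \<psi>, of j]] by measurable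
      show "AE x in lborel. h x * partial j \<psi> x = G x $ c * partial j \<psi> x" using AE by eventually_elim simp
    qed
    have 2: "(LINT x|lebesgue. d x $ c * \<psi> x) = (LINT x|lborel. d x $ c * \<psi> x)"
    proof (rule lebesgue_borel_representative(2))
      show "(\<lambda>x. d x $ c * \<psi> x) \<in> borel_measurable borel"
        using comp[OF d(1)] m[OF \<psi>] by measurable
    qed simp
    show "(LINT x|lebesgue. h x * partial j \<psi> x) = - (LINT x|lebesgue. d x $ c * \<psi> x)"
      unfolding 1 2 by (rule d(2)[OF \<psi>])
  qed
  moreover have "(\<lambda>x. d x $ c) \<in> L2"
    by (rule square_integrable_component[where c=c, OF d(1)]) simp
  ultimately show "\<exists>v\<in>L2. weak_partial j h v" by blast
qed

lemma norm_square_complex_vec: "(norm (V :: complex^'n))\<^sup>2 = (\<Sum>k\<in>UNIV. (norm (V $ k))\<^sup>2)"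
  by (simp add: power2_norm_eq_inner inner_vec_def)

lemma norm_upper_lower_le: "norm (upper V) \<le> norm V" "norm (lower V) \<le> norm V"
proof -
  have "(norm (upper V))\<^sup>2 \<le> (norm V)\<^sup>2" "(norm (lower V))\<^sup>2 \<le> (norm V)\<^sup>2"
    by (simp_all add: norm_square_complex_vec sum_2 sum_4 upper_def lower_def)
  then show "norm (upper V) \<le> norm V" "norm (lower V) \<le> norm V"
    by (auto intro: power2_le_imp_le)
qed

lemma upper_lower_H1:
  assumes "square_integrable lborel (\<lambda>x. upper (F x))" "has_square_integrable_gradient (\<lambda>x. upper (F x))"
    and "square_integrable lborel (\<lambda>x. lower (F x))" "has_square_integrable_gradient (\<lambda>x. lower (F x))"
    and AE: "AE x in lborel. f x = F x"
  shows "f \<in> componentwise_in H1"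
  unfolding componentwise_in_def
proof (intro CollectI allI)
  fix k :: 4
  consider "k = 1" | "k = 2" | "k = 3" | "k = 4" using exhaust_4[of k] by blast
  then show "(\<lambda>x. f x $ k) \<in> H1"
  proof cases
    case 1
    have "AE x in lborel. f x $ k = upper (F x) $ 1" using AE by eventually_elim (simp add: 1 upper_def)
    then show ?thesis by (rule has_square_integrable_gradient_H1[OF assms(1,2)])
  next
    case 2
    have "AE x in lborel. f x $ k = upper (F x) $ 2" using AE by eventually_elim (simp add: 2 upper_def)
    then show ?thesis by (rule has_square_integrable_gradient_H1[OF assms(1,2)])
  next
    case 3
    have "AE x in lborel. f x $ k = lower (F x) $ 1" using AE by eventually_elim (simp add: 3 lower_def)
    then show ?thesis by (rule has_square_integrable_gradient_H1[OF assms(3,4)])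
  next
    case 4
    have "AE x in lborel. f x $ k = lower (F x) $ 2" using AE by eventually_elim (simp add: 4 lower_def)
    then show ?thesis by (rule has_square_integrable_gradient_H1[OF assms(3,4)])
  qed
qed

lemma weyl_magnetic_scalar: "weyl_magnetic a x (c *s v) = c *s weyl_magnetic a x v"
  by (simp add: weyl_magnetic_def vec_eq_iff pauli_scalar sum_distrib_left algebra_simps)

text \<open>Multiplying \<open>w\<close> by \<open>- \<i>\<close> makes the coupling constant real, as the argument by real inner products
  requires: with an imaginary coupling the pairing of \<open>u\<close> with the source would vanish identically.\<close>

lemma (in weyl_potential) coupled_pair:
  assumes P: "\<And>x c v. P x (c *s v) = c *s P x v"
    and u: "weak_weyl u (\<lambda>x. P x (u x) + (\<i> * of_real 0) *s w x)" "weighted_square_integrable s u"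
    and w: "weak_weyl w (\<lambda>x. P x (w x) + (\<i> * of_real \<kappa>) *s u x)" "weighted_square_integrable s w"
    and \<kappa>: "\<kappa> \<noteq> 0" and s: "0 \<le> s" "s < 1" "s \<le> \<rho> - 1"
  shows "AE x in lborel. u x = 0"
    and "square_integrable lborel u" "has_square_integrable_gradient u"
    and "square_integrable lborel w" "has_square_integrable_gradient w"
proof -
  have u': "weak_weyl u (\<lambda>x. P x (u x))" using u(1) by simp
  have "weak_weyl (\<lambda>x. (- \<i>) *s w x) (\<lambda>x. (- \<i>) *s (P x (w x) + (\<i> * of_real \<kappa>) *s u x))"
    by (rule weak_weyl_scalar[OF w(1)])
  also have "(\<lambda>x. (- \<i>) *s (P x (w x) + (\<i> * of_real \<kappa>) *s u x)) = (\<lambda>x. P x ((- \<i>) *s w x) + \<kappa> *\<^sub>R u x)"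
    by (simp only: P fun_eq_iff) (simp add: vec_eq_iff algebra_simps scaleR_conv_of_real[where 'a=complex])
  finally have w': "weak_weyl (\<lambda>x. (- \<i>) *s w x) (\<lambda>x. P x ((- \<i>) *s w x) + \<kappa> *\<^sub>R u x)" .
  have n: "norm ((- \<i>) *s v) = norm v" for v :: "complex^2" by (simp add: norm_vector_scalar_mult)
  have bm: "(\<lambda>x. c *s v x) \<in> borel_measurable borel" if "v \<in> borel_measurable borel" for v :: "real^3 \<Rightarrow> complex^2" and c
    using that by (intro borel_measurable_bounded_bilinear[OF bounded_bilinear_vector_scalar_mult]) auto
  have ws: "weighted_square_integrable s (\<lambda>x. (- \<i>) *s w x)"
    using w(2) bm[of w "- \<i>"] unfolding weighted_square_integrable_def n by blast
  note pair = solution_pair[OF u' u(2) w' ws \<kappa> s]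
  show "AE x in lborel. u x = 0" "square_integrable lborel u" "has_square_integrable_gradient u"
    by (rule pair)+
  show "square_integrable lborel w"
    using pair(4) w(2) unfolding square_integrable_def weighted_square_integrable_def n by simp
  show "has_square_integrable_gradient w"
    unfolding has_square_integrable_gradient_def
  proof
    fix k
    obtain d where d: "square_integrable lborel d" "\<And>c \<psi>. \<psi> \<in> test_functions \<Longrightarrow>
       (LINT x|lborel. ((- \<i>) *s w x) $ c * partial k \<psi> x) = - (LINT x|lborel. d x $ c * \<psi> x)"
      using pair(5) unfolding has_square_integrable_gradient_def by blast
    have dm: "d \<in> borel_measurable borel" using d(1) by (simp add: square_integrable_def)
    have "square_integrable lborel (\<lambda>x. \<i> *s d x)"
      by (rule square_integrable_bound[where c=1, OF d(1)]) (use bm[OF dm] in \<open>simp_all add: norm_vector_scalar_mult\<close>)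
    moreover have "(LINT x|lborel. w x $ c * partial k \<psi> x) = - (LINT x|lborel. (\<i> *s d x) $ c * \<psi> x)"
      if "\<psi> \<in> test_functions" for c \<psi>
    proof -
      have "(- \<i>) * (LINT x|lborel. w x $ c * partial k \<psi> x) = - (LINT x|lborel. d x $ c * \<psi> x)"
        using d(2)[OF that, of c] by (simp add: mult.assoc)
      then have "\<i> * ((- \<i>) * (LINT x|lborel. w x $ c * partial k \<psi> x)) = \<i> * - (LINT x|lborel. d x $ c * \<psi> x)" by (simp only:)
      then show ?thesis by (simp add: mult.assoc)
    qed
    ultimately show "\<exists>d. square_integrable lborel d \<and> (\<forall>c. \<forall>\<psi>\<in>test_functions.
       (LINT x|lborel. w x $ c * partial k \<psi> x) = - (LINT x|lborel. d x $ c * \<psi> x))" by blast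
  qed
qed


lemma distribution_of_borel_representative:
  fixes G :: "real^3 \<Rightarrow> complex^'n"
  assumes G: "G \<in> borel_measurable borel" and AE: "AE x in lborel. g x = G x" and \<psi>: "\<psi> \<in> test_functions"
  shows "distribution_of g \<psi> = (LINT x|lborel. \<psi> x *s G x)"
  unfolding distribution_of_def
proof (rule lebesgue_borel_representative(2))
  show "(\<lambda>x. \<psi> x *s G x) \<in> borel_measurable borel"
    by (intro borel_measurable_bounded_bilinear[OF bounded_bilinear_vector_scalar_mult]
        borel_measurable_continuous_onI test_function_continuous \<psi> G)
  show "AE x in lborel. \<psi> x *s g x = \<psi> x *s G x" using AE by eventually_elim simp
qed

text \<open>Clamping a Borel representative changes it on a null set only and makes the bound hold everywhere.\<close>

lemma bounded_vector_potential_representative: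
  assumes A: "\<And>j. (\<lambda>x. A x $ j) \<in> borel_measurable lebesgue"
    and b: "b \<in> borel_measurable borel" "\<And>x. b x \<ge> 0" and A_le: "\<And>j x. \<bar>A x $ j\<bar> \<le> b x"
  obtains a :: "real^3 \<Rightarrow> real^3" where "a \<in> borel_measurable borel" "AE x in lborel. A x = a x" "\<And>j x. \<bar>a x $ j\<bar> \<le> b x"
proof -
  have "A \<in> borel_measurable lebesgue" by (rule borel_measurable_vec[OF A])
  then obtain a0 where a0: "a0 \<in> borel_measurable borel" "AE x in lborel. A x = a0 x"
    by (rule borel_representative)
  define a where "a x = (\<chi> j. max (- b x) (min (b x) (a0 x $ j)))" for x
  have "a \<in> borel_measurable borel"
  proof (rule borel_measurable_vec)
    fix j
    have "(\<lambda>x. a0 x $ j) \<in> borel_measurable borel"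
      by (rule borel_measurable_bounded_linear[OF bounded_linear_vec_nth a0(1)])
    then show "(\<lambda>x. a x $ j) \<in> borel_measurable borel"
      unfolding a_def using b(1) by simp
  qed
  moreover have "AE x in lborel. A x = a x"
    using a0(2)
  proof eventually_elim
    case (elim x)
    have "max (- b x) (min (b x) (A x $ j)) = A x $ j" for j using A_le[of x j] by (simp add: abs_le_iff)
    then show ?case using elim by (simp add: a_def vec_eq_iff)
  qed
  moreover have "\<bar>a x $ j\<bar> \<le> b x" for j x using b(2)[of x] by (simp add: a_def abs_le_iff)
  ultimately show ?thesis by (rule that)
qed

lemma weighted_L2_representative:
  fixes f :: "real^3 \<Rightarrow> complex^4"
  assumes f: "f \<in> componentwise_in (weighted_L2 (- s))"
  obtains F where "AE x in lborel. f x = F x" "weighted_square_integrable s F"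
proof -
  have L: "(\<lambda>x. complex_of_real (japanese_bracket x powr (- s)) * f x $ k) \<in> borel_measurable lebesgue"
    "integrable lebesgue (\<lambda>x. (norm (complex_of_real (japanese_bracket x powr (- s)) * f x $ k))\<^sup>2)" for k
    using f by (auto simp: componentwise_in_def weighted_L2_def L2_def)
  have jb: "(\<lambda>x. complex_of_real (japanese_bracket x powr s)) \<in> borel_measurable lebesgue"
    unfolding japanese_bracket_powr by (intro measurable_completion) simp
  have "(\<lambda>x. f x $ k) \<in> borel_measurable lebesgue" for k
  proof -
    have "complex_of_real (japanese_bracket x powr s) * (complex_of_real (japanese_bracket x powr (- s)) * f x $ k) = f x $ k" for x
    proof -
      have "1 + (norm x)\<^sup>2 > 0" by (simp add: add_pos_nonneg)
      then have "japanese_bracket x powr s * japanese_bracket x powr (- s) = 1"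
        by (simp add: japanese_bracket_powr powr_add[symmetric])
      then show ?thesis by (simp add: mult.assoc[symmetric] of_real_mult[symmetric] del: of_real_mult)
    qed
    then show ?thesis using borel_measurable_times[OF jb L(1)[of k]] by (simp only:)
  qed
  then have "f \<in> borel_measurable lebesgue" by (rule borel_measurable_vec)
  then obtain F where F: "F \<in> borel_measurable borel" "AE x in lborel. f x = F x"
    by (rule borel_representative)
  have Fk: "(\<lambda>x. F x $ k) \<in> borel_measurable borel" for k
    by (rule borel_measurable_bounded_linear[OF bounded_linear_vec_nth F(1)])
  have "integrable lborel (\<lambda>x. weight s x * (norm (F x $ k))\<^sup>2)" for k
  proof -
    have m: "(\<lambda>x. weight s x * (norm (F x $ k))\<^sup>2) \<in> borel_measurable borel"
      using Fk[of k] weight_measurable[of s] by measurable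
    have "AE x in lborel. (norm (complex_of_real (japanese_bracket x powr (- s)) * f x $ k))\<^sup>2 = weight s x * (norm (F x $ k))\<^sup>2"
      using F(2) by eventually_elim (simp add: weight_eq_japanese_bracket norm_mult power_mult_distrib)
    from lebesgue_borel_representative(3)[OF m this] L(2) show ?thesis by simp
  qed
  then have "integrable lborel (\<lambda>x. \<Sum>k\<in>UNIV. weight s x * (norm (F x $ k))\<^sup>2)"
    by (intro Bochner_Integration.integrable_sum)
  then have "weighted_square_integrable s F"
    using F(1) by (simp add: weighted_square_integrable_def norm_square_complex_vec sum_distrib_left)
  then show ?thesis using that F(2) by blast
qed

lemma weighted_square_integrable_bounded_image:
  assumes F: "weighted_square_integrable s F" and p: "bounded_linear p" "\<And>V. norm (p V) \<le> norm V"
  shows "weighted_square_integrable s (\<lambda>x. p (F x) :: 'b::euclidean_space)"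
  unfolding weighted_square_integrable_def
proof
  have Fm: "F \<in> borel_measurable borel" using F by (simp add: weighted_square_integrable_def)
  show pm: "(\<lambda>x. p (F x)) \<in> borel_measurable borel"
    by (rule borel_measurable_bounded_linear[OF p(1) Fm])
  show "integrable lborel (\<lambda>x. weight s x * (norm (p (F x)))\<^sup>2)"
  proof (rule Bochner_Integration.integrable_bound)
    show "integrable lborel (\<lambda>x. weight s x * (norm (F x))\<^sup>2)" using F by (simp add: weighted_square_integrable_def)
    show "(\<lambda>x. weight s x * (norm (p (F x)))\<^sup>2) \<in> borel_measurable lborel"
      using pm weight_measurable[of s] by measurable
    show "AE x in lborel. norm (weight s x * (norm (p (F x)))\<^sup>2) \<le> norm (weight s x * (norm (F x))\<^sup>2)"
    proof (intro always_eventually allI)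
      fix x
      have "(norm (p (F x)))\<^sup>2 \<le> (norm (F x))\<^sup>2" by (intro power_mono p(2)) simp
      then show "norm (weight s x * (norm (p (F x)))\<^sup>2) \<le> norm (weight s x * (norm (F x))\<^sup>2)"
        using weight_pos[of s x] by (simp add: abs_mult mult_left_mono)
    qed
  qed
qed

theorem theorem6p1:
  fixes m \<rho> C s :: real
    and A :: "real^3 \<Rightarrow> real^3"
    and f :: "real^3 \<Rightarrow> complex^4"
  assumes "m > 0"
    and "\<And>j. (\<lambda>x. A x $ j) \<in> borel_measurable lebesgue"
    and "\<rho> > 3/2" and "C > 0"
    and "\<And>j x. \<bar>A x $ j\<bar> \<le> C * japanese_bracket x powr (-\<rho>)"
    and "0 < s" and "s < min 1 (\<rho> - 1)"
    and "f \<in> componentwise_in (weighted_L2 (-s))"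
  shows "(distr_eq (dirac_operator m A f) (distribution_of (\<lambda>x. complex_of_real m *s f x))
            \<longrightarrow> f \<in> componentwise_in H1 \<and> (AE x in lebesgue. lower_spinor f x = 0))
       \<and> (distr_eq (dirac_operator m A f) (distribution_of (\<lambda>x. complex_of_real (-m) *s f x))
            \<longrightarrow> f \<in> componentwise_in H1 \<and> (AE x in lebesgue. upper_spinor f x = 0))"
proof -
  have s: "0 \<le> s" "s < 1" "s \<le> \<rho> - 1" using assms by auto
  define b where "b x = C * (1 + (norm x)\<^sup>2) powr (- \<rho> / 2)" for x :: "real^3"
  have b: "b \<in> borel_measurable borel" "\<And>x. b x \<ge> 0"
    using assms(4) unfolding b_def by (measurable, simp)
  have A_le: "\<bar>A x $ j\<bar> \<le> b x" for j x
    using assms(5)[of x j] by (simp add: b_def japanese_bracket_powr)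
  obtain a where a: "a \<in> borel_measurable borel" "AE x in lborel. A x = a x" "\<And>j x. \<bar>a x $ j\<bar> \<le> b x"
    using bounded_vector_potential_representative[OF assms(2) b A_le] by blast
  obtain F where F: "AE x in lborel. f x = F x" "weighted_square_integrable s F"
    using weighted_L2_representative[OF assms(8)] by blast
  have Fm: "F \<in> borel_measurable borel" using F(2) by (simp add: weighted_square_integrable_def)
  note Fl = weighted_loc_square_integrable[OF F(2) s(1)]
  interpret weyl_potential "weyl_magnetic a" "9 * C\<^sup>2" \<rho>
    by (rule weyl_magnetic_potential[OF a(1)]) (use a(3) assms in \<open>simp_all add: b_def\<close>)
  have b_le: "b x \<le> C" for x
    using powr_mono2'[of "- \<rho> / 2" 1 "1 + (norm x)\<^sup>2"] assms(3,4) by (simp add: b_def mult_left_le)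
  have aFm: "(\<lambda>x. complex_of_real (a x $ j) *s F x) \<in> borel_measurable borel" for j
  proof -
    have "(\<lambda>x. a x $ j) \<in> borel_measurable borel"
      by (rule borel_measurable_bounded_linear[OF bounded_linear_vec_nth a(1)])
    then show ?thesis unfolding vector_scalar_mult_of_real by (intro borel_measurable_scaleR Fm)
  qed
  have aFl: "loc_integrable (\<lambda>x. complex_of_real (a x $ j) *s F x)" for j
  proof (rule loc_square_integrable_loc_integrable, rule loc_square_integrable_bound[where c=C, OF Fl aFm])
    show "norm (complex_of_real (a x $ j) *s F x) \<le> C * norm (F x)" for x
      using order_trans[OF a(3) b_le, of x j] by (simp add: norm_vector_scalar_mult mult_right_mono)
  qed
  have components: "weak_weyl (\<lambda>x. lower (F x)) (\<lambda>x. weyl_magnetic a x (lower (F x)) + (\<i> * of_real (\<mu> - m)) *s upper (F x))"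
    "weak_weyl (\<lambda>x. upper (F x)) (\<lambda>x. weyl_magnetic a x (upper (F x)) + (\<i> * of_real (\<mu> + m)) *s lower (F x))"
    if eigen: "distr_eq (dirac_operator m A f) (distribution_of (\<lambda>x. complex_of_real \<mu> *s f x))" for \<mu>
  proof -
    have eq: "(\<Sum>j\<in>UNIV. dirac_alpha j *v ((1 / \<i>) *s (- (LINT x|lborel. partial j \<psi> x *s F x))
        - (LINT x|lborel. \<psi> x *s (complex_of_real (a x $ j) *s F x))))
      + complex_of_real m *s (dirac_beta *v (LINT x|lborel. \<psi> x *s F x)) = complex_of_real \<mu> *s (LINT x|lborel. \<psi> x *s F x)"
      if \<psi>: "\<psi> \<in> test_functions" for \<psi>
    proof -
      have 1: "distribution_of f \<phi> = (LINT x|lborel. \<phi> x *s F x)" if "\<phi> \<in> test_functions" for \<phi>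
        by (rule distribution_of_borel_representative[OF Fm F(1) that])
      have 2: "distribution_of (\<lambda>x. complex_of_real (A x $ j) *s f x) \<psi> = (LINT x|lborel. \<psi> x *s (complex_of_real (a x $ j) *s F x))" for j
        by (rule distribution_of_borel_representative[OF aFm _ \<psi>])
          (use F(1) a(2) in eventually_elim, simp)
      have "distribution_of (\<lambda>x. complex_of_real \<mu> *s f x) \<psi> = (LINT x|lborel. \<psi> x *s (complex_of_real \<mu> *s F x))"
        by (rule distribution_of_borel_representative[OF _ _ \<psi>])
          (use Fm in \<open>simp add: vector_scalar_mult_of_real borel_measurable_scaleR\<close>, use F(1) in eventually_elim, simp)
      also have "\<dots> = (LINT x|lborel. \<mu> *\<^sub>R (\<psi> x *s F x))"
        by (rule arg_cong[where f="integral\<^sup>L lborel"])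
          (simp add: fun_eq_iff vec_eq_iff scaleR_conv_of_real[where 'a=complex])
      also have "\<dots> = complex_of_real \<mu> *s (LINT x|lborel. \<psi> x *s F x)"
        by (simp add: vector_scalar_mult_of_real)
      finally show ?thesis
        using bspec[OF eigen[unfolded distr_eq_def] \<psi>]
        by (simp add: dirac_operator_def distr_D_def distr_partial_def 1 2 \<psi> test_function_partial)
    qed
    show "weak_weyl (\<lambda>x. lower (F x)) (\<lambda>x. weyl_magnetic a x (lower (F x)) + (\<i> * of_real (\<mu> - m)) *s upper (F x))"
      "weak_weyl (\<lambda>x. upper (F x)) (\<lambda>x. weyl_magnetic a x (upper (F x)) + (\<i> * of_real (\<mu> + m)) *s lower (F x))"
      by (rule dirac_eigenvalue_equation_components[OF loc_square_integrable_loc_integrable[OF Fl] aFl eq]; assumption)+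
  qed
  have U: "weighted_square_integrable s (\<lambda>x. upper (F x))"
    by (rule weighted_square_integrable_bounded_image[OF F(2) upper_lower_linear(1) norm_upper_lower_le(1)])
  have L: "weighted_square_integrable s (\<lambda>x. lower (F x))"
    by (rule weighted_square_integrable_bounded_image[OF F(2) upper_lower_linear(2) norm_upper_lower_le(2)])
  show ?thesis
  proof (intro conjI impI)
    assume "distr_eq (dirac_operator m A f) (distribution_of (\<lambda>x. complex_of_real m *s f x))"
    note c = components[OF this]
    have l: "weak_weyl (\<lambda>x. lower (F x)) (\<lambda>x. weyl_magnetic a x (lower (F x)) + (\<i> * of_real 0) *s upper (F x))"
      using c(1) by simp
    have "m + m \<noteq> 0" using assms(1) by simp
    note pair = coupled_pair[OF weyl_magnetic_scalar l L c(2) U this s]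
    show "f \<in> componentwise_in H1" by (rule upper_lower_H1[OF pair(4,5,2,3) F(1)])
    have "AE x in lborel. lower_spinor f x = 0"
      using pair(1) F(1) by eventually_elim (simp add: lower_spinor_def lower_def)
    then show "AE x in lebesgue. lower_spinor f x = 0" by (rule AE_completion)
  next
    assume "distr_eq (dirac_operator m A f) (distribution_of (\<lambda>x. complex_of_real (-m) *s f x))"
    note c = components[OF this]
    have u: "weak_weyl (\<lambda>x. upper (F x)) (\<lambda>x. weyl_magnetic a x (upper (F x)) + (\<i> * of_real 0) *s lower (F x))"
      using c(2) by simp
    have "- m - m \<noteq> 0" using assms(1) by simp
    note pair = coupled_pair[OF weyl_magnetic_scalar u U c(1) L this s]
    show "f \<in> componentwise_in H1" by (rule upper_lower_H1[OF pair(2,3,4,5) F(1)])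
    have "AE x in lborel. upper_spinor f x = 0"
      using pair(1) F(1) by eventually_elim (simp add: upper_spinor_def upper_def)
    then show "AE x in lebesgue. upper_spinor f x = 0" by (rule AE_completion)
  qed
qed

end
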